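(* Let $(X_t)_{t\ge 0}$ be continuous-time simple random walk on $\mathbb{Z}$ with local times $\ell_T(x)=\int_0^T\mathbf{1}_{\{X_s=x\}}\,\mathrm{d}s$, $x\in\mathbb{Z}$, $T>0$. Let $b\in\mathbb{N}$ and $h>0$, and let $T_b^h=\inf\{t>0\colon\ell_t(b)>h\}$. (i) Under $\mathbb{P}_0$, the process $\big(\ell_{T_b^h}(b-x)\big)_{x=0}^{b}$ is a time-homogeneous discrete-time Markov chain on $(0,\infty)$, starting at $h$, with transition density given by $$f(h_1,h_2)=\mathrm{e}^{-h_1-h_2}I_0\big(2\sqrt{h_1h_2}\big),\qquad h_1,h_2\in(0,\infty).$$ (ii) Under $\mathbb{P}_0$, the processes $\big(\ell_{T_b^h}(b+x)\big)_{x\in\mathbb{N}_0}$ and $\big(\ell_{T_b^h}(-x)\big)_{x\in\mathbb{N}_0}$ are time-homogeneous discrete-time Markov chains on $[0,\infty)$ with transition probabilities given by $$P^\star(h_1,\mathrm{d}h_2)=\mathrm{e}^{-h_1}\delta_0(\mathrm{d}h_2)+\mathrm{e}^{-h_1-h_2}\sqrt{\frac{h_1}{h_2}}\,I_0'\big(2\sqrt{h_1h_2}\big)\,\mathrm{d}h_2,\qquad h_1,h_2\in[0,\infty).$$ (iii) The three Markov chains in (i) and (ii) are independent.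
   Context: Continuous-time simple random walk on $\mathbb{Z}$ is the Markov chain with generator $A_{x,y}=1$ if $|x-y|=1$, $A_{x,x}=-2$, and $A_{x,y}=0$ otherwise; under $\mathbb{P}_0$ it starts at $0$. $\mathbb{N}=\{1,2,\dots\}$ and $\mathbb{N}_0=\{0,1,2,\dots\}$. $I_0$ is the modified Bessel function $I_0(h)=\sum_{i=0}^\infty\frac{h^{2i}}{2^{2i}(i!)^2}$, and $I_0'$ is its derivative. $\delta_0$ is the unit mass at $0$. The map $h\mapsto T_b^h$ is the right-continuous inverse of $t\mapsto\ell_t(b)$.
   Formalization: In (iii), since the chain in (i) ends at the random value where the chain at −x starts, independence is read as: the chain at b+x is independent of the other two jointly, and those two are conditionally independent given their common value, the local time at 0. *)

theory Defs
  imports "HOL-Probability.Probability"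
begin

definition transition_function :: "(real \<Rightarrow> 's \<Rightarrow> 's \<Rightarrow> real) \<Rightarrow> bool" where
  "transition_function P \<longleftrightarrow>
     (\<forall>t\<ge>0. \<forall>x y. 0 \<le> P t x y) \<and>
     (\<forall>t\<ge>0. \<forall>x. (P t x has_sum 1) UNIV) \<and>
     (\<forall>x y. P 0 x y = of_bool (x = y)) \<and>
     (\<forall>s\<ge>0. \<forall>t\<ge>0. \<forall>x y. ((\<lambda>z. P s x z * P t z y) has_sum P (s + t) x y) UNIV)"

definition has_generator :: "(real \<Rightarrow> 's \<Rightarrow> 's \<Rightarrow> real) \<Rightarrow> ('s \<Rightarrow> 's \<Rightarrow> real) \<Rightarrow> bool" where
  "has_generator P A \<longleftrightarrow>
     (\<forall>x y. ((\<lambda>t. (P t x y - P 0 x y) / t) \<longlongrightarrow> A x y) (at_right 0))"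

text \<open>Only the times \<open>t \<ge> 0\<close> of the process matter. Paths are right-continuous with left limits
  in the discrete topology of the state space. The Markov property
  \<open>Pr(X(t\<^sub>n\<^sub>+\<^sub>1) = y | X(t\<^sub>0) = x\<^sub>0, \<dots>, X(t\<^sub>n) = x\<^sub>n) = P (t\<^sub>n\<^sub>+\<^sub>1 - t\<^sub>n) x\<^sub>n y\<close> is stated in product form,
  to avoid conditioning on null events.\<close>

definition ctmc ::
  "'a measure \<Rightarrow> ('s \<Rightarrow> 's \<Rightarrow> real) \<Rightarrow> 's \<Rightarrow> (real \<Rightarrow> 'a \<Rightarrow> 's) \<Rightarrow> bool" where
  "ctmc M A x\<^sub>0 X \<longleftrightarrow>
     prob_space M \<and>
     (\<forall>t\<ge>0. X t \<in> M \<rightarrow>\<^sub>M count_space UNIV) \<and>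
     (\<forall>\<omega>\<in>space M. \<forall>t\<ge>0. \<forall>\<^sub>F s in at_right t. X s \<omega> = X t \<omega>) \<and>
     (\<forall>\<omega>\<in>space M. \<forall>t>0. \<exists>x. \<forall>\<^sub>F s in at_left t. X s \<omega> = x) \<and>
     (AE \<omega> in M. X 0 \<omega> = x\<^sub>0) \<and>
     (\<exists>P. transition_function P \<and> has_generator P A \<and>
       (\<forall>n (t :: nat \<Rightarrow> real) x. 0 \<le> t 0 \<longrightarrow> (\<forall>i\<le>n. t i \<le> t (Suc i)) \<longrightarrow>
          measure M {\<omega>\<in>space M. \<forall>i\<le>Suc n. X (t i) \<omega> = x i} =
          measure M {\<omega>\<in>space M. \<forall>i\<le>n. X (t i) \<omega> = x i} * P (t (Suc n) - t n) (x n) (x (Suc n))))"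

definition srw_generator :: "int \<Rightarrow> int \<Rightarrow> real" where
  "srw_generator x y = (if \<bar>x - y\<bar> = 1 then 1 else if x = y then -2 else 0)"

text \<open>The time horizon is extended real, because the inverse local time is \<open>\<infinity>\<close> on the null event
  that the local time at \<open>b\<close> never exceeds \<open>h\<close> (\<open>Inf {} = \<infinity>\<close>).\<close>

definition local_time :: "(real \<Rightarrow> 'a \<Rightarrow> int) \<Rightarrow> ereal \<Rightarrow> int \<Rightarrow> 'a \<Rightarrow> real" where
  "local_time X T x \<omega> = (LBINT s=0..T. indicator {x} (X s \<omega>))"

definition inverse_local_time :: "(real \<Rightarrow> 'a \<Rightarrow> int) \<Rightarrow> int \<Rightarrow> real \<Rightarrow> 'a \<Rightarrow> ereal" where
  "inverse_local_time X b h \<omega> = Inf {ereal t | t. 0 < t \<and> local_time X (ereal t) b \<omega> > h}"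

definition stopped_local_time ::
  "(real \<Rightarrow> 'a \<Rightarrow> int) \<Rightarrow> int \<Rightarrow> real \<Rightarrow> int \<Rightarrow> 'a \<Rightarrow> real" where
  "stopped_local_time X b h x \<omega> = local_time X (inverse_local_time X b h \<omega>) x \<omega>"

text \<open>The index set \<open>I\<close> is an initial segment of the naturals, or all of them. The Markov property
  is with respect to the filtration generated by the process.\<close>

definition sample_path :: "nat set \<Rightarrow> (nat \<Rightarrow> 'a \<Rightarrow> real) \<Rightarrow> 'a \<Rightarrow> nat \<Rightarrow> real" where
  "sample_path I Y \<omega> = (\<lambda>n\<in>I. Y n \<omega>)"

abbreviation path_space :: "nat set \<Rightarrow> (nat \<Rightarrow> real) measure" where
  "path_space I \<equiv> PiM I (\<lambda>_. borel)"

definition markov_chain_on ::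
  "'a measure \<Rightarrow> nat set \<Rightarrow> real set \<Rightarrow> (real \<Rightarrow> real measure) \<Rightarrow> (nat \<Rightarrow> 'a \<Rightarrow> real) \<Rightarrow> bool" where
  "markov_chain_on M I S K Y \<longleftrightarrow>
     K \<in> restrict_space borel S \<rightarrow>\<^sub>M prob_algebra (restrict_space borel S) \<and>
     (\<forall>n\<in>I. Y n \<in> borel_measurable M \<and> (AE \<omega> in M. Y n \<omega> \<in> S)) \<and>
     (\<forall>n. n \<in> I \<longrightarrow> Suc n \<in> I \<longrightarrow> (\<forall>B\<in>sets (restrict_space borel S).
        AE \<omega> in M.
          real_cond_exp M (vimage_algebra (space M) (sample_path {..n} Y) (path_space {..n}))
            (indicator (Y (Suc n) -` B \<inter> space M)) \<omega>
          = measure (K (Y n \<omega>)) B))"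

definition cond_indep_var ::
  "'a measure \<Rightarrow> 'a measure \<Rightarrow> 'b measure \<Rightarrow> ('a \<Rightarrow> 'b) \<Rightarrow> 'c measure \<Rightarrow> ('a \<Rightarrow> 'c) \<Rightarrow> bool" where
  "cond_indep_var M F N\<^sub>1 Z\<^sub>1 N\<^sub>2 Z\<^sub>2 \<longleftrightarrow>
     Z\<^sub>1 \<in> M \<rightarrow>\<^sub>M N\<^sub>1 \<and> Z\<^sub>2 \<in> M \<rightarrow>\<^sub>M N\<^sub>2 \<and>
     (\<forall>B\<^sub>1\<in>sets N\<^sub>1. \<forall>B\<^sub>2\<in>sets N\<^sub>2. AE \<omega> in M.
        real_cond_exp M F (indicator (Z\<^sub>1 -` B\<^sub>1 \<inter> Z\<^sub>2 -` B\<^sub>2 \<inter> space M)) \<omega> =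
        real_cond_exp M F (indicator (Z\<^sub>1 -` B\<^sub>1 \<inter> space M)) \<omega> *
        real_cond_exp M F (indicator (Z\<^sub>2 -` B\<^sub>2 \<inter> space M)) \<omega>)"

text \<open>Independence of the three chains. The chain \<open>Y\<^sub>1\<close>, indexed by \<open>0,\<dots>,b\<close>, ends at the random
  point at which \<open>Y\<^sub>3\<close> starts (\<open>Y\<^sub>1 b = Y\<^sub>3 0\<close>), so the two cannot be independent as random sequences;
  independence of the chains means that they are independent given this common value. The chain
  \<open>Y\<^sub>2\<close> shares only its deterministic starting point with \<open>Y\<^sub>1\<close> and is independent of the pair.\<close>

definition independent_chains ::
  "'a measure \<Rightarrow> nat \<Rightarrow> (nat \<Rightarrow> 'a \<Rightarrow> real) \<Rightarrow> (nat \<Rightarrow> 'a \<Rightarrow> real) \<Rightarrow> (nat \<Rightarrow> 'a \<Rightarrow> real) \<Rightarrow> bool" where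
  "independent_chains M b Y\<^sub>1 Y\<^sub>2 Y\<^sub>3 \<longleftrightarrow>
     prob_space.indep_set M
       (sets (vimage_algebra (space M) (sample_path UNIV Y\<^sub>2) (path_space UNIV)))
       (sets (vimage_algebra (space M)
          (\<lambda>\<omega>. (sample_path {..b} Y\<^sub>1 \<omega>, sample_path UNIV Y\<^sub>3 \<omega>))
          (path_space {..b} \<Otimes>\<^sub>M path_space UNIV))) \<and>
     cond_indep_var M (vimage_algebra (space M) (Y\<^sub>3 0) borel)
       (path_space {..b}) (sample_path {..b} Y\<^sub>1)
       (path_space UNIV) (sample_path UNIV Y\<^sub>3)"

definition bessel_I0 :: "real \<Rightarrow> real" where
  "bessel_I0 h = (\<Sum>i. h ^ (2 * i) / (2 ^ (2 * i) * (fact i)\<^sup>2))"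

definition between_density :: "real \<Rightarrow> real \<Rightarrow> real" where
  "between_density h\<^sub>1 h\<^sub>2 = exp (- h\<^sub>1 - h\<^sub>2) * bessel_I0 (2 * sqrt (h\<^sub>1 * h\<^sub>2))"

definition between_kernel :: "real \<Rightarrow> real measure" where
  "between_kernel h\<^sub>1 =
     density (restrict_space lborel {0<..}) (\<lambda>h\<^sub>2. ennreal (between_density h\<^sub>1 h\<^sub>2))"

definition outer_density :: "real \<Rightarrow> real \<Rightarrow> real" where
  "outer_density h\<^sub>1 h\<^sub>2 =
     exp (- h\<^sub>1 - h\<^sub>2) * sqrt (h\<^sub>1 / h\<^sub>2) * deriv bessel_I0 (2 * sqrt (h\<^sub>1 * h\<^sub>2))"

definition outer_kernel :: "real \<Rightarrow> real measure" where
  "outer_kernel h\<^sub>1 =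
     measure_of {0..} (sets (restrict_space borel {0..}))
       (\<lambda>B. ennreal (exp (- h\<^sub>1)) * indicator B 0
            + (\<integral>\<^sup>+h\<^sub>2\<in>B. ennreal (outer_density h\<^sub>1 h\<^sub>2) \<partial>lborel))"

end

theory Submission
  imports Defs "HOL-Real_Asymp.Real_Asymp"
begin

text \<open>
  Everything is read off from one Laplace functional. Let \<open>T\<close> be the inverse local time, and let \<open>u\<close> be a
  bounded function with \<open>u(b) = 1\<close> that satisfies \<open>u(x + 1) + u(x - 1) - 2 u(x) = q(x) u(x)\<close> for \<open>x \<noteq> b\<close>,
  where \<open>q \<ge> 0\<close> has finite support. With \<open>V(x) = q(x)\<close> off \<open>b\<close> and
  \<open>V(b) = u(b + 1) + u(b - 1) - 2 \<le> 0\<close>, the process \<open>u(X\<^sub>t) exp(- \<integral>\<^sub>0\<^sup>t V(X\<^sub>s) ds)\<close> is a martingale, and it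
  is bounded up to \<open>T\<close>, since the local time at \<open>b\<close> is at most \<open>h\<close> until then. At \<open>T\<close> the walk is at \<open>b\<close>
  and has spent time exactly \<open>h\<close> there, so stopping gives (\<open>laplace_functional\<close>)
  \<open>E exp(- \<Sum> q(x) \<ell>\<^sub>T(x)) = u(0) exp(h (u(b + 1) + u(b - 1) - 2))\<close>.
  That \<open>T\<close> is finite follows from the same martingale with \<open>u(x) = \<rho>^\<bar>x - b\<bar>\<close> as \<open>\<rho>\<close> tends to \<open>1\<close>.

  The point \<open>b\<close> splits the equation for \<open>u\<close> into two sides. On each side the ratio of the values of \<open>u\<close>
  at consecutive sites, going away from \<open>b\<close>, is \<open>1 / (1 + s)\<close>, where the effective rate \<open>s\<close> of a site is its
  own rate \<open>q\<close> plus \<open>s' / (1 + s')\<close> for the effective rate \<open>s'\<close> of the next site. On the other hand, both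
  kernels are Poisson mixtures of gamma laws, and their Laplace transforms at \<open>s\<close> are
  \<open>exp(- y s / (1 + s))\<close> for the outer kernel and \<open>exp(- y s / (1 + s)) / (1 + s)\<close> for the kernel between \<open>b\<close>
  and the starting point. So the outermost site can be cut off, at the price of adding \<open>s / (1 + s)\<close> to the
  rate of its neighbour: this is the Markov property on the level of transforms. For sites between \<open>b\<close> and
  the starting point, \<open>u(0)\<close> contributes one more ratio \<open>1 / (1 + s)\<close>, which is the additional factor in
  the transform of the first kernel.

  The two sides of \<open>b\<close> contribute separate factors, so they are independent; and all sites beyond the
  starting point together act as one rate at the starting point, so they are independent of the sites
  between, given the local time at the starting point. Laplace transforms determine laws on path spaces, also
  in the presence of bounded weights (\<open>sample_path_laplace_unique\<close>), which turns these identities into statements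
  about events.

  Optional stopping is proved by hand on dyadic grids: one step of the discretised martingale has a
  conditional expectation whose error is \<open>o(mesh)\<close> at each state, with a uniform bound \<open>O(mesh)\<close>; the accumulated
  error is a Riemann sum along the path and tends to \<open>0\<close> by dominated convergence.
\<close>

section \<open>The transition operators of the walk\<close>

locale srw_semigroup =
  fixes P :: "real \<Rightarrow> int \<Rightarrow> int \<Rightarrow> real"
  assumes transition: "transition_function P"
    and generator: "has_generator P srw_generator"
begin

lemma P_nonneg: "0 \<le> t \<Longrightarrow> 0 \<le> P t x y"
  using transition by (auto simp: transition_function_def)

lemma P_zero: "P 0 x y = of_bool (x = y)"
  using transition by (auto simp: transition_function_def)

lemma P_has_sum: "0 \<le> t \<Longrightarrow> (P t x has_sum 1) UNIV"
  using transition by (auto simp: transition_function_def)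

definition law :: "real \<Rightarrow> int \<Rightarrow> int pmf" where
  "law t x = embed_pmf (P t x)"

lemma pmf_law: "0 \<le> t \<Longrightarrow> pmf (law t x) y = P t x y"
proof -
  assume t: "0 \<le> t"
  have "(\<integral>\<^sup>+y. ennreal (P t x y) \<partial>count_space UNIV) = 1"
  proof -
    have "(P t x) summable_on UNIV" "infsum (P t x) UNIV = 1"
      using P_has_sum[OF t, of x] by (auto simp: has_sum_imp_summable infsumI)
    then have "Infinite_Set_Sum.abs_summable_on (P t x) UNIV"
      using P_nonneg[OF t] by (subst abs_summable_equivalent [symmetric]) simp
    then show ?thesis
      using \<open>infsum (P t x) UNIV = 1\<close> P_nonneg[OF t]
      by (simp add: nn_integral_conv_infsetsum infsetsum_infsum)
  qed
  then show ?thesis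
    unfolding law_def by (intro pmf_embed_pmf) (auto simp: P_nonneg t)
qed

text \<open>
  One way to be at \<open>x\<close> at time \<open>s + t\<close> is to be there at time \<open>s\<close> too.
\<close>

lemma P_diag_supermult:
  assumes "0 \<le> s" "0 \<le> t"
  shows "P s x x * P t x x \<le> P (s + t) x x"
proof -
  have "((\<lambda>z. P s x z * P t z x) has_sum P (s + t) x x) UNIV"
    using transition assms by (auto simp: transition_function_def)
  from has_sum_mono2[OF has_sum_finite[of "{x}"] this] assms show ?thesis
    by (simp add: P_nonneg)
qed

lemma P_diag_power:
  assumes "0 \<le> t"
  shows "P t x x ^ n \<le> P (real n * t) x x"
proof (induction n)
  case 0
  then show ?case by (simp add: P_zero)
next
  case (Suc n)
  have "P t x x ^ Suc n \<le> P t x x * P (real n * t) x x"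
    using Suc assms by (simp add: P_nonneg mult_left_mono)
  also have "\<dots> \<le> P (t + real n * t) x x"
    using assms by (intro P_diag_supermult) auto
  finally show ?case by (simp add: algebra_simps)
qed

lemma generator_at_right:
  "((\<lambda>t. (P t x y - of_bool (x = y)) / t) \<longlongrightarrow> srw_generator x y) (at_right 0)"
  using generator by (auto simp: has_generator_def P_zero)

text \<open>
  Supermultiplicativity turns the derivative at \<open>0\<close> into a bound at every time: the holding
  probability is at least the \<open>n\<close>-th power of the one over \<open>t / n\<close>, which Bernoulli's
  inequality linearises before \<open>n\<close> tends to infinity. The point is that the bound is the same
  for all states, whereas the generator is given entrywise.
\<close>

lemma P_diag_lower:
  assumes "0 \<le> t"
  shows "1 - 2 * t \<le> P t x x"
proof (cases "t = 0")
  case True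
  then show ?thesis by (simp add: P_zero)
next
  case False
  with assms have t: "0 < t" by simp
  have "(\<lambda>n. t / real (Suc n)) \<longlonglongrightarrow> 0"
    using LIMSEQ_inverse_real_of_nat tendsto_mult_right_zero[of _ sequentially t]
    by (simp add: divide_inverse del: of_nat_Suc)
  then have "filterlim (\<lambda>n. t / real (Suc n)) (at_right 0) sequentially"
    using t by (auto simp: filterlim_at simp del: of_nat_Suc)
  from filterlim_compose[OF generator_at_right[of x x] this]
  have "(\<lambda>n. (P (t / real (Suc n)) x x - 1) / (t / real (Suc n))) \<longlonglongrightarrow> -2"
    by (simp add: srw_generator_def)
  from tendsto_add[OF tendsto_const[of 1] tendsto_mult[OF tendsto_const[of t] this]]
  have lim: "(\<lambda>n. 1 + t * ((P (t / real (Suc n)) x x - 1) / (t / real (Suc n)))) \<longlonglongrightarrow> 1 - 2 * t"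
    by (simp add: mult.commute)
  \<comment> \<open>the left-hand side tends to \<open>1 - 2 * t\<close>\<close>
  have "1 + t * ((P (t / real (Suc n)) x x - 1) / (t / real (Suc n))) \<le> P t x x" for n
  proof -
    let ?p = "P (t / real (Suc n)) x x"
    have "1 + t * ((?p - 1) / (t / real (Suc n))) = 1 + real (Suc n) * (?p - 1)"
      using t by (simp add: field_simps)
    also have "\<dots> \<le> (1 + (?p - 1)) ^ Suc n"
      using P_nonneg[of "t / real (Suc n)" x x] t by (intro Bernoulli_inequality) auto
    also have "\<dots> = ?p ^ Suc n" by simp
    also have "\<dots> \<le> P (real (Suc n) * (t / real (Suc n))) x x"
      using t by (intro P_diag_power) auto
    finally show ?thesis by (simp add: mult.commute)
  qed
  then show ?thesis
    using lim by (intro LIMSEQ_le_const2[OF lim]) auto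
qed

definition transition_op :: "real \<Rightarrow> (int \<Rightarrow> real) \<Rightarrow> int \<Rightarrow> real" where
  "transition_op t u x = measure_pmf.expectation (law t x) u"

context
  fixes u :: "int \<Rightarrow> real"
  assumes u: "\<And>x. 0 \<le> u x" "\<And>x. u x \<le> 1"
begin

lemma transition_op_bounds: "0 \<le> transition_op t u x" "transition_op t u x \<le> 1"
  unfolding transition_op_def using u
  by (auto intro!: integral_nonneg_AE measure_pmf.integral_le_const
      measure_pmf.integrable_const_bound[where B=1])

text \<open>
  Functions with values in the unit interval have increments at most \<open>1\<close>, so leaving out the
  states off a finite set \<open>F\<close> costs at most the probability of landing off \<open>F\<close>.
\<close>

lemma transition_op_increment_approx:
  assumes t: "0 \<le> t" and F: "finite F"
  shows "\<bar>transition_op t u x - u x - (\<Sum>y\<in>F. P t x y * (u y - u x))\<bar> \<le> 1 - (\<Sum>y\<in>F. P t x y)"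
proof -
  let ?p = "law t x"
  have bound: "\<bar>u y - u x\<bar> \<le> 1" for y
    using u(1)[of x] u(2)[of x] u(1)[of y] u(2)[of y] by (auto simp: abs_le_iff)
  have int[simp]: "integrable (measure_pmf ?p) u"
    using u by (auto intro!: measure_pmf.integrable_const_bound[where B=1])
  have intF[simp]: "integrable (measure_pmf ?p) (\<lambda>y. indicator F y * (u y - u x))"
    using bound by (intro measure_pmf.integrable_const_bound[where B=1]) (auto simp: indicator_def)
  have "(\<Sum>y\<in>F. P t x y * (u y - u x)) = (\<integral>y. indicator F y * (u y - u x) \<partial>?p)"
    using F by (subst integral_measure_pmf_real[of F]) (auto simp: pmf_law[OF t] mult.commute indicator_def)
  then have "transition_op t u x - u x - (\<Sum>y\<in>F. P t x y * (u y - u x))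
      = (\<integral>y. (u y - u x) - indicator F y * (u y - u x) \<partial>?p)"
    unfolding transition_op_def by (simp add: Bochner_Integration.integral_diff)
  also have "\<bar>\<dots>\<bar> \<le> (\<integral>y. indicator (-F) y \<partial>?p)"
  proof (rule order_trans[OF integral_abs_bound], rule integral_mono)
    show "integrable (measure_pmf ?p) (indicator (-F) :: int \<Rightarrow> real)"
      by (rule measure_pmf.integrable_const_bound[where B=1]) (auto simp: indicator_def)
    show "integrable (measure_pmf ?p) (\<lambda>y. \<bar>u y - u x - indicator F y * (u y - u x)\<bar>)"
      by (intro integrable_abs Bochner_Integration.integrable_diff intF int) simp
    show "\<bar>u y - u x - indicator F y * (u y - u x)\<bar> \<le> indicator (-F) y" for y
      using bound[of y] by (simp add: indicator_def)
  qed
  also have "\<dots> = 1 - measure ?p F"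
    by (simp add: measure_pmf.prob_compl[of F, simplified] Compl_eq_Diff_UNIV)
  also have "measure ?p F = (\<Sum>y\<in>F. P t x y)"
    using F by (simp add: measure_measure_pmf_finite pmf_law[OF t])
  finally show ?thesis .
qed

text \<open>
  The set \<open>F\<close> is \<open>{x}\<close>: only a jump away from \<open>x\<close> changes the value.
\<close>

lemma transition_op_lipschitz:
  assumes t: "0 \<le> t"
  shows "\<bar>transition_op t u x - u x\<bar> \<le> 2 * t"
  using transition_op_increment_approx[OF t, of "{x}" x] P_diag_lower[OF t, of x] by simp

text \<open>
  With \<open>F\<close> the state and its two neighbours, the probability of landing off \<open>F\<close> is \<open>o(t)\<close>,
  because the three generator entries sum to \<open>0\<close>.
\<close>

lemma transition_op_derivative:
  "((\<lambda>t. (transition_op t u x - u x) / t) \<longlongrightarrow> u (x + 1) + u (x - 1) - 2 * u x) (at_right 0)"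
proof -
  let ?F = "{x - 1, x, x + 1}"
  have D: "((\<lambda>t. P t x y / t) \<longlongrightarrow> 1) (at_right 0)" if "y = x - 1 \<or> y = x + 1" for y
    using generator_at_right[of x y] that by (auto simp: srw_generator_def)
  have D0: "((\<lambda>t. (P t x x - 1) / t) \<longlongrightarrow> -2) (at_right 0)"
    using generator_at_right[of x x] by (simp add: srw_generator_def)
  have pos: "\<forall>\<^sub>F t::real in at_right 0. 0 < t"
    by (simp add: eventually_at_right_less)
  let ?e = "\<lambda>t. - (P t x (x - 1) / t + P t x (x + 1) / t + (P t x x - 1) / t)"
  let ?g = "\<lambda>t. P t x (x + 1) / t * (u (x + 1) - u x) + P t x (x - 1) / t * (u (x - 1) - u x)"
  have e: "(?e \<longlongrightarrow> 0) (at_right 0)"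
    using tendsto_minus[OF tendsto_add[OF tendsto_add[OF D[of "x - 1"] D[of "x + 1"]] D0]] by simp
  have g: "(?g \<longlongrightarrow> u (x + 1) + u (x - 1) - 2 * u x) (at_right 0)"
    using tendsto_add[OF tendsto_mult[OF D[of "x + 1"] tendsto_const[of "u (x + 1) - u x"]]
        tendsto_mult[OF D[of "x - 1"] tendsto_const[of "u (x - 1) - u x"]]]
    by (simp add: algebra_simps)
  have "\<forall>\<^sub>F t in at_right 0. norm ((transition_op t u x - u x) / t - ?g t) \<le> ?e t"
    using pos
  proof eventually_elim
    case (elim t)
    have "\<bar>transition_op t u x - u x - t * ?g t\<bar> \<le> t * ?e t"
    proof -
      have "t * ?g t = (\<Sum>y\<in>?F. P t x y * (u y - u x))" "t * ?e t = 1 - (\<Sum>y\<in>?F. P t x y)"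
        using elim by (simp_all add: distrib_left right_diff_distrib diff_divide_distrib)
      then show ?thesis
        using transition_op_increment_approx[of t ?F x] elim by simp
    qed
    then have "\<bar>transition_op t u x - u x - t * ?g t\<bar> / t \<le> ?e t"
      using elim by (simp add: divide_le_eq mult.commute)
    moreover have "(transition_op t u x - u x) / t - ?g t = (transition_op t u x - u x - t * ?g t) / t"
      using elim by (simp add: diff_divide_distrib)
    ultimately show ?case using elim by simp
  qed
  then have "((\<lambda>t. (transition_op t u x - u x) / t - ?g t) \<longlongrightarrow> 0) (at_right 0)"
    by (rule Lim_null_comparison[OF _ e])
  from tendsto_add[OF this g] show ?thesis by simp
qed

end

end

section \<open>Occupation integrals along right-continuous paths\<close>

locale right_continuous_paths = prob_space M for M :: "'a measure" +
  fixes X :: "real \<Rightarrow> 'a \<Rightarrow> int"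
  assumes X_meas: "\<And>t. 0 \<le> t \<Longrightarrow> X t \<in> M \<rightarrow>\<^sub>M count_space UNIV"
    and X_right: "\<And>\<omega> t. \<omega> \<in> space M \<Longrightarrow> 0 \<le> t \<Longrightarrow> \<forall>\<^sub>F s in at_right t. X s \<omega> = X t \<omega>"
begin

definition mesh :: "nat \<Rightarrow> real" where "mesh n = 1 / 2 ^ n"

lemma mesh_pos[simp]: "0 < mesh n" and mesh_nonneg[simp]: "0 \<le> mesh n" and mesh_neq[simp]: "mesh n \<noteq> 0"
  by (simp_all add: mesh_def)

lemma mesh_tendsto_0: "mesh \<longlonglongrightarrow> 0"
  unfolding mesh_def[abs_def] by (simp add: LIMSEQ_divide_realpow_zero)

text \<open>
  Grid times are approached from the right, where paths are continuous; left limits are never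
  needed.
\<close>

definition ceil_mesh :: "nat \<Rightarrow> real \<Rightarrow> real" where
  "ceil_mesh n s = mesh n * real_of_int \<lceil>s / mesh n\<rceil>"

lemma ceil_mesh_ge: "s \<le> ceil_mesh n s"
  and ceil_mesh_less: "ceil_mesh n s < s + mesh n"
proof -
  have "s / mesh n \<le> \<lceil>s / mesh n\<rceil>" "\<lceil>s / mesh n\<rceil> < s / mesh n + 1" by linarith+
  then have "mesh n * (s / mesh n) \<le> ceil_mesh n s" "ceil_mesh n s < mesh n * (s / mesh n + 1)"
    unfolding ceil_mesh_def by (intro mult_left_mono mult_strict_left_mono; simp)+
  then show "s \<le> ceil_mesh n s" "ceil_mesh n s < s + mesh n"
    by (simp_all add: distrib_left)
qed

lemma path_eventually_const:
  assumes "\<omega> \<in> space M" "0 \<le> s" "\<And>n. s \<le> r n" "r \<longlonglongrightarrow> s"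
  shows "\<forall>\<^sub>F n in sequentially. X (r n) \<omega> = X s \<omega>"
proof -
  obtain d where d: "s < d" "\<And>y. s < y \<Longrightarrow> y < d \<Longrightarrow> X y \<omega> = X s \<omega>"
    using X_right[OF assms(1,2)] by (auto simp: eventually_at_right_field)
  have "\<forall>\<^sub>F n in sequentially. r n < d"
    using order_tendstoD(2)[OF assms(4) d(1)] .
  then show ?thesis
  proof eventually_elim
    case (elim n)
    then show ?case using d(2)[of "r n"] assms(3)[of n] by (cases "r n = s") auto
  qed
qed

lemma ceil_mesh_tendsto: "(\<lambda>n. ceil_mesh n s) \<longlonglongrightarrow> s"
proof (rule tendsto_sandwich[OF _ _ tendsto_const])
  show "(\<lambda>n. s + mesh n) \<longlonglongrightarrow> s" using tendsto_add[OF tendsto_const mesh_tendsto_0] by simp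
qed (auto simp: ceil_mesh_ge less_imp_le[OF ceil_mesh_less])

lemma path_ceil_mesh:
  "\<omega> \<in> space M \<Longrightarrow> 0 \<le> s \<Longrightarrow> \<forall>\<^sub>F n in sequentially. X (ceil_mesh n s) \<omega> = X s \<omega>"
  by (rule path_eventually_const) (auto simp: ceil_mesh_ge ceil_mesh_tendsto)

text \<open>
  Joint measurability in time and chance, from the right-continuous approximation by the values
  at grid times. Negative times are cut off, since the process is only given for \<open>t \<ge> 0\<close>.
\<close>

lemma measurable_path_pair:
  fixes f :: "int \<Rightarrow> real"
  shows "(\<lambda>z. f (X (max 0 (fst z)) (snd z))) \<in> borel_measurable ((borel :: real measure) \<Otimes>\<^sub>M M)"
proof (rule borel_measurable_LIMSEQ_real)
  fix z assume "z \<in> space ((borel :: real measure) \<Otimes>\<^sub>M M)"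
  then have "snd z \<in> space M" by (auto simp: space_pair_measure)
  from path_ceil_mesh[OF this, of "max 0 (fst z)"]
  show "(\<lambda>n. f (X (ceil_mesh n (max 0 (fst z))) (snd z))) \<longlonglongrightarrow> f (X (max 0 (fst z)) (snd z))"
    by (intro tendsto_eventually) (auto elim!: eventually_mono)
next
  fix n
  let ?k = "\<lambda>s::real. nat \<lceil>max 0 s / mesh n\<rceil>"
  have eq: "ceil_mesh n (max 0 s) = mesh n * real (?k s)" for s
    by (simp add: ceil_mesh_def of_nat_nat)
  have "(\<lambda>z. (\<lambda>k z. f (X (mesh n * real k) (snd z))) (?k (fst z)) z)
      \<in> borel_measurable ((borel :: real measure) \<Otimes>\<^sub>M M)"
  proof (rule measurable_compose_countable[where f = "\<lambda>k z. f (X (mesh n * real k) (snd z))"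
        and g = "\<lambda>z. nat \<lceil>max 0 (fst z) / mesh n\<rceil>"])
    fix k
    have "(\<lambda>\<omega>. f (X (mesh n * real k) \<omega>)) \<in> borel_measurable M"
      by (rule measurable_compose[OF X_meas]) simp_all
    then show "(\<lambda>z. f (X (mesh n * real k) (snd z))) \<in> borel_measurable ((borel :: real measure) \<Otimes>\<^sub>M M)"
      by (rule measurable_compose[OF measurable_snd])
  next
    have "(\<lambda>s. nat \<lceil>max 0 s / mesh n\<rceil>) \<in> borel \<rightarrow>\<^sub>M count_space UNIV"
      by measurable
    then show "(\<lambda>z. nat \<lceil>max 0 (fst z) / mesh n\<rceil>) \<in> (borel :: real measure) \<Otimes>\<^sub>M M \<rightarrow>\<^sub>M count_space UNIV"
      by (rule measurable_compose[OF measurable_fst])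
  qed
  then show "(\<lambda>z. f (X (ceil_mesh n (max 0 (fst z))) (snd z))) \<in> borel_measurable ((borel :: real measure) \<Otimes>\<^sub>M M)"
    unfolding eq .
qed

lemma measurable_path: "\<omega> \<in> space M \<Longrightarrow> (\<lambda>s. f (X (max 0 s) \<omega>)) \<in> borel_measurable borel" for f :: "int \<Rightarrow> real"
  using measurable_compose[OF measurable_Pair2'[of \<omega> M borel] measurable_path_pair[of f]] by simp

text \<open>
  For the indicator of a point this is its local time. Cutting off negative times makes the integrand
  measurable on the whole line, also where nothing is known about the process.
\<close>

definition occ :: "(int \<Rightarrow> real) \<Rightarrow> real \<Rightarrow> 'a \<Rightarrow> real" where
  "occ f t \<omega> = (\<integral>s. indicator {0<..<t} s * f (X (max 0 s) \<omega>) \<partial>lborel)"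

lemma occ_integrable:
  fixes f :: "int \<Rightarrow> real"
  assumes "\<omega> \<in> space M" "\<And>x. \<bar>f x\<bar> \<le> C"
  shows "integrable lborel (\<lambda>s. indicator {0<..<t} s * f (X (max 0 s) \<omega>))"
proof -
  have [measurable]: "(\<lambda>s. f (X (max 0 s) \<omega>)) \<in> borel_measurable borel" by (rule measurable_path) fact
  have C: "0 \<le> C" using assms(2)[of 0] by linarith
  have "emeasure lborel {0<..<t} < \<infinity>" by (cases "0 \<le> t") auto
  then have dom: "integrable lborel (\<lambda>s. C * indicator {0<..<t} s)"
    by (intro integrable_mult_right integrable_real_indicator) auto
  show ?thesis
  proof (rule Bochner_Integration.integrable_bound[OF dom])
    show "(\<lambda>s. indicator {0<..<t} s * f (X (max 0 s) \<omega>)) \<in> borel_measurable lborel"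
      by measurable
    show "AE s in lborel. norm (indicator {0<..<t} s * f (X (max 0 s) \<omega>)) \<le> norm (C * indicator {0<..<t} s)"
      using assms(2) C by (intro AE_I2) (simp add: indicator_def)
  qed
qed

lemma riemann_sum_eq_integral:
  fixes f :: "int \<Rightarrow> real"
  shows   "mesh n * (\<Sum>k=1..K. f (X (mesh n * real k) \<omega>))
    = (\<integral>s. indicator {0<..mesh n * real K} s * f (X (ceil_mesh n s) \<omega>) \<partial>lborel)"
proof -
  let ?I = "\<lambda>k. {mesh n * (real k - 1)<..mesh n * real k}"
  have step: "indicator {0<..mesh n * real K} s * f (X (ceil_mesh n s) \<omega>)
      = (\<Sum>k=1..K. f (X (mesh n * real k) \<omega>) * indicator (?I k) s)" for s
  proof -
    define k where "k = \<lceil>s / mesh n\<rceil>"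
    have k: "s \<in> ?I j \<longleftrightarrow> int j = k" for j
    proof -
      have "k = int j \<longleftrightarrow> real j - 1 < s / mesh n \<and> s / mesh n \<le> real j"
        unfolding k_def by (simp add: ceiling_eq_iff)
      also have "\<dots> \<longleftrightarrow> s \<in> ?I j"
        by (simp add: pos_less_divide_eq pos_divide_le_eq mult.commute)
      finally show ?thesis by (metis)
    qed
    have ind: "indicator (?I i) s = (if int i = k then 1 else 0 :: real)" for i
      using k[of i] by (simp only: indicator_def of_bool_def)
    have pos: "s \<in> {0<..mesh n * real K} \<longleftrightarrow> 1 \<le> k \<and> k \<le> int K"
    proof -
      have "0 < s \<longleftrightarrow> 0 < s / mesh n"
        using pos_less_divide_eq[OF mesh_pos[of n], of 0 s] by simp
      moreover have "s \<le> mesh n * real K \<longleftrightarrow> s / mesh n \<le> real K"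
        by (simp add: pos_divide_le_eq mult.commute)
      moreover have "1 \<le> k \<longleftrightarrow> 0 < s / mesh n" "k \<le> int K \<longleftrightarrow> s / mesh n \<le> real K"
        unfolding k_def by (simp_all add: ceiling_le_iff int_one_le_iff_zero_less)
      ultimately show ?thesis by simp
    qed
    show ?thesis
    proof (cases "1 \<le> k \<and> k \<le> int K")
      case True
      then obtain j where j: "k = int j" "1 \<le> j" "j \<le> K" by (cases k) auto
      have "(\<Sum>i=1..K. f (X (mesh n * real i) \<omega>) * indicator (?I i) s)
          = (\<Sum>i=1..K. if i = j then f (X (mesh n * real j) \<omega>) else 0)"
        unfolding ind j(1) by (intro sum.cong) simp_all
      moreover have "ceil_mesh n s = mesh n * real j" using j by (simp add: ceil_mesh_def k_def[symmetric])
      moreover have "indicator {0<..mesh n * real K} s = (1::real)" using True pos by simp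
      ultimately show ?thesis using j by simp
    next
      case False
      then have "(\<Sum>i=1..K. f (X (mesh n * real i) \<omega>) * indicator (?I i) s) = 0"
        unfolding ind by (intro sum.neutral) auto
      moreover have "indicator {0<..mesh n * real K} s = (0::real)" using False pos by simp
      ultimately show ?thesis by simp
    qed
  qed
  have "(\<integral>s. indicator {0<..mesh n * real K} s * f (X (ceil_mesh n s) \<omega>) \<partial>lborel)
      = (\<Sum>k=1..K. \<integral>s. f (X (mesh n * real k) \<omega>) * indicator (?I k) s \<partial>lborel)"
    unfolding step by (intro Bochner_Integration.integral_sum integrable_mult_right integrable_real_indicator)
      (simp_all add: right_diff_distrib)
  also have "\<dots> = (\<Sum>k=1..K. f (X (mesh n * real k) \<omega>) * mesh n)"
    by (intro sum.cong refl) (simp add: right_diff_distrib)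
  also have "\<dots> = mesh n * (\<Sum>k=1..K. f (X (mesh n * real k) \<omega>))"
    by (simp add: sum_distrib_left mult.commute)
  finally show ?thesis by (rule sym)
qed

text \<open>
  The summand may vary with the mesh as long as it converges pointwise and boundedly; this covers
  the local times (constant \<open>f\<close>) and the one-step errors of the discretised martingale, which
  vanish only pointwise in the state.
\<close>

lemma riemann_sum_tendsto:
  fixes f :: "nat \<Rightarrow> int \<Rightarrow> real"
  assumes w: "\<omega> \<in> space M" and f: "\<And>n x. \<bar>f n x\<bar> \<le> C" and lim: "\<And>x. (\<lambda>n. f n x) \<longlonglongrightarrow> g x"
    and K: "(\<lambda>n. mesh n * real (K n)) \<longlonglongrightarrow> t"
  shows "(\<lambda>n. mesh n * (\<Sum>k=1..K n. f n (X (mesh n * real k) \<omega>))) \<longlonglongrightarrow> occ g t \<omega>"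
proof -
  obtain T where T: "\<And>n. mesh n * real (K n) \<le> T"
    using convergent_imp_Bseq[OF convergentI[OF K]] by (auto simp: Bseq_def abs_le_iff)
  have C: "0 \<le> C" using f[of 0 0] by linarith
  have ind: "AE s in lborel. s \<noteq> t \<and> s \<noteq> 0" by (intro AE_conjI AE_lborel_singleton)
  have "(\<lambda>n. \<integral>s. indicator {0<..mesh n * real (K n)} s * f n (X (ceil_mesh n s) \<omega>) \<partial>lborel) \<longlonglongrightarrow> occ g t \<omega>"
    unfolding occ_def
  proof (rule integral_dominated_convergence)
    have [measurable]: "(\<lambda>s. g (X (max 0 s) \<omega>)) \<in> borel_measurable borel" by (rule measurable_path) fact
    show "(\<lambda>s. indicator {0<..<t} s * g (X (max 0 s) \<omega>)) \<in> borel_measurable lborel" by measurable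
    show "(\<lambda>s. indicator {0<..mesh n * real (K n)} s * f n (X (ceil_mesh n s) \<omega>)) \<in> borel_measurable lborel" for n
    proof -
      have "(\<lambda>s::real. f n (X (mesh n * real_of_int \<lceil>s / mesh n\<rceil>) \<omega>)) \<in> borel_measurable borel"
        by (rule measurable_compose_countable[where f = "\<lambda>k s. f n (X (mesh n * real_of_int k) \<omega>)"
              and g = "\<lambda>s. \<lceil>s / mesh n\<rceil>"]) measurable
      then show ?thesis unfolding ceil_mesh_def by measurable
    qed
    show "integrable lborel (\<lambda>s. C * indicator {0<..T} s)"
    proof -
      have "emeasure lborel {0<..T} < \<infinity>" by (cases "0 \<le> T") auto
      then show ?thesis by (intro integrable_mult_right integrable_real_indicator) auto
    qed
    show "AE s in lborel. norm (indicator {0<..mesh n * real (K n)} s * f n (X (ceil_mesh n s) \<omega>)) \<le> C * indicator {0<..T} s" for n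
      using f[of n] C T[of n] by (intro AE_I2) (auto simp: indicator_def)
    show "AE s in lborel. (\<lambda>n. indicator {0<..mesh n * real (K n)} s * f n (X (ceil_mesh n s) \<omega>))
        \<longlonglongrightarrow> indicator {0<..<t} s * g (X (max 0 s) \<omega>)"
      using ind
    proof (rule AE_mp, intro AE_I2 impI)
      fix s assume s: "s \<noteq> t \<and> s \<noteq> 0"
      have "(\<lambda>n. indicator {0<..mesh n * real (K n)} s :: real) \<longlonglongrightarrow> indicator {0<..<t} s"
      proof (cases "s < t")
        case True
        then have "\<forall>\<^sub>F n in sequentially. s < mesh n * real (K n)" using order_tendstoD(1)[OF K] by blast
        then show ?thesis using True
          by (intro tendsto_eventually) (auto simp: indicator_def elim!: eventually_mono)
      next
        case False
        then have "\<forall>\<^sub>F n in sequentially. mesh n * real (K n) < s" using order_tendstoD(2)[OF K, of s] s by auto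
        then show ?thesis using False
          by (intro tendsto_eventually) (auto simp: indicator_def elim!: eventually_mono)
      qed
      moreover have "(\<lambda>n. f n (X (ceil_mesh n s) \<omega>)) \<longlonglongrightarrow> g (X (max 0 s) \<omega>)" if "0 < s"
      proof (rule Lim_transform_eventually)
        show "(\<lambda>n. f n (X s \<omega>)) \<longlonglongrightarrow> g (X (max 0 s) \<omega>)" using lim[of "X s \<omega>"] that by simp
        show "\<forall>\<^sub>F n in sequentially. f n (X s \<omega>) = f n (X (ceil_mesh n s) \<omega>)"
          using path_ceil_mesh[OF w, of s] that by (auto elim!: eventually_mono)
      qed
      ultimately show "(\<lambda>n. indicator {0<..mesh n * real (K n)} s * f n (X (ceil_mesh n s) \<omega>))
        \<longlonglongrightarrow> indicator {0<..<t} s * g (X (max 0 s) \<omega>)"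
        using s by (cases "0 < s") (auto intro: tendsto_mult)
    qed
  qed
  then show ?thesis by (simp only: riemann_sum_eq_integral)
qed

end

section \<open>The Markov property at a dyadic time\<close>

locale srw = right_continuous_paths M X + srw_semigroup P
  for M :: "'a measure" and X :: "real \<Rightarrow> 'a \<Rightarrow> int" and P +
  assumes start: "AE \<omega> in M. X 0 \<omega> = 0"
    and fdd: "\<And>n (t :: nat \<Rightarrow> real) x. 0 \<le> t 0 \<Longrightarrow> (\<And>i. i \<le> n \<Longrightarrow> t i \<le> t (Suc i)) \<Longrightarrow>
       measure M {\<omega>\<in>space M. \<forall>i\<le>Suc n. X (t i) \<omega> = x i} =
       measure M {\<omega>\<in>space M. \<forall>i\<le>n. X (t i) \<omega> = x i} * P (t (Suc n) - t n) (x n) (x (Suc n))"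
begin

text \<open>
  The cylinders at time \<open>mesh n * K\<close> prescribe the path on the whole grid of width \<open>mesh (n + N)\<close> up to
  that time. Since the grids are nested, two cylinders are either disjoint or one contains the other, so
  they form a generator stable under intersections without any merging of time points.
\<close>

definition cyl :: "nat \<Rightarrow> nat \<Rightarrow> nat \<Rightarrow> (nat \<Rightarrow> int) \<Rightarrow> 'a set" where
  "cyl n K N x = {\<omega>\<in>space M. \<forall>i\<le>K * 2 ^ N. X (mesh (n + N) * real i) \<omega> = x i}"

definition past :: "nat \<Rightarrow> nat \<Rightarrow> 'a measure" where
  "past n K = sigma (space M) (insert {} (range (case_prod (cyl n K))))"

lemma mesh_add: "mesh (n + N) * (real i * 2 ^ N) = mesh n * real i"
  by (simp add: mesh_def power_add)

lemma cyl_sets: "cyl n K N x \<in> sets M"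
proof -
  have [measurable]: "X (mesh (n + N) * real i) \<in> M \<rightarrow>\<^sub>M count_space UNIV" for i by (rule X_meas) simp
  have "cyl n K N x = (\<Inter>i\<in>{..K * 2 ^ N}. {\<omega>\<in>space M. X (mesh (n + N) * real i) \<omega> = x i})"
    by (auto simp: cyl_def)
  also have "\<dots> \<in> sets M"
    by (intro sets.finite_INT) (auto intro!: measurable_sets_Collect)
  finally show ?thesis .
qed

lemma cyl_subset: "cyl n K N x \<subseteq> space M"
  by (auto simp: cyl_def)

lemma cyl_Int_refined:
  assumes "N \<le> N'"
  shows "cyl n K N x \<inter> cyl n K N' x' = {} \<or> cyl n K N x \<inter> cyl n K N' x' = cyl n K N' x'"
proof (cases "\<forall>i\<le>K * 2 ^ N. x i = x' (i * 2 ^ (N' - N))")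
  case True
  have "cyl n K N' x' \<subseteq> cyl n K N x"
  proof
    fix \<omega> assume w: "\<omega> \<in> cyl n K N' x'"
    have "X (mesh (n + N) * real i) \<omega> = x i" if i: "i \<le> K * 2 ^ N" for i
    proof -
      have "i * 2 ^ (N' - N) \<le> K * 2 ^ N * 2 ^ (N' - N)" using i by simp
      also have "\<dots> = K * 2 ^ N'" using assms by (simp add: mult.assoc power_add[symmetric])
      finally have "X (mesh (n + N') * real (i * 2 ^ (N' - N))) \<omega> = x' (i * 2 ^ (N' - N))"
        using w unfolding cyl_def by blast
      moreover have "mesh (n + N') * real (i * 2 ^ (N' - N)) = mesh (n + N) * real i"
        using mesh_add[of "n + N" "N' - N" i] assms by simp
      ultimately show ?thesis using True i by metis
    qed
    then show "\<omega> \<in> cyl n K N x" using w by (simp add: cyl_def)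
  qed
  then show ?thesis by blast
next
  case False
  then obtain i where i: "i \<le> K * 2 ^ N" "x i \<noteq> x' (i * 2 ^ (N' - N))" by blast
  have "False" if w: "\<omega> \<in> cyl n K N x" "\<omega> \<in> cyl n K N' x'" for \<omega>
  proof -
    have "i * 2 ^ (N' - N) \<le> K * 2 ^ N * 2 ^ (N' - N)" using i by simp
    also have "\<dots> = K * 2 ^ N'" using assms by (simp add: mult.assoc power_add[symmetric])
    finally have "X (mesh (n + N') * real (i * 2 ^ (N' - N))) \<omega> = x' (i * 2 ^ (N' - N))"
      using w(2) unfolding cyl_def by blast
    moreover have "mesh (n + N') * real (i * 2 ^ (N' - N)) = mesh (n + N) * real i"
      using mesh_add[of "n + N" "N' - N" i] assms by simp
    moreover have "X (mesh (n + N) * real i) \<omega> = x i" using w(1) i(1) unfolding cyl_def by blast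
    ultimately show False using i(2) by metis
  qed
  then show ?thesis by blast
qed

lemma cyl_Int_stable: "Int_stable (insert {} (range (case_prod (cyl n K))))"
proof (rule Int_stableI)
  have "cyl n K N x \<inter> cyl n K N' x' \<in> insert {} (range (case_prod (cyl n K)))" for N N' x x'
  proof (cases "N \<le> N'")
    case True
    then show ?thesis using cyl_Int_refined[OF True, of n K x x'] by (auto intro!: image_eqI[of _ _ "(N', x')"])
  next
    case False
    then have le: "N' \<le> N" by simp
    show ?thesis using cyl_Int_refined[OF le, of n K x' x]
      by (auto simp: Int_commute intro!: image_eqI[of _ _ "(N, x)"])
  qed
  note cyl = this
  fix a b assume ab: "a \<in> insert {} (range (case_prod (cyl n K)))" "b \<in> insert {} (range (case_prod (cyl n K)))"
  show "a \<inter> b \<in> insert {} (range (case_prod (cyl n K)))"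
  proof (cases "a = {} \<or> b = {}")
    case False
    then obtain N x N' x' where "a = cyl n K N x" "b = cyl n K N' x'" using ab by auto
    then show ?thesis using cyl by (simp only:)
  qed auto
qed

lemma space_past: "space (past n K) = space M"
  and sets_past: "sets (past n K) = sigma_sets (space M) (insert {} (range (case_prod (cyl n K))))"
proof -
  have "insert {} (range (case_prod (cyl n K))) \<subseteq> Pow (space M)"
    by (auto dest: subsetD[OF cyl_subset])
  then show "space (past n K) = space M"
    "sets (past n K) = sigma_sets (space M) (insert {} (range (case_prod (cyl n K))))"
    unfolding past_def by (simp_all only: space_measure_of sets_measure_of)
qed

lemma past_subset: "sets (past n K) \<subseteq> sets M"
  unfolding sets_past by (rule sets.sigma_sets_subset) (auto simp: cyl_sets)

lemma past_measurable_M: "f \<in> past n K \<rightarrow>\<^sub>M N \<Longrightarrow> f \<in> M \<rightarrow>\<^sub>M N"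
  by (rule measurable_mono[OF order_refl refl past_subset, THEN subsetD]) (simp_all add: space_past)

text \<open>
  On a cylinder the last prescribed value is the present state, so the finite-dimensional
  distributions say that the next value is distributed by the transition law of that state.
\<close>

lemma cyl_law:
  assumes u: "\<And>x. 0 \<le> u x" "\<And>x. u x \<le> 1" and s: "0 \<le> s"
  shows "(\<integral>\<^sup>+\<omega>. indicator (cyl n K N x) \<omega> * ennreal (u (X (mesh n * real K + s) \<omega>)) \<partial>M)
     = (\<integral>\<^sup>+\<omega>. indicator (cyl n K N x) \<omega> * ennreal (transition_op s u (X (mesh n * real K) \<omega>)) \<partial>M)"
proof -
  let ?C = "cyl n K N x" and ?X = "X (mesh n * real K + s)" and ?z = "x (K * 2 ^ N)"
  have [measurable]: "?X \<in> M \<rightarrow>\<^sub>M count_space UNIV" "?C \<in> sets M"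
    using s by (auto intro!: X_meas cyl_sets)
  have eqK: "mesh (n + N) * real (K * 2 ^ N) = mesh n * real K"
    using mesh_add[of n N K] by simp
  have pt: "emeasure M {\<omega>\<in>?C. ?X \<omega> = y} = emeasure M ?C * ennreal (P s ?z y)" for y
  proof -
    define t where "t i = (if i \<le> K * 2 ^ N then mesh (n + N) * real i else mesh n * real K + s)" for i
    \<comment> \<open>the grid times of the cylinder followed by one later time\<close>
    define x' where "x' i = (if i \<le> K * 2 ^ N then x i else y)" for i
    have "measure M {\<omega>\<in>space M. \<forall>i\<le>Suc (K * 2 ^ N). X (t i) \<omega> = x' i} =
       measure M {\<omega>\<in>space M. \<forall>i\<le>K * 2 ^ N. X (t i) \<omega> = x' i}
         * P (t (Suc (K * 2 ^ N)) - t (K * 2 ^ N)) (x' (K * 2 ^ N)) (x' (Suc (K * 2 ^ N)))"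
    proof (rule fdd)
      show "t i \<le> t (Suc i)" if "i \<le> K * 2 ^ N" for i
      proof (cases "Suc i \<le> K * 2 ^ N")
        case False
        then have i: "i = K * 2 ^ N" using that by simp
        have "t i = mesh n * real K" "t (Suc i) = mesh n * real K + s"
          unfolding t_def i using eqK by simp_all
        then show ?thesis using s by simp
      qed (simp add: t_def)
    qed (simp add: t_def)
    moreover have "{\<omega>\<in>space M. \<forall>i\<le>Suc (K * 2 ^ N). X (t i) \<omega> = x' i} = {\<omega>\<in>?C. ?X \<omega> = y}"
      by (auto simp: cyl_def t_def x'_def le_Suc_eq)
    moreover have "{\<omega>\<in>space M. \<forall>i\<le>K * 2 ^ N. X (t i) \<omega> = x' i} = ?C"
      by (auto simp: cyl_def t_def x'_def)
    moreover have "t (K * 2 ^ N) = mesh n * real K" "t (Suc (K * 2 ^ N)) = mesh n * real K + s"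
      unfolding t_def using eqK by simp_all
    then have "t (Suc (K * 2 ^ N)) - t (K * 2 ^ N) = s" by simp
    ultimately show ?thesis
      using P_nonneg[OF s] by (simp add: emeasure_eq_measure ennreal_mult x'_def)
  qed
  have "distr (density M (indicator ?C)) (count_space UNIV) ?X = density (measure_pmf (law s ?z)) (\<lambda>_. emeasure M ?C)"
  proof (rule measure_eqI_countable[of _ UNIV])
    fix y :: int
    have "emeasure (distr (density M (indicator ?C)) (count_space UNIV) ?X) {y}
        = (\<integral>\<^sup>+\<omega>. indicator ?C \<omega> * indicator (?X -` {y} \<inter> space M) \<omega> \<partial>M)"
      by (simp add: emeasure_distr emeasure_density)
    also have "\<dots> = (\<integral>\<^sup>+\<omega>. indicator {\<omega>\<in>?C. ?X \<omega> = y} \<omega> \<partial>M)"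
      using cyl_subset[of n K N x] by (intro nn_integral_cong) (auto simp: indicator_def)
    also have "\<dots> = emeasure M {\<omega>\<in>?C. ?X \<omega> = y}"
    proof (rule nn_integral_indicator)
      have "{\<omega>\<in>?C. ?X \<omega> = y} = ?C \<inter> (?X -` {y} \<inter> space M)" by (auto dest: subsetD[OF cyl_subset])
      also have "\<dots> \<in> sets M" by measurable
      finally show "{\<omega>\<in>?C. ?X \<omega> = y} \<in> sets M" .
    qed
    also have "\<dots> = emeasure (density (measure_pmf (law s ?z)) (\<lambda>_. emeasure M ?C)) {y}"
      by (simp add: pt emeasure_density_const emeasure_pmf_single pmf_law[OF s])
    finally show "emeasure (distr (density M (indicator ?C)) (count_space UNIV) ?X) {y}
      = emeasure (density (measure_pmf (law s ?z)) (\<lambda>_. emeasure M ?C)) {y}" .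
  qed simp_all
  then have "(\<integral>\<^sup>+y. ennreal (u y) \<partial>distr (density M (indicator ?C)) (count_space UNIV) ?X)
      = (\<integral>\<^sup>+y. ennreal (u y) \<partial>density (measure_pmf (law s ?z)) (\<lambda>_. emeasure M ?C))"
    by simp
  also have "\<dots> = emeasure M ?C * (\<integral>\<^sup>+y. ennreal (u y) \<partial>measure_pmf (law s ?z))"
    by (simp add: nn_integral_density nn_integral_cmult)
  also have "(\<integral>\<^sup>+y. ennreal (u y) \<partial>measure_pmf (law s ?z)) = ennreal (transition_op s u ?z)"
    unfolding transition_op_def using u
    by (intro nn_integral_eq_integral measure_pmf.integrable_const_bound[where B=1]) auto
  also have "emeasure M ?C * ennreal (transition_op s u ?z)
      = (\<integral>\<^sup>+\<omega>. ennreal (transition_op s u ?z) * indicator ?C \<omega> \<partial>M)"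
    by (subst nn_integral_cmult_indicator) (simp_all add: mult.commute)
  also have "\<dots> = (\<integral>\<^sup>+\<omega>. indicator ?C \<omega> * ennreal (transition_op s u (X (mesh n * real K) \<omega>)) \<partial>M)"
  proof (intro nn_integral_cong)
    fix \<omega>
    have "X (mesh n * real K) \<omega> = ?z" if "\<omega> \<in> ?C"
    proof -
      have "X (mesh (n + N) * real (K * 2 ^ N)) \<omega> = ?z" using that unfolding cyl_def by blast
      then show ?thesis unfolding eqK .
    qed
    then show "ennreal (transition_op s u ?z) * indicator ?C \<omega> = indicator ?C \<omega> * ennreal (transition_op s u (X (mesh n * real K) \<omega>))"
      by (simp add: indicator_def)
  qed
  finally show ?thesis by (simp add: nn_integral_distr nn_integral_density)
qed

text \<open>
  Both sides, as functions of the set whose indicator replaces \<open>Z\<close>, are finite measures on the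
  past that agree on cylinders.
\<close>

lemma markov_property:
  assumes u: "\<And>x. 0 \<le> u x" "\<And>x. u x \<le> 1" and s: "0 \<le> s"
    and Z: "Z \<in> borel_measurable (past n K)" "\<And>\<omega>. 0 \<le> Z \<omega>" "\<And>\<omega>. Z \<omega> \<le> C"
  shows "(\<integral>\<omega>. Z \<omega> * u (X (mesh n * real K + s) \<omega>) \<partial>M)
     = (\<integral>\<omega>. Z \<omega> * transition_op s u (X (mesh n * real K) \<omega>) \<partial>M)"
proof -
  define Q where "Q v = distr (density M (\<lambda>\<omega>. ennreal (v \<omega>))) (past n K) (\<lambda>\<omega>. \<omega>)" for v :: "'a \<Rightarrow> real"
  let ?v1 = "\<lambda>\<omega>. u (X (mesh n * real K + s) \<omega>)" and ?v2 = "\<lambda>\<omega>. transition_op s u (X (mesh n * real K) \<omega>)"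
  have v[measurable]: "?v1 \<in> borel_measurable M" "?v2 \<in> borel_measurable M"
    using s by (auto intro!: measurable_compose[OF X_meas])
  have id: "(\<lambda>\<omega>. \<omega>) \<in> M \<rightarrow>\<^sub>M past n K"
    by (rule past_measurable_M[of _ n K]) simp
  have Q: "emeasure (Q v) A = (\<integral>\<^sup>+\<omega>. indicator A \<omega> * ennreal (v \<omega>) \<partial>M)"
    if "A \<in> sets (past n K)" and [measurable]: "v \<in> borel_measurable M" for v A
  proof -
    have [measurable]: "A \<in> sets M" using that past_subset by auto
    then show ?thesis
      unfolding Q_def using that id sets.sets_into_space[of A M]
      by (subst emeasure_distr) (auto simp: emeasure_density mult.commute Int_absorb2)
  qed
  have cylQ: "cyl n K N x \<in> sets (past n K)" for N x
    unfolding sets_past by (rule sigma_sets.Basic) (auto intro!: image_eqI[of _ _ "(N, x)"])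
  have "Q ?v1 = Q ?v2"
  proof (rule measure_eqI_generator_eq_countable[OF cyl_Int_stable[of n K]])
    show "insert {} (range (case_prod (cyl n K))) \<subseteq> Pow (space M)"
      by (auto dest: subsetD[OF cyl_subset])
    show "emeasure (Q ?v1) A = emeasure (Q ?v2) A" if A': "A \<in> insert {} (range (case_prod (cyl n K)))" for A
    proof (cases "A = {}")
      case False
      then obtain N x where A: "A = cyl n K N x" using A' by auto
      show ?thesis
        unfolding A Q[OF cylQ v(1)] Q[OF cylQ v(2)] by (rule cyl_law[OF u s])
    qed simp
    show "sets (Q ?v1) = sigma_sets (space M) (insert {} (range (case_prod (cyl n K))))"
      "sets (Q ?v2) = sigma_sets (space M) (insert {} (range (case_prod (cyl n K))))"
      by (simp_all add: Q_def sets_past)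
    let ?A = "cyl n K 0 ` (PiE {..K} (\<lambda>_. UNIV))"
    show "?A \<subseteq> insert {} (range (case_prod (cyl n K)))" by force
    show "countable ?A" by (intro countable_image countable_PiE) auto
    show "\<Union> ?A = space M"
    proof (intro equalityI subsetI)
      fix \<omega> assume "\<omega> \<in> space M"
      then have "\<omega> \<in> cyl n K 0 (\<lambda>i\<in>{..K}. X (mesh n * real i) \<omega>)" by (auto simp: cyl_def)
      then show "\<omega> \<in> \<Union> ?A" by (intro UnionI[OF imageI[of "\<lambda>i\<in>{..K}. X (mesh n * real i) \<omega>"]]) auto
    qed (auto simp: cyl_def)
    show "emeasure (Q ?v1) a \<noteq> \<infinity>" if "a \<in> ?A" for a
    proof -
      from that obtain x where a: "a = cyl n K 0 x" by auto
      have "emeasure (Q ?v1) a \<le> (\<integral>\<^sup>+\<omega>. 1 \<partial>M)"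
        unfolding a Q[OF cylQ v(1)] using u by (intro nn_integral_mono) (auto simp: indicator_def)
      then show ?thesis by (auto simp: emeasure_space_1 top_unique)
    qed
  qed
  then have "(\<integral>\<^sup>+\<omega>. ennreal (Z \<omega>) \<partial>Q ?v1) = (\<integral>\<^sup>+\<omega>. ennreal (Z \<omega>) \<partial>Q ?v2)" by simp
  moreover have ZM[measurable]: "Z \<in> borel_measurable M" by (rule past_measurable_M[OF Z(1)])
  have "(\<integral>\<^sup>+\<omega>. ennreal (Z \<omega>) \<partial>Q v) = (\<integral>\<^sup>+\<omega>. ennreal (Z \<omega> * v \<omega>) \<partial>M)"
    if [measurable]: "v \<in> borel_measurable M" and "\<And>\<omega>. 0 \<le> v \<omega>" for v
  proof -
    have "(\<integral>\<^sup>+\<omega>. ennreal (Z \<omega>) \<partial>Q v) = (\<integral>\<^sup>+\<omega>. ennreal (Z \<omega>) \<partial>density M (\<lambda>\<omega>. ennreal (v \<omega>)))"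
      unfolding Q_def using Z(1) id by (intro nn_integral_distr) simp_all
    also have "\<dots> = (\<integral>\<^sup>+\<omega>. ennreal (v \<omega>) * ennreal (Z \<omega>) \<partial>M)"
      by (rule nn_integral_density) simp_all
    finally show ?thesis using that(2) Z(2) by (simp add: ennreal_mult[symmetric] mult.commute)
  qed
  ultimately have "(\<integral>\<^sup>+\<omega>. ennreal (Z \<omega> * ?v1 \<omega>) \<partial>M) = (\<integral>\<^sup>+\<omega>. ennreal (Z \<omega> * ?v2 \<omega>) \<partial>M)"
    using u transition_op_bounds[OF u] by simp
  then show ?thesis
    using u transition_op_bounds[OF u] Z(2) by (simp add: integral_eq_nn_integral)
qed

lemma X_past: "i \<le> K * 2 ^ N \<Longrightarrow> X (mesh (n + N) * real i) \<in> past n K \<rightarrow>\<^sub>M count_space UNIV"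
proof (rule measurable_count_space_eq_countable[THEN iffD2, OF _ conjI])
  assume i: "i \<le> K * 2 ^ N"
  show "X (mesh (n + N) * real i) \<in> space (past n K) \<rightarrow> UNIV" by simp
  have "X (mesh (n + N) * real i) -` {y} \<inter> space (past n K)
    = (\<Union>x\<in>{x \<in> PiE {..K * 2 ^ N} (\<lambda>_. UNIV). x i = y}. cyl n K N x)" for y
  proof (intro equalityI subsetI)
    fix \<omega> assume w: "\<omega> \<in> X (mesh (n + N) * real i) -` {y} \<inter> space (past n K)"
    then have "\<omega> \<in> cyl n K N (\<lambda>j\<in>{..K * 2 ^ N}. X (mesh (n + N) * real j) \<omega>)"
      by (auto simp: cyl_def space_past)
    then show "\<omega> \<in> (\<Union>x\<in>{x \<in> PiE {..K * 2 ^ N} (\<lambda>_. UNIV). x i = y}. cyl n K N x)"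
      using w i by (intro UN_I[of "\<lambda>j\<in>{..K * 2 ^ N}. X (mesh (n + N) * real j) \<omega>"]) auto
  qed (use i in \<open>auto simp: cyl_def space_past\<close>)
  moreover have "cyl n K N x \<in> sets (past n K)" for x
    unfolding sets_past by (rule sigma_sets.Basic) (auto intro!: image_eqI[of _ _ "(N, x)"])
  moreover have "countable {x \<in> PiE {..K * 2 ^ N} (\<lambda>_. UNIV :: int set). x i = y}" for y
    by (rule countable_subset[of _ "PiE {..K * 2 ^ N} (\<lambda>_. UNIV)"]) (auto intro!: countable_PiE)
  ultimately show "\<forall>y\<in>UNIV. X (mesh (n + N) * real i) -` {y} \<inter> space (past n K) \<in> sets (past n K)"
    by (auto intro!: sets.countable_UN')
qed simp

text \<open>
  Right-endpoint Riemann sums at finer grids use only values of the path up to the present, so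
  their limit belongs to the past.
\<close>

lemma occ_past:
  assumes f: "\<And>x. \<bar>f x\<bar> \<le> C"
  shows "occ f (mesh n * real K) \<in> borel_measurable (past n K)"
proof (rule borel_measurable_LIMSEQ_real)
  fix \<omega> assume "\<omega> \<in> space (past n K)"
  then have w: "\<omega> \<in> space M" by (simp add: space_past)
  have lim: "(\<lambda>m. mesh m * real (if n \<le> m then K * 2 ^ (m - n) else 0)) \<longlonglongrightarrow> mesh n * real K"
  proof (rule tendsto_eventually)
    show "\<forall>\<^sub>F m in sequentially. mesh m * real (if n \<le> m then K * 2 ^ (m - n) else 0) = mesh n * real K"
      using eventually_ge_at_top[of n]
    proof eventually_elim
      case (elim m)
      then show ?case using mesh_add[of n "m - n" K] by simp
    qed
  qed
  from riemann_sum_tendsto[OF w f tendsto_const lim]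
  have "(\<lambda>m. mesh m * (\<Sum>k=1..(if n \<le> m then K * 2 ^ (m - n) else 0). f (X (mesh m * real k) \<omega>))) \<longlonglongrightarrow> occ f (mesh n * real K) \<omega>" .
  from LIMSEQ_ignore_initial_segment[OF this, of n]
  show "(\<lambda>N. mesh (n + N) * (\<Sum>k=1..K * 2 ^ N. f (X (mesh (n + N) * real k) \<omega>))) \<longlonglongrightarrow> occ f (mesh n * real K) \<omega>"
    by (simp add: add.commute)
next
  fix N
  have "(\<lambda>\<omega>. f (X (mesh (n + N) * real k) \<omega>)) \<in> borel_measurable (past n K)" if "k \<le> K * 2 ^ N" for k
    by (rule measurable_compose[OF X_past[OF that]]) simp
  then show "(\<lambda>\<omega>. mesh (n + N) * (\<Sum>k=1..K * 2 ^ N. f (X (mesh (n + N) * real k) \<omega>))) \<in> borel_measurable (past n K)"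
    by (intro borel_measurable_times borel_measurable_sum borel_measurable_const) auto
qed

end

section \<open>Exponential martingales stopped at a local time level\<close>

lemma abs_exp_minus_one_le: "\<bar>exp y - 1\<bar> \<le> \<bar>y\<bar> * exp \<bar>y\<bar>" for y :: real
proof (cases "0 \<le> y")
  case True
  have "exp y * (1 - exp (- y)) \<le> exp y * y"
    using exp_ge_add_one_self[of "- y"] by (intro mult_left_mono) auto
  then show ?thesis using True by (simp add: right_diff_distrib exp_minus mult.commute)
next
  case False
  have "1 - exp y \<le> - y" using exp_ge_add_one_self[of y] by linarith
  also have "\<dots> \<le> (- y) * exp (- y)" using False mult_left_mono[of 1 "exp (- y)" "- y"] by simp
  finally show ?thesis using False by simp
qed

lemma norm_mult_unit_le:
  fixes a c e :: real
  assumes "\<bar>a\<bar> \<le> c" "0 \<le> e" "e \<le> 1"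
  shows "norm (a * e) \<le> c" "norm (e * a) \<le> c"
  using assms mult_mono[of "\<bar>a\<bar>" c e 1] by (auto simp: abs_mult mult.commute)

context right_continuous_paths
begin

lemma mesh_le_1: "mesh n \<le> 1"
  by (simp add: mesh_def)

lemma occ_mono:
  assumes "\<omega> \<in> space M" "\<And>x. 0 \<le> f x" "\<And>x. f x \<le> C" "s \<le> t"
  shows "occ f s \<omega> \<le> occ f t \<omega>"
  unfolding occ_def using assms
  by (intro integral_mono occ_integrable[where C=C]) (auto simp: indicator_def abs_le_iff intro: order_trans[of _ 0])

text \<open>
  The horizon \<open>m\<close> keeps the stopping time finite on every path.
\<close>

definition level_time :: "int \<Rightarrow> real \<Rightarrow> nat \<Rightarrow> 'a \<Rightarrow> real" where
  "level_time b h m \<omega> = Inf (insert (real m) {t. 0 \<le> t \<and> h < occ (indicator {b}) t \<omega>})"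

text \<open>
  The number of grid steps until the exact local time (not its Riemann sum) exceeds \<open>h\<close>. With the
  exact local time the stopped grid time lies within one mesh to the right of the stopping time,
  for every path and every level.
\<close>

definition level_step :: "int \<Rightarrow> real \<Rightarrow> nat \<Rightarrow> nat \<Rightarrow> 'a \<Rightarrow> nat" where
  "level_step b h m n \<omega> = (LEAST k. k = m * 2 ^ n \<or> h < occ (indicator {b}) (mesh n * real k) \<omega>)"

lemma mesh_grid: "mesh n * real (m * 2 ^ n) = real m"
  by (simp add: mesh_def)

lemma level_step_le: "level_step b h m n \<omega> \<le> m * 2 ^ n"
  unfolding level_step_def by (rule Least_le) simp

text \<open>
  Local times increase, so being below the level now means having been below it before.
\<close>

lemma less_level_step_iff:
  assumes "\<omega> \<in> space M"
  shows "k < level_step b h m n \<omega> \<longleftrightarrow> k < m * 2 ^ n \<and> occ (indicator {b}) (mesh n * real k) \<omega> \<le> h"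
proof
  assume k: "k < level_step b h m n \<omega>"
  then have "\<not> (k = m * 2 ^ n \<or> h < occ (indicator {b}) (mesh n * real k) \<omega>)"
    unfolding level_step_def by (rule not_less_Least)
  then show "k < m * 2 ^ n \<and> occ (indicator {b}) (mesh n * real k) \<omega> \<le> h"
    using k level_step_le[of b h m n \<omega>] by auto
next
  assume k: "k < m * 2 ^ n \<and> occ (indicator {b}) (mesh n * real k) \<omega> \<le> h"
  let ?j = "level_step b h m n \<omega>"
  have "?j = m * 2 ^ n \<or> h < occ (indicator {b}) (mesh n * real ?j) \<omega>"
    unfolding level_step_def by (rule LeastI[of _ "m * 2 ^ n"]) simp
  moreover have "occ (indicator {b}) (mesh n * real ?j) \<omega> \<le> occ (indicator {b}) (mesh n * real k) \<omega>" if "?j \<le> k"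
    using that by (intro occ_mono[OF assms, where C=1]) (auto intro!: mult_left_mono simp: indicator_def)
  ultimately show "k < ?j" using k by (cases "?j \<le> k") auto
qed

lemma level_time_nonneg: "0 \<le> level_time b h m \<omega>"
  unfolding level_time_def by (rule cInf_greatest) auto

lemma level_step_approximates:
  assumes "\<omega> \<in> space M"
  shows "level_time b h m \<omega> \<le> mesh n * real (level_step b h m n \<omega>)"
    and "mesh n * real (level_step b h m n \<omega>) \<le> level_time b h m \<omega> + mesh n"
proof -
  let ?k = "level_step b h m n \<omega>" and ?T = "insert (real m) {t. 0 \<le> t \<and> h < occ (indicator {b}) t \<omega>}"
  have bdd: "bdd_below ?T" by (rule bdd_belowI[of _ 0]) auto
  have "?k = m * 2 ^ n \<or> h < occ (indicator {b}) (mesh n * real ?k) \<omega>"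
    unfolding level_step_def by (rule LeastI[of _ "m * 2 ^ n"]) simp
  then have "mesh n * real ?k \<in> ?T" using mesh_grid[of n m] by auto
  then show "level_time b h m \<omega> \<le> mesh n * real ?k"
    unfolding level_time_def using bdd by (rule cInf_lower)
  show "mesh n * real ?k \<le> level_time b h m \<omega> + mesh n"
  proof (cases ?k)
    case 0
    then show ?thesis using level_time_nonneg[of b h m \<omega>] by (simp add: add_nonneg_nonneg)
  next
    case (Suc j)
    then have j: "j < m * 2 ^ n" "occ (indicator {b}) (mesh n * real j) \<omega> \<le> h"
      using less_level_step_iff[OF assms, of j b h m n] by auto
    have "mesh n * real j \<le> level_time b h m \<omega>"
      unfolding level_time_def
    proof (rule cInf_greatest)
      fix t assume "t \<in> ?T"
      then consider "t = real m" | "h < occ (indicator {b}) t \<omega>" by auto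
      then show "mesh n * real j \<le> t"
      proof cases
        case 1
        have "mesh n * real j \<le> mesh n * real (m * 2 ^ n)"
          using j(1) by (intro mult_left_mono) (simp_all del: of_nat_mult of_nat_power)
        then show ?thesis unfolding 1 mesh_grid .
      next
        case 2
        have "occ (indicator {b}) t \<omega> \<le> occ (indicator {b}) (mesh n * real j) \<omega>" if "t \<le> mesh n * real j"
          using that by (intro occ_mono[OF assms, where C=1]) (auto simp: indicator_def)
        then show ?thesis using 2 j(2) by (cases "t \<le> mesh n * real j") auto
      qed
    qed simp
    then show ?thesis using Suc by (simp add: algebra_simps)
  qed
qed

lemma level_step_tendsto:
  assumes "\<omega> \<in> space M"
  shows "(\<lambda>n. mesh n * real (level_step b h m n \<omega>)) \<longlonglongrightarrow> level_time b h m \<omega>"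
proof (rule tendsto_sandwich[OF _ _ tendsto_const])
  show "(\<lambda>n. level_time b h m \<omega> + mesh n) \<longlonglongrightarrow> level_time b h m \<omega>"
    using tendsto_add[OF tendsto_const mesh_tendsto_0] by simp
qed (simp_all add: level_step_approximates[OF assms])

text \<open>
  Shifting the summation index by one changes the sum by at most two bounded terms of weight \<open>mesh n\<close>.
\<close>

lemma left_sum_tendsto:
  fixes f :: "nat \<Rightarrow> int \<Rightarrow> real"
  assumes w: "\<omega> \<in> space M" and f: "\<And>n x. \<bar>f n x\<bar> \<le> C" and lim: "\<And>x. (\<lambda>n. f n x) \<longlonglongrightarrow> g x"
    and K: "(\<lambda>n. mesh n * real (K n)) \<longlonglongrightarrow> t"
  shows "(\<lambda>n. mesh n * (\<Sum>k<K n. f n (X (mesh n * real k) \<omega>))) \<longlonglongrightarrow> occ g t \<omega>"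
proof -
  have shift: "(\<Sum>k<K. F k) = F 0 - F K + (\<Sum>k=1..K. F k)" for F :: "nat \<Rightarrow> real" and K
    by (induction K) auto
  let ?e = "\<lambda>n. mesh n * (f n (X (mesh n * real 0) \<omega>) - f n (X (mesh n * real (K n)) \<omega>))"
  have "?e \<longlonglongrightarrow> 0"
  proof (rule Lim_null_comparison)
    show "\<forall>\<^sub>F n in sequentially. norm (?e n) \<le> mesh n * (2 * C)"
    proof (intro always_eventually allI)
      fix n
      have "\<bar>f n (X (mesh n * real 0) \<omega>) - f n (X (mesh n * real (K n)) \<omega>)\<bar> \<le> 2 * C"
        using f[of n "X (mesh n * real 0) \<omega>"] f[of n "X (mesh n * real (K n)) \<omega>"] by linarith
      then show "norm (?e n) \<le> mesh n * (2 * C)" by (simp add: abs_mult)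
    qed
    show "(\<lambda>n. mesh n * (2 * C)) \<longlonglongrightarrow> 0" using tendsto_mult_right[OF mesh_tendsto_0, of "2 * C"] by simp
  qed
  from tendsto_add[OF this riemann_sum_tendsto[OF w f lim K]]
  show ?thesis by (simp add: shift distrib_left)
qed

end

text \<open>
  The function \<open>u\<close> solves \<open>A u = V u\<close> for the generator \<open>A\<close>, so that
  \<open>u(X\<^sub>t) exp(- \<integral>\<^sub>0\<^sup>t V(X\<^sub>s) ds)\<close> is a martingale.
\<close>

locale exponential_martingale = srw M X P
  for M :: "'a measure" and X :: "real \<Rightarrow> 'a \<Rightarrow> int" and P +
  fixes u V :: "int \<Rightarrow> real" and B :: real and b :: int and h :: real
  assumes u: "\<And>x. 0 \<le> u x" "\<And>x. u x \<le> 1"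
    and V: "\<And>x. \<bar>V x\<bar> \<le> B"
    and gen: "\<And>x. u (x + 1) + u (x - 1) - 2 * u x = V x * u x"
begin

lemma B_nonneg: "0 \<le> B" using V[of 0] by linarith

text \<open>
  The conditional expectation of one step of the discretised martingale, per unit of time and up to the
  discount accumulated before: it is bounded and tends to \<open>A u - V u = 0\<close> at each state.
\<close>

definition drift :: "nat \<Rightarrow> int \<Rightarrow> real" where
  "drift n x = (exp (- mesh n * V x) * transition_op (mesh n) u x - u x) / mesh n"

lemma exp_mesh_bound: "\<bar>exp (- mesh n * V x) - 1\<bar> \<le> mesh n * (B * exp B)"
proof -
  have le: "\<bar>- mesh n * V x\<bar> \<le> mesh n * B" using V[of x] by (simp add: abs_mult)
  also have "\<dots> \<le> B" using mesh_le_1[of n] B_nonneg by (simp add: mult_left_le_one_le)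
  finally have "exp \<bar>- mesh n * V x\<bar> \<le> exp B" by simp
  then have "\<bar>- mesh n * V x\<bar> * exp \<bar>- mesh n * V x\<bar> \<le> (mesh n * B) * exp B"
    using le B_nonneg by (intro mult_mono) auto
  then show ?thesis using abs_exp_minus_one_le[of "- mesh n * V x"] by simp
qed

lemma drift_bound: "\<bar>drift n x\<bar> \<le> B * exp B + 2"
proof -
  let ?S = "transition_op (mesh n) u x" and ?E = "exp (- mesh n * V x)"
  have "\<bar>?E * ?S - u x\<bar> \<le> \<bar>?E - 1\<bar> * ?S + \<bar>?S - u x\<bar>"
  proof -
    have "?E * ?S - u x = (?E - 1) * ?S + (?S - u x)" by (simp add: algebra_simps)
    then have "\<bar>?E * ?S - u x\<bar> \<le> \<bar>(?E - 1) * ?S\<bar> + \<bar>?S - u x\<bar>" by (simp only: abs_triangle_ineq)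
    then show ?thesis using transition_op_bounds[where u = u, OF u, of "mesh n" x] by (simp add: abs_mult)
  qed
  also have "\<dots> \<le> mesh n * (B * exp B) * 1 + 2 * mesh n"
    using exp_mesh_bound[of n x] transition_op_bounds[where u = u, OF u, of "mesh n" x] transition_op_lipschitz[where u = u, OF u, of "mesh n" x]
    by (intro add_mono mult_mono) auto
  finally have "\<bar>?E * ?S - u x\<bar> \<le> mesh n * (B * exp B + 2)" by (simp add: algebra_simps)
  then have "\<bar>?E * ?S - u x\<bar> / mesh n \<le> B * exp B + 2" by (simp add: divide_le_eq mult.commute)
  then show ?thesis by (simp add: drift_def)
qed

lemma drift_tendsto_0: "(\<lambda>n. drift n x) \<longlonglongrightarrow> 0"
proof -
  have mesh0: "filterlim mesh (at_right 0) sequentially"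
    using mesh_tendsto_0 by (auto simp: filterlim_at)
  have transition_op: "(\<lambda>n. (transition_op (mesh n) u x - u x) / mesh n) \<longlonglongrightarrow> V x * u x"
    using filterlim_compose[OF transition_op_derivative[where u = u, OF u, of x] mesh0] by (simp add: gen)
  have "((\<lambda>t. exp (- t * V x)) has_real_derivative - V x) (at 0)"
    by (auto intro!: derivative_eq_intros)
  then have "((\<lambda>t. (exp (- t * V x) - 1) / t) \<longlongrightarrow> - V x) (at 0)"
    by (simp add: has_field_derivative_iff)
  then have ex: "(\<lambda>n. (exp (- mesh n * V x) - 1) / mesh n) \<longlonglongrightarrow> - V x"
    using filterlim_compose[OF filterlim_mono[OF _ order_refl at_le] mesh0] by blast
  have e1: "(\<lambda>n. exp (- mesh n * V x)) \<longlonglongrightarrow> exp (- 0 * V x)"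
    by (intro tendsto_intros mesh_tendsto_0)
  have "(\<lambda>n. exp (- mesh n * V x) * ((transition_op (mesh n) u x - u x) / mesh n)
      + (exp (- mesh n * V x) - 1) / mesh n * u x) \<longlonglongrightarrow> exp (- 0 * V x) * (V x * u x) + (- V x) * u x"
    by (intro tendsto_intros e1 transition_op ex)
  moreover have "exp (- mesh n * V x) * ((transition_op (mesh n) u x - u x) / mesh n)
      + (exp (- mesh n * V x) - 1) / mesh n * u x = drift n x" for n
    by (simp add: drift_def field_simps)
  ultimately show ?thesis by simp
qed

definition cost :: "nat \<Rightarrow> nat \<Rightarrow> 'a \<Rightarrow> real" where
  "cost n k \<omega> = mesh n * (\<Sum>i<k. V (X (mesh n * real i) \<omega>))"

definition discounted :: "nat \<Rightarrow> nat \<Rightarrow> 'a \<Rightarrow> real" where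
  "discounted n k \<omega> = u (X (mesh n * real k) \<omega>) * exp (- cost n k \<omega>)"

definition below :: "nat \<Rightarrow> nat \<Rightarrow> 'a \<Rightarrow> real" where
  "below n k \<omega> = (if occ (indicator {b}) (mesh n * real k) \<omega> \<le> h then 1 else 0)"

lemma cost_bound: "k \<le> m * 2 ^ n \<Longrightarrow> \<bar>cost n k \<omega>\<bar> \<le> B * real m"
proof -
  assume k: "k \<le> m * 2 ^ n"
  have "\<bar>cost n k \<omega>\<bar> \<le> mesh n * (\<Sum>i<k. \<bar>V (X (mesh n * real i) \<omega>)\<bar>)"
    unfolding cost_def by (simp add: abs_mult sum_abs)
  also have "\<dots> \<le> mesh n * (\<Sum>i<k. B)"
    by (intro mult_left_mono sum_mono V) simp
  also have "\<dots> = B * (mesh n * real k)" by simp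
  also have "\<dots> \<le> B * (mesh n * real (m * 2 ^ n))"
    using k B_nonneg by (intro mult_left_mono) (simp_all del: of_nat_mult of_nat_power)
  finally show ?thesis by (simp only: mesh_grid)
qed

lemma exp_cost_bound: "k \<le> m * 2 ^ n \<Longrightarrow> exp (- cost n k \<omega>) \<le> exp (B * real m)"
  using cost_bound[of k m n \<omega>] by simp

lemma X_borel: "0 \<le> t \<Longrightarrow> (\<lambda>\<omega>. f (X t \<omega>)) \<in> borel_measurable M" for f :: "int \<Rightarrow> real"
  by (rule measurable_compose[OF X_meas]) simp_all

lemma cost_past: "cost n (Suc k) \<in> borel_measurable (past n k)"
proof -
  have "(\<lambda>\<omega>. V (X (mesh n * real i) \<omega>)) \<in> borel_measurable (past n k)" if "i < Suc k" for i
    using that measurable_compose[OF X_past[of i k 0 n], of V borel] by simp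
  then show ?thesis
    unfolding cost_def[abs_def] by (intro borel_measurable_times borel_measurable_sum borel_measurable_const) auto
qed

lemma below_past: "below n k \<in> borel_measurable (past n k)"
proof -
  have [measurable]: "occ (indicator {b}) (mesh n * real k) \<in> borel_measurable (past n k)"
    by (rule occ_past[where C=1]) (auto simp: indicator_def)
  show ?thesis unfolding below_def[abs_def] by measurable
qed

lemma cost_measurable: "cost n k \<in> borel_measurable M"
  unfolding cost_def[abs_def] by (intro borel_measurable_times borel_measurable_sum borel_measurable_const X_borel) auto

lemma below_measurable: "below n k \<in> borel_measurable M"
  by (rule past_measurable_M[OF below_past])

lemma discounted_measurable: "discounted n k \<in> borel_measurable M"
proof -
  have [measurable]: "(\<lambda>\<omega>. u (X (mesh n * real k) \<omega>)) \<in> borel_measurable M" "cost n k \<in> borel_measurable M"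
    by (rule X_borel cost_measurable, simp?)+
  show ?thesis unfolding discounted_def[abs_def] by measurable
qed

lemma discounted_bound:
  assumes "k \<le> m * 2 ^ n"
  shows "\<bar>discounted n k \<omega>\<bar> \<le> exp (B * real m)"
proof -
  have "u (X (mesh n * real k) \<omega>) * exp (- cost n k \<omega>) \<le> 1 * exp (B * real m)"
    using u exp_cost_bound[OF assms] by (intro mult_mono) auto
  then show ?thesis using u by (simp add: discounted_def abs_mult)
qed

text \<open>
  The weight \<open>below n k * exp (- cost n (Suc k))\<close> belongs to the past of step \<open>k\<close>, because the left
  Riemann sum \<open>cost n (Suc k)\<close> stops at the value \<open>X\<close> has at step \<open>k\<close>.
\<close>

lemma one_step:
  "(\<integral>\<omega>. below n k \<omega> * (discounted n (Suc k) \<omega> - discounted n k \<omega>) \<partial>M)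
    = (\<integral>\<omega>. below n k \<omega> * exp (- cost n k \<omega>) * (mesh n * drift n (X (mesh n * real k) \<omega>)) \<partial>M)"
proof -
  obtain m where m: "Suc k \<le> m * 2 ^ n" by (metis le_square power_0 mult_le_mono2 one_le_numeral one_le_power mult.right_neutral order_trans order_refl)
  define Z where "Z \<omega> = below n k \<omega> * exp (- cost n (Suc k) \<omega>)" for \<omega>
  let ?Y = "X (mesh n * real k)"
  have below01: "0 \<le> below n k \<omega>" "below n k \<omega> \<le> 1" for \<omega> by (auto simp: below_def)
  have Zp: "Z \<in> borel_measurable (past n k)"
    using cost_past below_past unfolding Z_def[abs_def] by measurable
  have Z: "0 \<le> Z \<omega>" "Z \<omega> \<le> exp (B * real m)" for \<omega>
  proof -
    have "below n k \<omega> * exp (- cost n (Suc k) \<omega>) \<le> 1 * exp (B * real m)"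
      using below01 exp_cost_bound[OF m] by (intro mult_mono) auto
    then show "0 \<le> Z \<omega>" "Z \<omega> \<le> exp (B * real m)" using below01 by (auto simp: Z_def)
  qed
  have Suc: "mesh n * real (Suc k) = mesh n * real k + mesh n" by (simp add: algebra_simps)
  have cost_Suc: "cost n (Suc k) \<omega> = cost n k \<omega> + mesh n * V (?Y \<omega>)" for \<omega>
    by (simp add: cost_def distrib_left)
  have meas[measurable]: "Z \<in> borel_measurable M" "(\<lambda>\<omega>. u (X (mesh n * real k + mesh n) \<omega>)) \<in> borel_measurable M"
    "(\<lambda>\<omega>. transition_op (mesh n) u (?Y \<omega>)) \<in> borel_measurable M" "below n k \<in> borel_measurable M" "discounted n k \<in> borel_measurable M"
    using past_measurable_M[OF Zp] below_measurable discounted_measurable by (auto intro!: X_borel)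
  have int1: "integrable M (\<lambda>\<omega>. Z \<omega> * u (X (mesh n * real k + mesh n) \<omega>))"
    using Z u by (intro integrable_const_bound[where B="exp (B * real m)"] AE_I2 norm_mult_unit_le) auto
  have int2: "integrable M (\<lambda>\<omega>. Z \<omega> * transition_op (mesh n) u (?Y \<omega>))"
    using Z transition_op_bounds[where u = u, OF u]
    by (intro integrable_const_bound[where B="exp (B * real m)"] AE_I2 norm_mult_unit_le) auto
  have int3: "integrable M (\<lambda>\<omega>. below n k \<omega> * discounted n k \<omega>)"
    using below01 discounted_bound[of k m n] m
    by (intro integrable_const_bound[where B="exp (B * real m)"] AE_I2 norm_mult_unit_le(2)) auto
  have "(\<integral>\<omega>. below n k \<omega> * (discounted n (Suc k) \<omega> - discounted n k \<omega>) \<partial>M)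
      = (\<integral>\<omega>. Z \<omega> * u (X (mesh n * real k + mesh n) \<omega>) - below n k \<omega> * discounted n k \<omega> \<partial>M)"
    by (intro Bochner_Integration.integral_cong refl) (simp add: discounted_def Z_def Suc algebra_simps)
  also have "\<dots> = (\<integral>\<omega>. Z \<omega> * u (X (mesh n * real k + mesh n) \<omega>) \<partial>M) - (\<integral>\<omega>. below n k \<omega> * discounted n k \<omega> \<partial>M)"
    by (rule Bochner_Integration.integral_diff[OF int1 int3])
  also have "(\<integral>\<omega>. Z \<omega> * u (X (mesh n * real k + mesh n) \<omega>) \<partial>M) = (\<integral>\<omega>. Z \<omega> * transition_op (mesh n) u (?Y \<omega>) \<partial>M)"
    by (rule markov_property[OF u _ Zp Z]) simp
  also have "\<dots> - (\<integral>\<omega>. below n k \<omega> * discounted n k \<omega> \<partial>M) = (\<integral>\<omega>. Z \<omega> * transition_op (mesh n) u (?Y \<omega>) - below n k \<omega> * discounted n k \<omega> \<partial>M)"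
    by (rule Bochner_Integration.integral_diff[OF int2 int3, symmetric])
  also have "\<dots> = (\<integral>\<omega>. below n k \<omega> * exp (- cost n k \<omega>) * (mesh n * drift n (?Y \<omega>)) \<partial>M)"
  proof (intro Bochner_Integration.integral_cong refl)
    fix \<omega>
    have "exp (- cost n (Suc k) \<omega>) = exp (- cost n k \<omega>) * exp (- mesh n * V (?Y \<omega>))"
      by (simp add: cost_Suc exp_add[symmetric])
    moreover have "mesh n * drift n (?Y \<omega>) = exp (- mesh n * V (?Y \<omega>)) * transition_op (mesh n) u (?Y \<omega>) - u (?Y \<omega>)"
      by (simp add: drift_def)
    ultimately show "Z \<omega> * transition_op (mesh n) u (?Y \<omega>) - below n k \<omega> * discounted n k \<omega>
        = below n k \<omega> * exp (- cost n k \<omega>) * (mesh n * drift n (?Y \<omega>))"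
      unfolding Z_def discounted_def by (simp only:) (simp add: algebra_simps)
  qed
  finally show ?thesis .
qed

abbreviation "steps m n \<equiv> level_step b h m n"

text \<open>
  Stopping amounts to summing the increments over the steps below the level.
\<close>

lemma discounted_telescope:
  assumes "\<omega> \<in> space M"
  shows "discounted n (steps m n \<omega>) \<omega> = discounted n 0 \<omega> + (\<Sum>k<m * 2 ^ n. below n k \<omega> * (discounted n (Suc k) \<omega> - discounted n k \<omega>))"
proof -
  let ?K = "steps m n \<omega>"
  have "(\<Sum>k<m * 2 ^ n. below n k \<omega> * (discounted n (Suc k) \<omega> - discounted n k \<omega>))
      = (\<Sum>k<m * 2 ^ n. if k < ?K then discounted n (Suc k) \<omega> - discounted n k \<omega> else 0)"
    by (intro sum.cong refl) (auto simp: less_level_step_iff[OF assms] below_def)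
  also have "\<dots> = (\<Sum>k<?K. discounted n (Suc k) \<omega> - discounted n k \<omega>)"
    using level_step_le[of b h m n \<omega>] by (intro sum.mono_neutral_cong_right) auto
  also have "\<dots> = discounted n ?K \<omega> - discounted n 0 \<omega>" by (rule sum_lessThan_telescope)
  finally show ?thesis by simp
qed

lemma discounted_steps_measurable: "(\<lambda>\<omega>. discounted n (steps m n \<omega>) \<omega>) \<in> borel_measurable M"
proof -
  have [measurable]: "discounted n k \<in> borel_measurable M" "below n k \<in> borel_measurable M" for k
    by (rule discounted_measurable below_measurable)+
  have "(\<lambda>\<omega>. discounted n 0 \<omega> + (\<Sum>k<m * 2 ^ n. below n k \<omega> * (discounted n (Suc k) \<omega> - discounted n k \<omega>))) \<in> borel_measurable M"
    by measurable
  then show ?thesis by (subst measurable_cong[OF discounted_telescope]) auto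
qed

definition drift_error :: "nat \<Rightarrow> nat \<Rightarrow> 'a \<Rightarrow> real" where
  "drift_error m n \<omega> = mesh n * (\<Sum>k<m * 2 ^ n. \<bar>drift n (X (mesh n * real k) \<omega>)\<bar>)"

text \<open>
  The error is a Riemann sum of the drifts, which converge to \<open>0\<close> pointwise and boundedly.
\<close>

lemma drift_error_tendsto_0: "(\<lambda>n. \<integral>\<omega>. drift_error m n \<omega> \<partial>M) \<longlonglongrightarrow> 0"
proof -
  let ?C = "B * exp B + 2"
  have "(\<lambda>n. \<integral>\<omega>. drift_error m n \<omega> \<partial>M) \<longlonglongrightarrow> (\<integral>\<omega>. 0 \<partial>M)"
  proof (rule integral_dominated_convergence)
    show "drift_error m n \<in> borel_measurable M" for n
      unfolding drift_error_def[abs_def]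
      by (intro borel_measurable_times borel_measurable_sum borel_measurable_const X_borel) simp
    show "integrable M (\<lambda>_. ?C * real m)" by simp
    show "AE \<omega> in M. (\<lambda>n. drift_error m n \<omega>) \<longlonglongrightarrow> 0"
    proof (rule AE_I2)
      fix \<omega> assume w: "\<omega> \<in> space M"
      have "(\<lambda>n. mesh n * (\<Sum>k<m * 2 ^ n. \<bar>drift n (X (mesh n * real k) \<omega>)\<bar>)) \<longlonglongrightarrow> occ (\<lambda>_. 0) (real m) \<omega>"
      proof (rule left_sum_tendsto[OF w])
        show "\<bar>\<bar>drift n x\<bar>\<bar> \<le> ?C" for n x using drift_bound by simp
        show "(\<lambda>n. \<bar>drift n x\<bar>) \<longlonglongrightarrow> 0" for x using drift_tendsto_0 by (rule tendsto_rabs_zero)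
        show "(\<lambda>n. mesh n * real (m * 2 ^ n)) \<longlonglongrightarrow> real m" by (simp only: mesh_grid tendsto_const)
      qed
      then show "(\<lambda>n. drift_error m n \<omega>) \<longlonglongrightarrow> 0" by (simp add: drift_error_def occ_def)
    qed
    show "AE \<omega> in M. norm (drift_error m n \<omega>) \<le> ?C * real m" for n
    proof (rule AE_I2)
      fix \<omega>
      have "mesh n * (\<Sum>k<m * 2 ^ n. \<bar>drift n (X (mesh n * real k) \<omega>)\<bar>) \<le> mesh n * (\<Sum>k<m * 2 ^ n. ?C)"
        by (intro mult_left_mono sum_mono drift_bound) simp
      also have "\<dots> = ?C * (mesh n * real (m * 2 ^ n))" by simp
      also have "\<dots> = ?C * real m" by (simp only: mesh_grid)
      finally show "norm (drift_error m n \<omega>) \<le> ?C * real m"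
        by (simp add: drift_error_def abs_of_nonneg[OF mult_nonneg_nonneg] sum_nonneg)
    qed
  qed simp
  then show ?thesis by simp
qed

lemma discounted_steps_expectation:
  "\<bar>(\<integral>\<omega>. discounted n (steps m n \<omega>) \<omega> \<partial>M) - u 0\<bar> \<le> exp (B * real m) * (\<integral>\<omega>. drift_error m n \<omega> \<partial>M)"
proof -
  let ?Y = "\<lambda>k. X (mesh n * real k)"
  let ?D = "\<lambda>k \<omega>. below n k \<omega> * (discounted n (Suc k) \<omega> - discounted n k \<omega>)"
  have [measurable]: "discounted n k \<in> borel_measurable M" "below n k \<in> borel_measurable M" "cost n k \<in> borel_measurable M" for k
    by (rule discounted_measurable below_measurable cost_measurable)+
  have [measurable]: "(\<lambda>\<omega>. drift n (?Y k \<omega>)) \<in> borel_measurable M" for k by (rule X_borel) simp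
  have intd: "integrable M (discounted n k)" if "k \<le> m * 2 ^ n" for k
    using discounted_bound[OF that] by (intro integrable_const_bound[where B="exp (B * real m)"]) auto
  have intD: "integrable M (?D k)" if "k < m * 2 ^ n" for k
  proof (rule integrable_const_bound[where B="2 * exp (B * real m)"])
    show "AE \<omega> in M. norm (?D k \<omega>) \<le> 2 * exp (B * real m)"
    proof (intro AE_I2 norm_mult_unit_le(2))
      fix \<omega>
      show "\<bar>discounted n (Suc k) \<omega> - discounted n k \<omega>\<bar> \<le> 2 * exp (B * real m)"
        using discounted_bound[of k m n \<omega>] discounted_bound[of "Suc k" m n \<omega>] that by linarith
    qed (auto simp: below_def)
  qed measurable
  have intr: "integrable M (\<lambda>\<omega>. \<bar>drift n (?Y k \<omega>)\<bar>)" for k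
    using drift_bound by (intro integrable_const_bound[where B="B * exp B + 2"]) auto
  have init: "(\<integral>\<omega>. discounted n 0 \<omega> \<partial>M) = u 0"
  proof -
    have "(\<integral>\<omega>. discounted n 0 \<omega> \<partial>M) = (\<integral>\<omega>. u 0 \<partial>M)"
    proof (rule integral_cong_AE[OF discounted_measurable borel_measurable_const])
      show "AE \<omega> in M. discounted n 0 \<omega> = u 0"
        using start by eventually_elim (simp add: discounted_def cost_def)
    qed
    then show ?thesis by (simp add: prob_space)
  qed
  have "(\<integral>\<omega>. discounted n (steps m n \<omega>) \<omega> \<partial>M) = (\<integral>\<omega>. discounted n 0 \<omega> + (\<Sum>k<m * 2 ^ n. ?D k \<omega>) \<partial>M)"
    by (intro Bochner_Integration.integral_cong refl discounted_telescope)
  also have "\<dots> = u 0 + (\<Sum>k<m * 2 ^ n. \<integral>\<omega>. ?D k \<omega> \<partial>M)"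
    using intd intD by (subst Bochner_Integration.integral_add)
      (auto simp: init Bochner_Integration.integral_sum intro!: Bochner_Integration.integrable_sum)
  finally have "(\<integral>\<omega>. discounted n (steps m n \<omega>) \<omega> \<partial>M) - u 0 = (\<Sum>k<m * 2 ^ n. \<integral>\<omega>. ?D k \<omega> \<partial>M)" by simp
  also have "\<bar>\<dots>\<bar> \<le> (\<Sum>k<m * 2 ^ n. \<bar>\<integral>\<omega>. ?D k \<omega> \<partial>M\<bar>)" by (rule sum_abs)
  also have "\<dots> \<le> (\<Sum>k<m * 2 ^ n. \<integral>\<omega>. exp (B * real m) * (mesh n * \<bar>drift n (?Y k \<omega>)\<bar>) \<partial>M)"
  proof (rule sum_mono)
    fix k assume "k \<in> {..<m * 2 ^ n}"
    then have k: "k \<le> m * 2 ^ n" by simp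
    have le: "\<bar>below n k \<omega> * exp (- cost n k \<omega>) * (mesh n * drift n (?Y k \<omega>))\<bar>
        \<le> exp (B * real m) * (mesh n * \<bar>drift n (?Y k \<omega>)\<bar>)" for \<omega>
    proof -
      have "below n k \<omega> * exp (- cost n k \<omega>) \<le> 1 * exp (B * real m)"
        using exp_cost_bound[OF k] by (intro mult_mono) (auto simp: below_def)
      then have "(below n k \<omega> * exp (- cost n k \<omega>)) * (mesh n * \<bar>drift n (?Y k \<omega>)\<bar>)
          \<le> exp (B * real m) * (mesh n * \<bar>drift n (?Y k \<omega>)\<bar>)"
        by (intro mult_right_mono) auto
      moreover have "0 \<le> below n k \<omega>" by (simp add: below_def)
      ultimately show ?thesis by (simp only: abs_mult abs_of_nonneg abs_exp_cancel mesh_nonneg abs_idempotent)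
    qed
    have int: "integrable M (\<lambda>\<omega>. exp (B * real m) * (mesh n * \<bar>drift n (?Y k \<omega>)\<bar>))"
      by (intro integrable_mult_right intr)
    show "\<bar>\<integral>\<omega>. ?D k \<omega> \<partial>M\<bar> \<le> (\<integral>\<omega>. exp (B * real m) * (mesh n * \<bar>drift n (?Y k \<omega>)\<bar>) \<partial>M)"
      unfolding one_step
    proof (rule order_trans[OF integral_abs_bound integral_mono[OF _ int le]])
      show "integrable M (\<lambda>\<omega>. \<bar>below n k \<omega> * exp (- cost n k \<omega>) * (mesh n * drift n (?Y k \<omega>))\<bar>)"
      proof (rule integrable_abs, rule Bochner_Integration.integrable_bound[OF int])
        show "(\<lambda>\<omega>. below n k \<omega> * exp (- cost n k \<omega>) * (mesh n * drift n (?Y k \<omega>))) \<in> borel_measurable M"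
          by measurable
        show "AE \<omega> in M. norm (below n k \<omega> * exp (- cost n k \<omega>) * (mesh n * drift n (?Y k \<omega>)))
            \<le> norm (exp (B * real m) * (mesh n * \<bar>drift n (?Y k \<omega>)\<bar>))"
          unfolding real_norm_def using le by (intro AE_I2 order_trans[OF le abs_ge_self])
      qed
    qed
  qed
  also have "\<dots> = exp (B * real m) * (\<integral>\<omega>. drift_error m n \<omega> \<partial>M)"
    using intr by (simp add: drift_error_def Bochner_Integration.integral_sum sum_distrib_left)
  finally show ?thesis .
qed

text \<open>
  Optional stopping at the local time level, cut off at the horizon: the identity holds along the
  dyadic grids up to an error that vanishes, and everything converges by right-continuity.
\<close>

theorem stopped_exponential_martingale:
  "(\<integral>\<omega>. u (X (level_time b h m \<omega>) \<omega>) * exp (- occ V (level_time b h m \<omega>) \<omega>) \<partial>M) = u 0"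
  and stopped_exponential_measurable:
  "(\<lambda>\<omega>. u (X (level_time b h m \<omega>) \<omega>) * exp (- occ V (level_time b h m \<omega>) \<omega>)) \<in> borel_measurable M"
proof -
  let ?E = "\<lambda>\<omega>. u (X (level_time b h m \<omega>) \<omega>) * exp (- occ V (level_time b h m \<omega>) \<omega>)"
  have lim: "(\<lambda>n. discounted n (steps m n \<omega>) \<omega>) \<longlonglongrightarrow> ?E \<omega>" if w: "\<omega> \<in> space M" for \<omega>
    unfolding discounted_def
  proof (intro tendsto_mult tendsto_exp tendsto_minus)
    \<comment> \<open>the grid times approach the stopping time from the right\<close>
    have "\<forall>\<^sub>F n in sequentially. X (mesh n * real (steps m n \<omega>)) \<omega> = X (level_time b h m \<omega>) \<omega>"
      by (rule path_eventually_const[OF w level_time_nonneg level_step_approximates(1)[OF w] level_step_tendsto[OF w]])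
    then show "(\<lambda>n. u (X (mesh n * real (steps m n \<omega>)) \<omega>)) \<longlonglongrightarrow> u (X (level_time b h m \<omega>) \<omega>)"
      by (intro tendsto_eventually) (auto elim!: eventually_mono)
    show "(\<lambda>n. cost n (steps m n \<omega>) \<omega>) \<longlonglongrightarrow> occ V (level_time b h m \<omega>) \<omega>"
      unfolding cost_def by (rule left_sum_tendsto[OF w V tendsto_const level_step_tendsto[OF w]])
  qed
  show meas: "?E \<in> borel_measurable M"
    by (rule borel_measurable_LIMSEQ_real[OF lim discounted_steps_measurable])
  have "(\<lambda>n. \<integral>\<omega>. discounted n (steps m n \<omega>) \<omega> \<partial>M) \<longlonglongrightarrow> (\<integral>\<omega>. ?E \<omega> \<partial>M)"
  proof (rule integral_dominated_convergence[OF meas discounted_steps_measurable])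
    show "integrable M (\<lambda>_. exp (B * real m))" by simp
    show "AE \<omega> in M. (\<lambda>n. discounted n (steps m n \<omega>) \<omega>) \<longlonglongrightarrow> ?E \<omega>" using lim by (intro AE_I2)
    show "AE \<omega> in M. norm (discounted n (steps m n \<omega>) \<omega>) \<le> exp (B * real m)" for n
      using discounted_bound[OF level_step_le] by (intro AE_I2) simp
  qed
  moreover have "(\<lambda>n. \<integral>\<omega>. discounted n (steps m n \<omega>) \<omega> \<partial>M) \<longlonglongrightarrow> u 0"
  proof (rule LIM_zero_cancel, rule Lim_null_comparison)
    show "\<forall>\<^sub>F n in sequentially. norm ((\<integral>\<omega>. discounted n (steps m n \<omega>) \<omega> \<partial>M) - u 0) \<le> exp (B * real m) * (\<integral>\<omega>. drift_error m n \<omega> \<partial>M)"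
      using discounted_steps_expectation by (intro always_eventually allI) simp
    show "(\<lambda>n. exp (B * real m) * (\<integral>\<omega>. drift_error m n \<omega> \<partial>M)) \<longlonglongrightarrow> 0"
      by (rule tendsto_mult_right_zero[OF drift_error_tendsto_0])
  qed
  ultimately show "(\<integral>\<omega>. ?E \<omega> \<partial>M) = u 0" by (rule LIMSEQ_unique)
qed

end

section \<open>The inverse local time\<close>

context right_continuous_paths
begin

lemma occ_zero: "occ f 0 \<omega> = 0"
  by (simp add: occ_def)

lemma occ_increment:
  assumes w: "\<omega> \<in> space M" and f: "\<And>x. 0 \<le> f x" "\<And>x. f x \<le> 1" and st: "s \<le> t"
  shows "occ f t \<omega> \<le> occ f s \<omega> + (t - s)"
proof -
  let ?g = "\<lambda>t s. indicator {0<..<t} s * f (X (max 0 s) \<omega>)"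
  have f': "\<bar>f x\<bar> \<le> 1" for x using f[of x] by simp
  note int = occ_integrable[OF w f']
  have ind: "integrable lborel (indicator {s..t} :: real \<Rightarrow> real)"
    using st by (intro integrable_real_indicator) auto
  have "occ f t \<omega> \<le> (\<integral>r. ?g s r + indicator {s..t} r \<partial>lborel)"
    unfolding occ_def
  proof (rule integral_mono[OF int Bochner_Integration.integrable_add[OF int ind]])
    show "?g t r \<le> ?g s r + indicator {s..t} r" for r
      using f by (auto simp: indicator_def)
  qed
  also have "\<dots> = occ f s \<omega> + (t - s)"
    unfolding occ_def using st by (subst Bochner_Integration.integral_add[OF int ind]) simp
  finally show ?thesis .
qed

text \<open>
  If this set is empty the inverse local time is infinite; otherwise it is the infimum of the set.
\<close>

definition exceeds :: "int \<Rightarrow> real \<Rightarrow> 'a \<Rightarrow> real set" where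
  "exceeds b h \<omega> = {t. 0 \<le> t \<and> h < occ (indicator {b}) t \<omega>}"

lemma level_time_alt: "level_time b h m \<omega> = Inf (insert (real m) (exceeds b h \<omega>))"
  by (simp add: level_time_def exceeds_def)

lemma exceeds_bdd: "bdd_below (exceeds b h \<omega>)"
  by (rule bdd_belowI[of _ 0]) (simp add: exceeds_def)

lemma level_time_empty: "exceeds b h \<omega> = {} \<Longrightarrow> level_time b h m \<omega> = real m"
  by (simp add: level_time_alt)

lemma level_time_nonempty:
  "exceeds b h \<omega> \<noteq> {} \<Longrightarrow> level_time b h m \<omega> = min (real m) (Inf (exceeds b h \<omega>))"
  unfolding level_time_alt using exceeds_bdd by (simp add: cInf_insert inf_min)

lemma crossing_nonneg: "exceeds b h \<omega> \<noteq> {} \<Longrightarrow> 0 \<le> Inf (exceeds b h \<omega>)"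
  by (rule cInf_greatest) (auto simp: exceeds_def)

lemma occ_before_crossing:
  assumes "t < Inf (exceeds b h \<omega>)" "0 \<le> t"
  shows "occ (indicator {b}) t \<omega> \<le> h"
  using assms cInf_lower[OF _ exceeds_bdd, of t b h \<omega>] by (fastforce simp: exceeds_def)

context
  fixes b :: int and h :: real and \<omega>
  assumes w: "\<omega> \<in> space M" and h: "0 \<le> h"
begin

text \<open>
  Local times are continuous, being Lipschitz in time.
\<close>

lemma occ_at_crossing:
  assumes ne: "exceeds b h \<omega> \<noteq> {}"
  shows "occ (indicator {b}) (Inf (exceeds b h \<omega>)) \<omega> = h"
proof (rule antisym)
  let ?r = "Inf (exceeds b h \<omega>)" and ?l = "\<lambda>t. occ (indicator {b}) t \<omega>"
  have inc: "?l t \<le> ?l s + (t - s)" if "s \<le> t" for s t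
    using that by (intro occ_increment[OF w]) (auto simp: indicator_def)
  show "?l ?r \<le> h"
  proof (cases "?r = 0")
    case True
    then show ?thesis using h by (simp add: occ_zero)
  next
    case False
    then have pos: "0 < ?r" using crossing_nonneg[OF ne] by simp
    show ?thesis
    proof (rule field_le_epsilon)
      fix e :: real assume e: "0 < e"
      define t where "t = max 0 (?r - e)"
      have "t < ?r" "0 \<le> t" "?r - t \<le> e" using e pos by (auto simp: t_def)
      then show "?l ?r \<le> h + e" using inc[of t ?r] occ_before_crossing[of t b h \<omega>] by simp
    qed
  qed
  show "h \<le> ?l ?r"
  proof (rule field_le_epsilon)
    fix e :: real assume e: "0 < e"
    then obtain t where t: "t \<in> exceeds b h \<omega>" "t < ?r + e"
      using cInf_lessD[OF ne, of "?r + e"] by auto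
    then have "?r \<le> t" using cInf_lower[OF _ exceeds_bdd] by auto
    then show "h \<le> ?l ?r + e" using inc[of ?r t] t by (auto simp: exceeds_def)
  qed
qed

text \<open>
  Otherwise the walk would stay off \<open>b\<close> for a while after the crossing, and the local time at
  \<open>b\<close> would not exceed \<open>h\<close> immediately after it.
\<close>

lemma position_at_crossing:
  assumes ne: "exceeds b h \<omega> \<noteq> {}"
  shows "X (Inf (exceeds b h \<omega>)) \<omega> = b"
proof (rule ccontr)
  let ?r = "Inf (exceeds b h \<omega>)"
  assume nb: "X ?r \<omega> \<noteq> b"
  have r0: "0 \<le> ?r" by (rule crossing_nonneg[OF ne])
  obtain d where d: "?r < d" "\<And>y. ?r < y \<Longrightarrow> y < d \<Longrightarrow> X y \<omega> = X ?r \<omega>"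
    using X_right[OF w r0] by (auto simp: eventually_at_right_field)
  obtain t where t: "t \<in> exceeds b h \<omega>" "t < d" using cInf_lessD[OF ne d(1)] by auto
  have rt: "?r \<le> t" using t cInf_lower[OF _ exceeds_bdd] by auto
  have "indicator {0<..<t} s * indicator {b} (X (max 0 s) \<omega>)
      = (indicator {0<..<?r} s * indicator {b} (X (max 0 s) \<omega>) :: real)" for s
  proof (cases "?r \<le> s \<and> s < t")
    case True
    then have "X s \<omega> = X ?r \<omega>" using d(2)[of s] t by (cases "s = ?r") auto
    then show ?thesis using True nb r0 by (simp add: indicator_def)
  next
    case False
    then show ?thesis using rt by (auto simp: indicator_def)
  qed
  then have "occ (indicator {b}) t \<omega> = occ (indicator {b}) ?r \<omega>"
    unfolding occ_def by (simp only:)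
  then show False using t(1) occ_at_crossing[OF ne] by (simp add: exceeds_def)
qed

lemma occ_level_time_le: "occ (indicator {b}) (level_time b h m \<omega>) \<omega> \<le> h"
proof (cases "exceeds b h \<omega> = {}")
  case True
  then show ?thesis by (auto simp: level_time_empty exceeds_def not_less)
next
  case False
  have "occ (indicator {b}) (level_time b h m \<omega>) \<omega> \<le> occ (indicator {b}) (Inf (exceeds b h \<omega>)) \<omega>"
    by (intro occ_mono[OF w, where C=1]) (auto simp: level_time_nonempty[OF False] indicator_def)
  then show ?thesis by (simp add: occ_at_crossing[OF False])
qed

lemma local_time_eq_occ:
  assumes "0 \<le> t"
  shows "local_time X (ereal t) x \<omega> = occ (indicator {x}) t \<omega>"
  unfolding local_time_def occ_def interval_lebesgue_integral_def set_lebesgue_integral_def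
  using assms by (auto simp: einterval_eq zero_ereal_def intro!: Bochner_Integration.integral_cong
      split: split_indicator)

lemma inverse_local_time_eq:
  "inverse_local_time X b h \<omega> = (if exceeds b h \<omega> = {} then \<infinity> else ereal (Inf (exceeds b h \<omega>)))"
proof -
  have "{ereal t | t. 0 < t \<and> local_time X (ereal t) b \<omega> > h} = ereal ` exceeds b h \<omega>"
  proof -
    have "0 < t \<and> h < local_time X (ereal t) b \<omega> \<longleftrightarrow> t \<in> exceeds b h \<omega>" for t
      using h by (cases "t = 0") (auto simp: exceeds_def local_time_eq_occ occ_zero)
    then show ?thesis by auto
  qed
  then have T: "inverse_local_time X b h \<omega> = Inf (ereal ` exceeds b h \<omega>)"
    by (simp add: inverse_local_time_def)
  show ?thesis
  proof (cases "exceeds b h \<omega> = {}")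
    case False
    have "ereal (Inf (exceeds b h \<omega>)) = Inf (ereal ` exceeds b h \<omega>)"
      using exceeds_bdd False by (intro ereal_Inf') 
    then show ?thesis using False T by simp
  qed (simp add: T top_ereal_def)
qed

lemma stopped_local_time_eq:
  assumes "exceeds b h \<omega> \<noteq> {}"
  shows "stopped_local_time X b h x \<omega> = occ (indicator {x}) (Inf (exceeds b h \<omega>)) \<omega>"
  using assms crossing_nonneg[OF assms]
  by (simp add: stopped_local_time_def inverse_local_time_eq local_time_eq_occ)

text \<open>
  This makes the inverse local time measurable, on the event where it is infinite too.
\<close>

lemma inverse_local_time_eq_SUP: "inverse_local_time X b h \<omega> = (SUP m. ereal (level_time b h m \<omega>))"
proof (cases "exceeds b h \<omega> = {}")
  case True
  have "(SUP m. ereal (real m)) = \<infinity>"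
    by (intro SUP_PInfty) (metis ereal_less_eq(3) UNIV_I order_refl)
  then show ?thesis using True by (simp add: inverse_local_time_eq level_time_empty)
next
  case False
  let ?r = "Inf (exceeds b h \<omega>)"
  have "(SUP m. ereal (level_time b h m \<omega>)) = ereal ?r"
  proof (rule antisym)
    show "(SUP m. ereal (level_time b h m \<omega>)) \<le> ereal ?r"
      by (rule SUP_least) (simp add: level_time_nonempty[OF False])
    obtain m :: nat where "?r \<le> real m" using real_arch_simple by blast
    then have "ereal ?r = ereal (level_time b h m \<omega>)" by (simp add: level_time_nonempty[OF False])
    also have "\<dots> \<le> (SUP m. ereal (level_time b h m \<omega>))" by (rule SUP_upper) simp
    finally show "ereal ?r \<le> (SUP m. ereal (level_time b h m \<omega>))" .
  qed
  then show ?thesis using False by (simp add: inverse_local_time_eq)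
qed

end

lemma stopped_local_time_nonneg: "0 \<le> stopped_local_time X b h x \<omega>"
proof -
  have "0 \<le> inverse_local_time X b h \<omega>"
    unfolding inverse_local_time_def by (rule Inf_greatest) auto
  then show ?thesis
    unfolding stopped_local_time_def local_time_def interval_lebesgue_integral_def set_lebesgue_integral_def
    by (auto intro!: integral_nonneg_AE AE_I2)
qed

end

context srw
begin

lemma occ_measurable:
  fixes f :: "int \<Rightarrow> real"
  assumes "\<And>x. \<bar>f x\<bar> \<le> C"
  shows "occ f (mesh n * real k) \<in> borel_measurable M"
  by (rule past_measurable_M[OF occ_past[OF assms]])

lemma level_time_measurable: "level_time b h m \<in> borel_measurable M"
proof (rule borel_measurable_LIMSEQ_real)
  fix n
  have step: "real (level_step b h m n \<omega>)
      = (\<Sum>k<m * 2 ^ n. if occ (indicator {b}) (mesh n * real k) \<omega> \<le> h then 1 else 0)" if w: "\<omega> \<in> space M" for \<omega>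
  proof -
    have "(\<Sum>k<m * 2 ^ n. if occ (indicator {b}) (mesh n * real k) \<omega> \<le> h then 1 else 0)
        = (\<Sum>k<m * 2 ^ n. if k < level_step b h m n \<omega> then 1 else 0 :: real)"
      by (intro sum.cong refl) (auto simp: less_level_step_iff[OF w])
    also have "\<dots> = (\<Sum>k<level_step b h m n \<omega>. 1)"
      using level_step_le[of b h m n \<omega>] by (intro sum.mono_neutral_cong_right) auto
    finally show ?thesis by simp
  qed
  have [measurable]: "occ (indicator {b}) (mesh n * real k) \<in> borel_measurable M" for k
    by (rule occ_measurable[where C=1]) (auto simp: indicator_def)
  have "(\<lambda>\<omega>. mesh n * (\<Sum>k<m * 2 ^ n. if occ (indicator {b}) (mesh n * real k) \<omega> \<le> h then 1 else 0))
      \<in> borel_measurable M"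
    by measurable
  then show "(\<lambda>\<omega>. mesh n * real (level_step b h m n \<omega>)) \<in> borel_measurable M"
    by (rule subst[OF measurable_cong, rotated]) (simp add: step)
qed (rule level_step_tendsto)

text \<open>
  The event of an infinite inverse local time is null, but the function has to be measurable there
  too.
\<close>

lemma stopped_local_time_measurable:
  assumes "0 \<le> h"
  shows "stopped_local_time X b h x \<in> borel_measurable M"
proof -
  define T where "T \<omega> = (SUP m. ereal (level_time b h m \<omega>))" for \<omega>
  define F :: "'a \<times> real \<Rightarrow> real" where "F z = indicator {0<..} (snd z) * (if ereal (snd z) < T (fst z) then 1 else 0)
      * indicator {x} (X (max 0 (snd z)) (fst z))" for z :: "'a \<times> real"
  have [measurable]: "T \<in> borel_measurable M"
    unfolding T_def[abs_def] using level_time_measurable by measurable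
  have "(\<lambda>z. (\<lambda>z. indicator {x} (X (max 0 (fst z)) (snd z)) :: real) (case z of (a, b) \<Rightarrow> (b, a)))
      \<in> borel_measurable (M \<Otimes>\<^sub>M (borel :: real measure))"
    using measurable_compose[OF measurable_pair_swap' measurable_path_pair[of "indicator {x}"]] .
  then have [measurable]: "(\<lambda>z. indicator {x} (X (max 0 (snd z)) (fst z)) :: real) \<in> borel_measurable (M \<Otimes>\<^sub>M (borel :: real measure))"
    by (simp add: case_prod_beta')
  have F: "F \<in> borel_measurable (M \<Otimes>\<^sub>M (borel :: real measure))"
    unfolding F_def[abs_def] by measurable
  have "sets (M \<Otimes>\<^sub>M (lborel :: real measure)) = sets (M \<Otimes>\<^sub>M (borel :: real measure))"
    by (rule sets_pair_measure_cong) auto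
  then have F': "F \<in> borel_measurable (M \<Otimes>\<^sub>M (lborel :: real measure))"
    using F by (simp cong: measurable_cong_sets)
  have "(\<lambda>\<omega>. \<integral>s. F (\<omega>, s) \<partial>lborel) \<in> borel_measurable M"
    using lborel.borel_measurable_lebesgue_integral[of "\<lambda>\<omega> s. F (\<omega>, s)" M] F' by simp
  moreover have "stopped_local_time X b h x \<omega> = (\<integral>s. F (\<omega>, s) \<partial>lborel)" if w: "\<omega> \<in> space M" for \<omega>
  proof -
    have "0 \<le> inverse_local_time X b h \<omega>"
      unfolding inverse_local_time_def by (rule Inf_greatest) auto
    then show ?thesis
      unfolding stopped_local_time_def local_time_def interval_lebesgue_integral_def set_lebesgue_integral_def
      by (auto intro!: Bochner_Integration.integral_cong simp: einterval_def F_def T_def zero_ereal_def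
          inverse_local_time_eq_SUP[OF w assms, symmetric] split: split_indicator)
  qed
  ultimately show ?thesis by (subst measurable_cong)
qed

end

section \<open>Recurrence and the Laplace functional of the local times\<close>

context right_continuous_paths
begin

lemma occ_cmult: "occ (\<lambda>x. c * f x) t \<omega> = c * occ f t \<omega>"
  unfolding occ_def by (simp add: mult.left_commute)

lemma occ_add:
  assumes "\<omega> \<in> space M" "\<And>x. \<bar>f x\<bar> \<le> C" "\<And>x. \<bar>g x\<bar> \<le> D"
  shows "occ (\<lambda>x. f x + g x) t \<omega> = occ f t \<omega> + occ g t \<omega>"
  unfolding occ_def using occ_integrable[where f = f, OF assms(1,2), of t] occ_integrable[where f = g, OF assms(1,3), of t]
  by (simp add: distrib_left Bochner_Integration.integral_add)

lemma occ_const: "0 \<le> t \<Longrightarrow> occ (\<lambda>_. c) t \<omega> = c * t"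
  by (simp add: occ_def)

lemma occ_sum:
  assumes "\<omega> \<in> space M" "finite F" "\<And>i x. i \<in> F \<Longrightarrow> \<bar>f i x\<bar> \<le> C i"
  shows "occ (\<lambda>x. \<Sum>i\<in>F. f i x) t \<omega> = (\<Sum>i\<in>F. occ (f i) t \<omega>)"
proof -
  have "occ (\<lambda>x. \<Sum>i\<in>F. f i x) t \<omega> = (\<integral>s. (\<Sum>i\<in>F. indicator {0<..<t} s * f i (X (max 0 s) \<omega>)) \<partial>lborel)"
    by (simp add: occ_def sum_distrib_left)
  also have "\<dots> = (\<Sum>i\<in>F. occ (f i) t \<omega>)"
    unfolding occ_def using assms by (intro Bochner_Integration.integral_sum occ_integrable) auto
  finally show ?thesis .
qed

lemma occ_mono_fun:
  assumes "\<omega> \<in> space M" "\<And>x. \<bar>f x\<bar> \<le> C" "\<And>x. \<bar>g x\<bar> \<le> D" "\<And>x. f x \<le> g x"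
  shows "occ f t \<omega> \<le> occ g t \<omega>"
  unfolding occ_def using assms(4)
  by (intro integral_mono occ_integrable[where f = f, OF assms(1,2)] occ_integrable[where f = g, OF assms(1,3)])
    (auto simp: indicator_def)

end

context exponential_martingale
begin

definition stopped :: "nat \<Rightarrow> 'a \<Rightarrow> real" where
  "stopped m \<omega> = u (X (level_time b h m \<omega>) \<omega>) * exp (- occ V (level_time b h m \<omega>) \<omega>)"

text \<open>
  Before the stopping time the local time at \<open>b\<close> is at most \<open>h\<close>, and only \<open>b\<close> can make \<open>V\<close>
  negative; so the stopped martingale is bounded uniformly in the horizon.
\<close>

lemma stopped_bound:
  assumes w: "\<omega> \<in> space M" and h: "0 \<le> h" and c: "c \<le> 0" and V_ge: "\<And>x. (if x = b then c else 0) \<le> V x"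
  shows "\<bar>stopped m \<omega>\<bar> \<le> exp (- c * h)"
proof -
  let ?t = "level_time b h m \<omega>"
  have "c * h \<le> c * occ (indicator {b}) ?t \<omega>"
    using occ_level_time_le[OF w h, of b m] c by (rule mult_left_mono_neg)
  also have "\<dots> = occ (\<lambda>x. c * indicator {b} x) ?t \<omega>" by (rule occ_cmult[symmetric])
  also have "\<dots> \<le> occ V ?t \<omega>"
  proof (rule occ_mono_fun[OF w _ V])
    show "\<bar>c * indicator {b} x\<bar> \<le> \<bar>c\<bar>" for x by (simp add: indicator_def)
    show "c * indicator {b} x \<le> V x" for x using V_ge[of x] by (simp add: indicator_def split: if_splits)
  qed
  finally have "exp (- occ V ?t \<omega>) \<le> exp (- c * h)" by simp
  then show ?thesis
    using u norm_mult_unit_le(2)[of "exp (- occ V ?t \<omega>)" "exp (- c * h)"] by (simp add: stopped_def)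
qed

lemma stopped_eventually:
  assumes w: "\<omega> \<in> space M" and h: "0 \<le> h" and ne: "exceeds b h \<omega> \<noteq> {}"
  shows "(\<lambda>m. stopped m \<omega>) \<longlonglongrightarrow> u b * exp (- occ V (Inf (exceeds b h \<omega>)) \<omega>)"
proof (rule tendsto_eventually)
  obtain N :: nat where N: "Inf (exceeds b h \<omega>) \<le> real N" using real_arch_simple by blast
  show "\<forall>\<^sub>F m in sequentially. stopped m \<omega> = u b * exp (- occ V (Inf (exceeds b h \<omega>)) \<omega>)"
    using eventually_ge_at_top[of N]
  proof eventually_elim
    case (elim m)
    then have "level_time b h m \<omega> = Inf (exceeds b h \<omega>)"
      using N by (simp add: level_time_nonempty[OF ne])
    then show ?case by (simp add: stopped_def position_at_crossing[OF w h ne])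
  qed
qed

end

context srw
begin

lemma exceeds_measurable: "{\<omega>\<in>space M. exceeds b h \<omega> \<noteq> {}} \<in> sets M"
proof -
  have eq: "exceeds b h \<omega> \<noteq> {} \<longleftrightarrow> (\<exists>m. h < occ (indicator {b}) (mesh 0 * real m) \<omega>)" if w: "\<omega> \<in> space M" for \<omega>
  proof
    assume "exceeds b h \<omega> \<noteq> {}"
    then obtain t where t: "0 \<le> t" "h < occ (indicator {b}) t \<omega>" by (auto simp: exceeds_def)
    obtain m :: nat where "t \<le> real m" using real_arch_simple by blast
    then have "occ (indicator {b}) t \<omega> \<le> occ (indicator {b}) (mesh 0 * real m) \<omega>"
      by (intro occ_mono[OF w, where C=1]) (auto simp: indicator_def mesh_def)
    then show "\<exists>m. h < occ (indicator {b}) (mesh 0 * real m) \<omega>" using t by (intro exI[of _ m]) simp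
  next
    assume "\<exists>m. h < occ (indicator {b}) (mesh 0 * real m) \<omega>"
    then obtain m where "mesh 0 * real m \<in> exceeds b h \<omega>" by (auto simp: exceeds_def)
    then show "exceeds b h \<omega> \<noteq> {}" by blast
  qed
  have [measurable]: "occ (indicator {b}) (mesh 0 * real m) \<in> borel_measurable M" for m
    by (rule occ_measurable[where C=1]) (auto simp: indicator_def)
  have "{\<omega>\<in>space M. \<exists>m. h < occ (indicator {b}) (mesh 0 * real m) \<omega>} \<in> sets M" by measurable
  then show ?thesis using eq by (simp cong: conj_cong)
qed

text \<open>
  Take \<open>u(x) = \<rho>^\<bar>x - b\<bar>\<close>. Away from \<open>b\<close> it is an eigenfunction with a positive eigenvalue
  \<open>\<Lambda>\<close>, and at \<open>b\<close> the potential is \<open>2 * \<rho> - 2\<close>. On the event that the level is never reached, the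
  exponential discounting sends the stopped martingale to \<open>0\<close>; on its complement the martingale
  is at most \<open>exp ((2 - 2 * \<rho>) * h)\<close>. Its expectation is \<open>u 0\<close> throughout.
\<close>

lemma crossing_probability_lower:
  assumes h: "0 \<le> h" and \<rho>: "0 < \<rho>" "\<rho> < 1"
  shows "\<rho> ^ nat \<bar>b\<bar> * exp ((2 * \<rho> - 2) * h) \<le> prob {\<omega>\<in>space M. exceeds b h \<omega> \<noteq> {}}"
proof -
  let ?A = "{\<omega>\<in>space M. exceeds b h \<omega> \<noteq> {}}"
  define u :: "int \<Rightarrow> real" where "u x = \<rho> ^ nat \<bar>x - b\<bar>" for x
  define c where "c = 2 * \<rho> - 2"
  define \<Lambda> where "\<Lambda> = \<rho> + 1 / \<rho> - 2"
  define V :: "int \<Rightarrow> real" where "V x = \<Lambda> + (c - \<Lambda>) * indicator {b} x" for x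
  have c: "c \<le> 0" using \<rho> by (simp add: c_def)
  have "\<Lambda> = (1 - \<rho>)\<^sup>2 / \<rho>" using \<rho> by (simp add: \<Lambda>_def power2_eq_square field_simps)
  then have \<Lambda>: "0 < \<Lambda>" using \<rho> by simp
  interpret exponential_martingale M X P u V "\<bar>c\<bar> + \<bar>\<Lambda>\<bar>" b h
  proof
    show "0 \<le> u x" "u x \<le> 1" for x using \<rho> by (auto simp: u_def power_le_one)
    show "\<bar>V x\<bar> \<le> \<bar>c\<bar> + \<bar>\<Lambda>\<bar>" for x by (auto simp: V_def indicator_def)
    fix x
    consider "x = b" | "b < x" | "x < b" by linarith
    then show "u (x + 1) + u (x - 1) - 2 * u x = V x * u x"
    proof cases
      case 1
      then show ?thesis by (simp add: u_def V_def c_def)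
    next
      case 2
      define k where "k = nat (x - b - 1)"
      have "nat \<bar>x - b\<bar> = Suc k" "nat \<bar>x + 1 - b\<bar> = Suc (Suc k)" "nat \<bar>x - 1 - b\<bar> = k"
        using 2 by (auto simp: k_def)
      then show ?thesis using 2 \<rho> by (simp add: u_def V_def \<Lambda>_def field_simps)
    next
      case 3
      define k where "k = nat (b - x - 1)"
      have "nat \<bar>x - b\<bar> = Suc k" "nat \<bar>x + 1 - b\<bar> = k" "nat \<bar>x - 1 - b\<bar> = Suc (Suc k)"
        using 3 by (auto simp: k_def)
      then show ?thesis using 3 \<rho> by (simp add: u_def V_def \<Lambda>_def field_simps)
    qed
  qed
  \<comment> \<open>the limit of the stopped martingale as the horizon grows\<close>
  define G where "G \<omega> = (if exceeds b h \<omega> = {} then 0 else u b * exp (- occ V (Inf (exceeds b h \<omega>)) \<omega>))" for \<omega>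
  have V_ge: "(if x = b then c else 0) \<le> V x" for x using \<Lambda> by (simp add: V_def)
  have lim: "(\<lambda>m. stopped m \<omega>) \<longlonglongrightarrow> G \<omega>" if w: "\<omega> \<in> space M" for \<omega>
  proof (cases "exceeds b h \<omega> = {}")
    case False
    then show ?thesis using stopped_eventually[OF w h False] by (simp add: G_def)
  next
    case True
    have "\<bar>stopped m \<omega>\<bar> \<le> exp (- (\<Lambda> * real m + (c - \<Lambda>) * h))" for m
    proof -
      have "occ V (real m) \<omega> = occ (\<lambda>_. \<Lambda>) (real m) \<omega> + occ (\<lambda>x. (c - \<Lambda>) * indicator {b} x) (real m) \<omega>"
        unfolding V_def by (rule occ_add[OF w, where C="\<bar>\<Lambda>\<bar>" and D="\<bar>c - \<Lambda>\<bar>"]) (auto simp: indicator_def)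
      also have "\<dots> = \<Lambda> * real m + (c - \<Lambda>) * occ (indicator {b}) (real m) \<omega>"
        by (simp only: occ_cmult) (simp add: occ_const)
      also have "\<dots> \<ge> \<Lambda> * real m + (c - \<Lambda>) * h"
        using occ_level_time_le[OF w h, of b m] c \<Lambda>
        by (intro add_left_mono mult_left_mono_neg) (auto simp: level_time_empty[OF True])
      finally have "exp (- occ V (real m) \<omega>) \<le> exp (- (\<Lambda> * real m + (c - \<Lambda>) * h))" by simp
      then show ?thesis
        using u norm_mult_unit_le(2)[of "exp (- occ V (real m) \<omega>)"] by (simp add: stopped_def level_time_empty[OF True])
    qed
    then have ev: "\<forall>\<^sub>F m in sequentially. norm (stopped m \<omega>) \<le> exp (- (\<Lambda> * real m + (c - \<Lambda>) * h))"
      by (intro always_eventually allI) simp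
    have "(\<lambda>m. exp (- (\<Lambda> * real m + (c - \<Lambda>) * h))) \<longlonglongrightarrow> 0"
      using \<Lambda> by real_asymp
    with ev have "(\<lambda>m. stopped m \<omega>) \<longlonglongrightarrow> 0"
      by (rule Lim_null_comparison)
    then show ?thesis using True by (simp add: G_def)
  qed
  have meas: "stopped m \<in> borel_measurable M" for m
    unfolding stopped_def[abs_def] by (rule stopped_exponential_measurable)
  have G: "G \<in> borel_measurable M" by (rule borel_measurable_LIMSEQ_real[OF lim meas])
  have bound: "\<bar>stopped m \<omega>\<bar> \<le> exp (- c * h)" if "\<omega> \<in> space M" for m \<omega>
    by (rule stopped_bound[OF that h c V_ge])
  have "(\<lambda>m. \<integral>\<omega>. stopped m \<omega> \<partial>M) \<longlonglongrightarrow> (\<integral>\<omega>. G \<omega> \<partial>M)"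
  proof (rule integral_dominated_convergence[OF G meas])
    show "integrable M (\<lambda>_. exp (- c * h))" by simp
  qed (use lim bound in \<open>auto intro!: AE_I2\<close>)
  moreover have "(\<integral>\<omega>. stopped m \<omega> \<partial>M) = u 0" for m
    unfolding stopped_def by (rule stopped_exponential_martingale)
  ultimately have "u 0 = (\<integral>\<omega>. G \<omega> \<partial>M)" using LIMSEQ_unique[OF tendsto_const] by simp
  also have "\<dots> \<le> (\<integral>\<omega>. exp (- c * h) * indicator ?A \<omega> \<partial>M)"
  proof (rule integral_mono_AE)
    have Gb: "\<bar>G \<omega>\<bar> \<le> exp (- c * h)" if "\<omega> \<in> space M" for \<omega>
      using tendsto_rabs[OF lim[OF that]] bound[OF that] by (intro LIMSEQ_le_const2) auto
    show "integrable M G" using Gb G by (intro integrable_const_bound[where B="exp (- c * h)"]) auto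
    show "integrable M (\<lambda>\<omega>. exp (- c * h) * indicator ?A \<omega>)"
      using exceeds_measurable by (intro integrable_mult_right) (auto simp: emeasure_eq_measure)
    show "AE \<omega> in M. G \<omega> \<le> exp (- c * h) * indicator ?A \<omega>"
    proof (rule AE_I2)
      fix \<omega> assume w: "\<omega> \<in> space M"
      show "G \<omega> \<le> exp (- c * h) * indicator ?A \<omega>"
        using Gb[OF w] w by (cases "exceeds b h \<omega> = {}") (auto simp: G_def)
    qed
  qed
  also have "\<dots> = exp (- c * h) * prob ?A" using exceeds_measurable by simp
  finally have "u 0 * exp (c * h) \<le> (exp (- c * h) * prob ?A) * exp (c * h)" by (intro mult_right_mono) auto
  also have "\<dots> = prob ?A" by (simp add: mult.commute mult.left_commute exp_add[symmetric])
  finally show ?thesis by (simp add: u_def c_def)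
qed

text \<open>
  Letting \<open>\<rho>\<close> tend to \<open>1\<close> in the lower bound: the walk is recurrent.
\<close>

lemma exceeds_AE:
  assumes h: "0 \<le> h"
  shows "AE \<omega> in M. exceeds b h \<omega> \<noteq> {}"
proof -
  let ?A = "{\<omega>\<in>space M. exceeds b h \<omega> \<noteq> {}}"
  let ?\<rho> = "\<lambda>n. 1 - 1 / (real n + 2)"
  have "?\<rho> \<longlonglongrightarrow> 1" by real_asymp
  then have lim: "(\<lambda>n. ?\<rho> n ^ nat \<bar>b\<bar> * exp ((2 * ?\<rho> n - 2) * h)) \<longlonglongrightarrow> 1 ^ nat \<bar>b\<bar> * exp ((2 * 1 - 2) * h)"
    by (intro tendsto_intros)
  have le: "?\<rho> n ^ nat \<bar>b\<bar> * exp ((2 * ?\<rho> n - 2) * h) \<le> prob ?A" for n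
    by (rule crossing_probability_lower[OF h]) (auto simp: field_simps)
  have "1 ^ nat \<bar>b\<bar> * exp ((2 * 1 - 2) * h) \<le> prob ?A"
    using le by (intro LIMSEQ_le_const2[OF lim]) blast
  then have "prob ?A = 1" using prob_le_1[of ?A] by simp
  from AE_in_set_eq_1[OF exceeds_measurable, THEN iffD2, OF this] show ?thesis by auto
qed

lemma stopped_local_time_at_level:
  assumes "0 \<le> h"
  shows "AE \<omega> in M. stopped_local_time X b h b \<omega> = h"
  using exceeds_AE[OF assms, of b]
  by (rule AE_mp, intro AE_I2 impI) (simp add: stopped_local_time_eq occ_at_crossing assms)

text \<open>
  By stopping at the inverse local time, where the walk is at \<open>b\<close> and has local time \<open>h\<close> there. The
  potential is the given rate on \<open>F\<close> and \<open>u(b + 1) + u(b - 1) - 2\<close> at \<open>b\<close>, since \<open>u(b) = 1\<close>; the latter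
  contributes the deterministic factor.
\<close>

theorem laplace_functional:
  fixes F :: "int set" and q :: "int \<Rightarrow> real"
  assumes h: "0 \<le> h" and F: "finite F" "b \<notin> F" and q: "\<And>x. x \<in> F \<Longrightarrow> 0 \<le> q x"
    and u: "\<And>x. 0 \<le> u x" "\<And>x. u x \<le> 1" "u b = 1"
    and harm: "\<And>x. x \<noteq> b \<Longrightarrow> u (x + 1) + u (x - 1) - 2 * u x = (if x \<in> F then q x else 0) * u x"
  shows "(\<integral>\<omega>. exp (- (\<Sum>x\<in>F. q x * stopped_local_time X b h x \<omega>)) \<partial>M)
    = u 0 * exp (h * (u (b + 1) + u (b - 1) - 2))"
proof -
  note u_b = u(3)
  define c where "c = u (b + 1) + u (b - 1) - 2"
  have c: "c \<le> 0" using u(2)[of "b + 1"] u(2)[of "b - 1"] by (simp add: c_def)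
  define V where "V y = (\<Sum>x\<in>F. q x * indicator {x} y) + c * indicator {b} y" for y :: int
  have sumF: "(\<Sum>x\<in>F. q x * indicator {x} y) = (if y \<in> F then q y else 0)" for y
  proof -
    have "(\<Sum>x\<in>F. q x * indicator {x} y) = (\<Sum>x\<in>F. if x = y then q y else 0)"
      by (intro sum.cong) (auto simp: indicator_def)
    then show ?thesis using F by simp
  qed
  have Vb: "V y = (if y = b then c else if y \<in> F then q y else 0)" for y
    using F by (simp add: V_def sumF)
  have sumbd: "\<bar>\<Sum>x\<in>F. q x * indicator {x} y\<bar> \<le> (\<Sum>x\<in>F. q x)" for y
    using F q by (auto simp: sumF sum_nonneg intro!: member_le_sum)
  interpret exponential_martingale M X P u V "(\<Sum>x\<in>F. q x) + \<bar>c\<bar>" b h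
  proof
    show "0 \<le> u x" "u x \<le> 1" for x using u by auto
    show "\<bar>V y\<bar> \<le> (\<Sum>x\<in>F. q x) + \<bar>c\<bar>" for y
    proof -
      have "\<bar>c * indicator {b} y\<bar> \<le> \<bar>c\<bar>" by (simp add: indicator_def)
      then show ?thesis using sumbd[of y] unfolding V_def by linarith
    qed
    show "u (x + 1) + u (x - 1) - 2 * u x = V x * u x" for x
      using harm[of x] u(3) by (cases "x = b") (auto simp: Vb c_def)
  qed
  have V_ge: "(if x = b then c else 0) \<le> V x" for x using q by (simp add: Vb)
  define G where "G \<omega> = exp (- (\<Sum>x\<in>F. q x * stopped_local_time X b h x \<omega>)) * exp (- (c * h))" for \<omega>
  have lim: "AE \<omega> in M. (\<lambda>m. stopped m \<omega>) \<longlonglongrightarrow> G \<omega>"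
    using exceeds_AE[OF h, of b]
  proof (rule AE_mp, intro AE_I2 impI)
    fix \<omega> assume w: "\<omega> \<in> space M" and ne: "exceeds b h \<omega> \<noteq> {}"
    let ?r = "Inf (exceeds b h \<omega>)"
    have "occ V ?r \<omega> = occ (\<lambda>y. \<Sum>x\<in>F. q x * indicator {x} y) ?r \<omega> + occ (\<lambda>y. c * indicator {b} y) ?r \<omega>"
      unfolding V_def by (rule occ_add[OF w sumbd, where D="\<bar>c\<bar>"]) (simp add: indicator_def)
    also have "occ (\<lambda>y. \<Sum>x\<in>F. q x * indicator {x} y) ?r \<omega> = (\<Sum>x\<in>F. occ (\<lambda>y. q x * indicator {x} y) ?r \<omega>)"
      using q by (intro occ_sum[OF w F(1), where C="q"]) (auto simp: indicator_def)
    also have "\<dots> = (\<Sum>x\<in>F. q x * stopped_local_time X b h x \<omega>)"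
      by (simp only: occ_cmult stopped_local_time_eq[OF w h ne])
    also have "occ (\<lambda>y. c * indicator {b} y) ?r \<omega> = c * h"
      by (simp only: occ_cmult occ_at_crossing[OF w h ne])
    finally show "(\<lambda>m. stopped m \<omega>) \<longlonglongrightarrow> G \<omega>"
      using stopped_eventually[OF w h ne] u_b by (simp add: G_def exp_add[symmetric])
  qed
  have meas: "stopped m \<in> borel_measurable M" for m
    unfolding stopped_def[abs_def] by (rule stopped_exponential_measurable)
  have [measurable]: "stopped_local_time X b h x \<in> borel_measurable M" for x
    by (rule stopped_local_time_measurable[OF h])
  have G: "G \<in> borel_measurable M" unfolding G_def[abs_def] by measurable
  have "(\<lambda>m. \<integral>\<omega>. stopped m \<omega> \<partial>M) \<longlonglongrightarrow> (\<integral>\<omega>. G \<omega> \<partial>M)"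
  proof (rule integral_dominated_convergence[OF G meas _ lim])
    show "integrable M (\<lambda>_. exp (- c * h))" by simp
    show "AE \<omega> in M. norm (stopped m \<omega>) \<le> exp (- c * h)" for m
      using stopped_bound[OF _ h c V_ge] by (intro AE_I2) simp
  qed
  moreover have "(\<integral>\<omega>. stopped m \<omega> \<partial>M) = u 0" for m
    unfolding stopped_def by (rule stopped_exponential_martingale)
  ultimately have "u 0 = (\<integral>\<omega>. G \<omega> \<partial>M)" using LIMSEQ_unique[OF tendsto_const] by simp
  also have "\<dots> = (\<integral>\<omega>. exp (- (\<Sum>x\<in>F. q x * stopped_local_time X b h x \<omega>)) \<partial>M) * exp (- (c * h))"
    unfolding G_def by simp
  finally have "u 0 * exp (c * h) = (\<integral>\<omega>. exp (- (\<Sum>x\<in>F. q x * stopped_local_time X b h x \<omega>)) \<partial>M)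
      * (exp (- (c * h)) * exp (c * h))" by simp
  then show ?thesis by (simp add: c_def exp_add[symmetric] mult.commute)
qed

end

section \<open>Laplace transforms determine laws\<close>

text \<open>
  For laws carried by \<open>{-1..1}\<close> the characteristic function is the sum of its moment series.
\<close>

lemma moments_determine_distribution:
  fixes D1 D2 :: "real measure"
  assumes D: "real_distribution D1" "real_distribution D2"
    and unit: "AE u in D1. \<bar>u\<bar> \<le> 1" "AE u in D2. \<bar>u\<bar> \<le> 1"
    and moments: "\<And>k::nat. (\<integral>u. u ^ k \<partial>D1) = (\<integral>u. u ^ k \<partial>D2)"
  shows "D1 = D2"
proof -
  have char_series: "char D t = (\<Sum>k. (\<i> * t) ^ k / fact k * (\<integral>u. u ^ k \<partial>D))"
    if "real_distribution D" and unit: "AE u in D. \<bar>u\<bar> \<le> 1" for D :: "real measure" and t :: real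
  proof -
    interpret real_distribution D by fact
    let ?f = "\<lambda>k u. (\<i> * t) ^ k / fact k * complex_of_real (u ^ k)"
    have pow: "AE u in D. \<bar>u ^ k\<bar> \<le> 1" for k
      using unit by eventually_elim (simp add: power_abs power_le_one)
    have int: "integrable D (\<lambda>u. u ^ k)" for k
      using pow[of k] by (intro integrable_const_bound[where B=1]) auto
    have intf: "integrable D (?f k)" for k
      by (intro integrable_mult_right integrable_of_real int)
    have norm: "norm (?f k u) = \<bar>t\<bar> ^ k / fact k * \<bar>u ^ k\<bar>" for k u
      by (simp add: norm_mult norm_divide norm_power power_abs)
    have bound: "AE u in D. norm (?f k u) \<le> \<bar>t\<bar> ^ k / fact k" for k
      using pow[of k] unfolding norm by eventually_elim (intro mult_left_le, auto)
    have summ: "summable (\<lambda>k. \<bar>t\<bar> ^ k / fact k)"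
      using summable_exp_generic[of "\<bar>t\<bar>"] by (simp add: divide_inverse mult.commute)
    have "char D t = (\<integral>u. (\<Sum>k. ?f k u) \<partial>D)"
      unfolding char_def
    proof (rule Bochner_Integration.integral_cong[OF refl])
      fix u :: real
      have "exp (\<i> * (t * u)) = (\<Sum>k. (\<i> * (t * u)) ^ k /\<^sub>R fact k)"
        by (simp add: exp_def)
      also have "(\<lambda>k. (\<i> * (t * u)) ^ k /\<^sub>R fact k) = (\<lambda>k. ?f k u)"
        by (auto simp: scaleR_conv_of_real power_mult_distrib divide_inverse mult_ac)
      finally show "iexp (t * u) = (\<Sum>k. ?f k u)" by simp
    qed
    also have "\<dots> = (\<Sum>k. \<integral>u. ?f k u \<partial>D)"
    proof (rule integral_suminf)
      have "AE u in D. \<forall>k. norm (?f k u) \<le> \<bar>t\<bar> ^ k / fact k"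
        using bound by (simp add: AE_all_countable)
      then show "AE u in D. summable (\<lambda>k. norm (?f k u))"
        by eventually_elim (intro summable_comparison_test[OF _ summ], auto)
      have "(\<integral>u. norm (?f k u) \<partial>D) \<le> \<bar>t\<bar> ^ k / fact k" for k
        using bound[of k] intf[of k] by (intro integral_le_const) auto
      then show "summable (\<lambda>k. \<integral>u. norm (?f k u) \<partial>D)"
        by (intro summable_comparison_test[OF _ summ] exI allI impI) simp
    qed (rule intf)
    also have "\<dots> = (\<Sum>k. (\<i> * t) ^ k / fact k * (\<integral>u. u ^ k \<partial>D))"
      by (simp only: integral_mult_right_zero integral_complex_of_real)
    finally show ?thesis .
  qed
  have "char D1 = char D2"
    by (rule ext) (simp only: char_series[OF D(1) unit(1)] char_series[OF D(2) unit(2)] moments)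
  then show ?thesis
    by (rule Levy_uniqueness[OF D])
qed

text \<open>
  The values of the transform at the integers are the moments of the image measure under
  \<open>y \<mapsto> exp (- y)\<close>, which lives on the unit interval.
\<close>

lemma laplace_transform_determines_measure:
  fixes N1 N2 :: "real measure"
  assumes fin: "finite_measure N1" "finite_measure N2"
    and sets[measurable_cong]: "sets N1 = sets borel" "sets N2 = sets borel"
    and nonneg: "AE y in N1. 0 \<le> y" "AE y in N2. 0 \<le> y"
    and laplace: "\<And>l. 0 \<le> l \<Longrightarrow> (\<integral>y. exp (- l * y) \<partial>N1) = (\<integral>y. exp (- l * y) \<partial>N2)"
  shows "N1 = N2"
proof -
  interpret N1: finite_measure N1 by fact
  interpret N2: finite_measure N2 by fact
  have space: "space N1 = UNIV" "space N2 = UNIV"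
    using sets_eq_imp_space_eq[OF sets(1)] sets_eq_imp_space_eq[OF sets(2)] by auto
  define m where "m = measure N1 UNIV"
  have m1: "emeasure N1 UNIV = m" and m2: "emeasure N2 UNIV = m"
    using laplace[of 0] by (auto simp: m_def space N1.emeasure_eq_measure N2.emeasure_eq_measure)
  show ?thesis
  proof (cases "m = 0")
    case True
    then have "emeasure N1 A = 0" "emeasure N2 A = 0" for A
      using m1 m2 emeasure_mono[of A UNIV N1] emeasure_mono[of A UNIV N2] by (auto simp: sets)
    then show ?thesis by (intro measure_eqI) (auto simp: sets)
  next
    case False
    then have m: "0 < m" by (simp add: m_def zero_less_measure_iff)
    \<comment> \<open>the normalised image under \<open>y \<mapsto> exp (- y)\<close>; the logarithm recovers the original measure\<close>
    define D where "D N = distr (density N (\<lambda>_. ennreal (1 / m))) borel (\<lambda>y. exp (- y))" for N :: "real measure"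
    have D: "real_distribution (D N)" "AE u in D N. \<bar>u\<bar> \<le> 1"
      "(\<integral>u. u ^ k \<partial>D N) = (\<integral>y. exp (- real k * y) \<partial>N) / m"
      "A \<in> sets borel \<Longrightarrow> emeasure N A = ennreal m * emeasure (D N) ((\<lambda>u. - ln u) -` A)"
      if [measurable_cong]: "sets N = sets borel" and "emeasure N UNIV = m" and "AE y in N. 0 \<le> y" for N k A
    proof -
      have sp: "space N = UNIV" using sets_eq_imp_space_eq[OF that(1)] by auto
      interpret prob_space "density N (\<lambda>_. ennreal (1 / m))"
        by standard (use m that in \<open>simp add: emeasure_density_const sp ennreal_mult[symmetric]\<close>)
      have "prob_space (D N)" unfolding D_def by (rule prob_space_distr) simp
      then show "real_distribution (D N)"
        by (simp add: real_distribution_def real_distribution_axioms_def D_def)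
      show "AE u in D N. \<bar>u\<bar> \<le> 1"
        unfolding D_def using that(3) by (subst AE_distr_iff) (auto simp: AE_density)
      show "(\<integral>u. u ^ k \<partial>D N) = (\<integral>y. exp (- real k * y) \<partial>N) / m"
        unfolding D_def using m
        by (subst integral_distr) (auto simp: integral_density exp_of_nat_mult[symmetric])
      show "emeasure N A = ennreal m * emeasure (D N) ((\<lambda>u. - ln u) -` A)" if [measurable]: "A \<in> sets borel"
      proof -
        have "(\<lambda>u::real. - ln u) -` A \<in> sets borel"
          using measurable_sets[of "\<lambda>u::real. - ln u" borel borel A] by simp
        moreover have "(\<lambda>y::real. exp (- y)) -` (\<lambda>u. - ln u) -` A = A" by auto
        ultimately have "emeasure (D N) ((\<lambda>u. - ln u) -` A) = ennreal (1 / m) * emeasure N A"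
          unfolding D_def by (simp add: emeasure_distr emeasure_density_const sp that)
        then show ?thesis using m by (simp add: mult.assoc[symmetric] ennreal_mult[symmetric])
      qed
    qed
    note D1 = D[OF sets(1) m1 nonneg(1)] and D2 = D[OF sets(2) m2 nonneg(2)]
    have "D N1 = D N2"
      using D1(1-3) D2(1-3) laplace
      by (intro moments_determine_distribution) auto
    with D1(4) D2(4) show ?thesis by (intro measure_eqI) (auto simp: sets)
  qed
qed

text \<open>
  The one-dimensional statement turns exponentials into indicators one coordinate at a time.
\<close>

lemma laplace_transform_determines_process_law:
  fixes N1 N2 :: "('i \<Rightarrow> real) measure"
  assumes fin: "finite_measure N1" "finite_measure N2"
    and sets[measurable_cong]: "sets N1 = sets (PiM I (\<lambda>_. borel))" "sets N2 = sets (PiM I (\<lambda>_. borel))"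
    and nonneg: "\<And>i. i \<in> I \<Longrightarrow> AE x in N1. 0 \<le> x i" "\<And>i. i \<in> I \<Longrightarrow> AE x in N2. 0 \<le> x i"
    and laplace: "\<And>J l. finite J \<Longrightarrow> J \<subseteq> I \<Longrightarrow> (\<And>i. 0 \<le> l i) \<Longrightarrow>
      (\<integral>x. exp (- (\<Sum>i\<in>J. l i * x i)) \<partial>N1) = (\<integral>x. exp (- (\<Sum>i\<in>J. l i * x i)) \<partial>N2)"
  shows "N1 = N2"
proof -
  have cyl: "(\<integral>x. (\<Prod>i\<in>K. indicator (A i) (x i)) * exp (- (\<Sum>i\<in>J. l i * x i)) \<partial>N1)
      = (\<integral>x. (\<Prod>i\<in>K. indicator (A i) (x i)) * exp (- (\<Sum>i\<in>J. l i * x i)) \<partial>N2)"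
    if "finite K" "K \<subseteq> I" "finite J" "J \<subseteq> I" "\<And>i. i \<in> K \<Longrightarrow> A i \<in> sets borel" "\<And>i. 0 \<le> l i"
    for K J A and l :: "'i \<Rightarrow> real"
    using that
  proof (induction K arbitrary: J l rule: finite_induct)
    case empty
    then show ?case using laplace by simp
  next
    case (insert k K)
    define w where "w x = (\<Prod>i\<in>K. indicator (A i) (x i)) * exp (- (\<Sum>i\<in>J. l i * x i))" for x :: "'i \<Rightarrow> real"
    define D where "D N = distr (density N (\<lambda>x. ennreal (w x))) borel (\<lambda>x. x k)" for N :: "('i \<Rightarrow> real) measure"
    have D: "finite_measure (D N)" "sets (D N) = sets borel" "AE y in D N. 0 \<le> y"
      "f \<in> borel_measurable borel \<Longrightarrow> (\<integral>y. f y \<partial>D N) = (\<integral>x. w x * f (x k) \<partial>N)"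
      if fin: "finite_measure N" and [measurable_cong]: "sets N = sets (PiM I (\<lambda>_. borel))"
        and nn: "\<And>i. i \<in> I \<Longrightarrow> AE x in N. 0 \<le> x i" for N and f :: "real \<Rightarrow> real"
    proof -
      interpret finite_measure N by fact
      have [measurable]: "(\<lambda>x. x k) \<in> borel_measurable N" "\<And>i. i \<in> K \<Longrightarrow> (\<lambda>x. x i) \<in> borel_measurable N"
         "\<And>i. i \<in> J \<Longrightarrow> (\<lambda>x. x i) \<in> borel_measurable N"
        using insert.prems by (auto simp: measurable_cong_sets[OF that(2) refl] intro!: measurable_component_singleton)
      have [measurable]: "\<And>i. i \<in> K \<Longrightarrow> A i \<in> sets borel" using insert.prems by auto
      have [measurable]: "w \<in> borel_measurable N" unfolding w_def by measurable
      have w0: "0 \<le> w x" for x unfolding w_def by (intro mult_nonneg_nonneg prod_nonneg) auto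
      have "AE x in N. \<forall>i\<in>J. 0 \<le> x i"
        using insert.prems nn by (intro AE_finite_allI) auto
      then have w1: "AE x in N. w x \<le> 1"
      proof eventually_elim
        case (elim x)
        have "(\<Prod>i\<in>K. indicator (A i) (x i)) \<le> (1::real)" by (intro prod_le_1) auto
        moreover have "exp (- (\<Sum>i\<in>J. l i * x i)) \<le> 1"
          using elim insert.prems by (auto intro!: sum_nonneg)
        ultimately show ?case unfolding w_def by (intro mult_le_one) auto
      qed
      have "emeasure (density N (\<lambda>x. ennreal (w x))) (space N) \<le> emeasure N (space N)"
        using nn_integral_mono_AE[of "\<lambda>x. ennreal (w x)" "\<lambda>_. 1" N] w1
        by (simp add: emeasure_density nn_integral_indicator_singleton cong: nn_integral_cong_simp)
      then have "finite_measure (density N (\<lambda>x. ennreal (w x)))"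
        by (intro finite_measureI) (auto simp: top_unique)
      then show "finite_measure (D N)"
        unfolding D_def by (rule finite_measure.finite_measure_distr) simp
      show "sets (D N) = sets borel" by (simp add: D_def)
      show "AE y in D N. 0 \<le> y"
        unfolding D_def using nn[of k] insert.prems by (subst AE_distr_iff) (auto simp: AE_density)
      show "(\<integral>y. f y \<partial>D N) = (\<integral>x. w x * f (x k) \<partial>N)" if [measurable]: "f \<in> borel_measurable borel"
        unfolding D_def using w0 by (subst integral_distr) (auto simp: integral_density)
    qed
    note D1 = D[OF fin(1) sets(1) nonneg(1)] and D2 = D[OF fin(2) sets(2) nonneg(2)]
    have "D N1 = D N2"
    proof (rule laplace_transform_determines_measure[OF D1(1) D2(1) D1(2) D2(2) D1(3) D2(3)])
      fix s :: real assume s: "0 \<le> s"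
      define l' where "l' i = (if i \<in> J then l i else 0) + (if i = k then s else 0)" for i
      have "w x * exp (- s * x k) = (\<Prod>i\<in>K. indicator (A i) (x i)) * exp (- (\<Sum>i\<in>insert k J. l' i * x i))" for x
      proof -
        have "(\<Sum>i\<in>insert k J. l' i * x i)
            = (\<Sum>i\<in>insert k J. if i \<in> J then l i * x i else 0) + (\<Sum>i\<in>insert k J. if i = k then s * x i else 0)"
          unfolding sum.distrib[symmetric] by (intro sum.cong) (auto simp: l'_def algebra_simps)
        also have "\<dots> = (\<Sum>i\<in>J. l i * x i) + s * x k"
          using insert.prems by (auto simp: sum.If_cases insert_absorb Int_insert_left Int_absorb1)
        finally show ?thesis by (simp add: w_def exp_add[symmetric] mult.assoc)
      qed
      moreover have "0 \<le> l' i" for i using insert.prems s by (auto simp: l'_def)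
      ultimately show "(\<integral>y. exp (- s * y) \<partial>D N1) = (\<integral>y. exp (- s * y) \<partial>D N2)"
        using insert.IH[of "insert k J" l'] insert.prems by (simp add: D1(4) D2(4))
    qed
    moreover have [measurable]: "A k \<in> sets borel" using insert.prems by auto
    have "(\<integral>x. w x * indicator (A k) (x k) \<partial>N) = (\<integral>y. indicator (A k) y \<partial>D N)" if "N = N1 \<or> N = N2" for N
      using that D1(4)[of "indicator (A k)"] D2(4)[of "indicator (A k)"] \<open>A k \<in> sets borel\<close>
      by (auto simp del: integral_indicator)
    ultimately show ?case
      using insert.hyps by (simp add: w_def mult_ac)
  qed
  show ?thesis
  proof (rule measure_eqI_PiM_infinite[OF sets _ fin(1)])
    fix A J assume J: "finite J" "J \<subseteq> I" "\<And>i. i \<in> J \<Longrightarrow> A i \<in> sets (borel :: real measure)"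
    let ?E = "prod_emb I (\<lambda>_. borel :: real measure) J (Pi\<^sub>E J A)"
    have E: "measure N ?E = (\<integral>x. (\<Prod>i\<in>J. indicator (A i) (x i)) * exp (- (\<Sum>i\<in>{}. 0 * x i)) \<partial>N)"
      if "sets N = sets (PiM I (\<lambda>_. borel))" for N
    proof -
      have "?E \<in> sets N" unfolding that using J by (intro sets_PiM_I) auto
      moreover have "(\<Prod>i\<in>J. indicator (A i) (x i)) = (indicator ?E x :: real)" if "x \<in> space N" for x
        using J that sets_eq_imp_space_eq[OF \<open>sets N = _\<close>]
        by (auto simp: prod_emb_def indicator_def space_PiM PiE_iff prod_zero_iff)
      ultimately show ?thesis by (simp cong: Bochner_Integration.integral_cong)
    qed
    interpret N1: finite_measure N1 by fact
    interpret N2: finite_measure N2 by fact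
    show "emeasure N1 ?E = emeasure N2 ?E"
      using cyl[of J "{}" A "\<lambda>_. 0"] J
      by (simp add: N1.emeasure_eq_measure N2.emeasure_eq_measure E[OF sets(1)] E[OF sets(2)])
  qed
qed

section \<open>The two transition kernels as Poisson mixtures\<close>

lemma bessel_coeff_summable: "summable (\<lambda>i. (1 / (fact i)\<^sup>2) * w ^ i)" for w :: real
proof (rule summable_comparison_test)
  show "summable (\<lambda>i. \<bar>w\<bar> ^ i / fact i)"
    using summable_exp_generic[of "\<bar>w\<bar>"] by (simp add: divide_inverse mult.commute)
  show "\<exists>N. \<forall>i\<ge>N. norm ((1 / (fact i)\<^sup>2) * w ^ i) \<le> \<bar>w\<bar> ^ i / fact i"
  proof (intro exI allI impI)
    fix i
    have "(fact i :: real) * 1 \<le> fact i * fact i" by (intro mult_left_mono) (auto simp: fact_ge_1)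
    then show "norm ((1 / (fact i)\<^sup>2) * w ^ i) \<le> \<bar>w\<bar> ^ i / fact i"
      by (auto simp: abs_mult power_abs power2_eq_square intro!: divide_left_mono)
  qed
qed

lemma bessel_I0_conv_series: "bessel_I0 z = (\<Sum>i. (1 / (fact i)\<^sup>2) * (z\<^sup>2 / 4) ^ i)"
proof -
  have "z ^ (2 * i) / (2 ^ (2 * i) * (fact i)\<^sup>2) = (1 / (fact i)\<^sup>2) * (z\<^sup>2 / 4) ^ i" for i
    unfolding power_mult by (simp add: power_divide mult.commute)
  then show ?thesis unfolding bessel_I0_def by (simp only:)
qed

lemma diffs_bessel_coeff:
  "diffs (\<lambda>i. 1 / (fact i)\<^sup>2 :: real) = (\<lambda>i. 1 / (fact i * fact (Suc i)))"
proof
  fix i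
  have "real (Suc i) / (real (Suc i) * fact i * (real (Suc i) * fact i)) = 1 / (fact i * (real (Suc i) * fact i))"
    by (simp del: of_nat_Suc)
  then show "diffs (\<lambda>i. 1 / (fact i)\<^sup>2 :: real) i = 1 / (fact i * fact (Suc i))"
    by (simp add: diffs_def power2_eq_square del: of_nat_Suc)
qed

lemma deriv_bessel_I0: "deriv bessel_I0 z = z / 2 * (\<Sum>i. (1 / (fact i * fact (Suc i))) * (z\<^sup>2 / 4) ^ i)"
proof -
  have "((\<lambda>w::real. \<Sum>i. (1 / (fact i)\<^sup>2) * w ^ i) has_field_derivative
      (\<Sum>i. (1 / (fact i * fact (Suc i))) * (z\<^sup>2 / 4) ^ i)) (at (z\<^sup>2 / 4))"
    using termdiffs_strong_converges_everywhere[OF bessel_coeff_summable, of "z\<^sup>2 / 4"]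
    unfolding diffs_bessel_coeff .
  moreover have "((\<lambda>z::real. z\<^sup>2 / 4) has_field_derivative z / 2) (at z)"
    by (auto intro!: derivative_eq_intros)
  ultimately have "(bessel_I0 has_field_derivative
      (\<Sum>i. (1 / (fact i * fact (Suc i))) * (z\<^sup>2 / 4) ^ i) * (z / 2)) (at z)"
    unfolding bessel_I0_conv_series[abs_def] by (rule DERIV_chain2)
  then show ?thesis by (simp add: DERIV_imp_deriv mult.commute)
qed

text \<open>
  The transition law is that of a sum of \<open>N + 1\<close> independent standard exponential variables, where
  \<open>N\<close> is Poisson with mean \<open>h\<close>: the Bessel series is the Poisson mixture of Erlang densities.
\<close>

lemma between_density_sums:
  assumes "0 \<le> h" "0 < y"
  shows "(\<lambda>i. exp (- h) * h ^ i / fact i * erlang_density i 1 y) sums between_density h y"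
proof -
  have "(\<lambda>i. exp (- h - y) * ((1 / (fact i)\<^sup>2) * (h * y) ^ i)) sums
      (exp (- h - y) * (\<Sum>i. (1 / (fact i)\<^sup>2) * (h * y) ^ i))"
    by (intro sums_mult summable_sums bessel_coeff_summable)
  also have "exp (- h - y) * (\<Sum>i. (1 / (fact i)\<^sup>2) * (h * y) ^ i) = between_density h y"
    using assms by (simp add: between_density_def bessel_I0_conv_series power_mult_distrib)
  also have "(\<lambda>i. exp (- h - y) * ((1 / (fact i)\<^sup>2) * (h * y) ^ i)) =
      (\<lambda>i. exp (- h) * h ^ i / fact i * erlang_density i 1 y)"
    using assms by (auto simp: erlang_density_def power2_eq_square exp_diff exp_minus field_simps)
  finally show ?thesis .
qed

text \<open>
  Here the number of exponential variables is \<open>N\<close> itself; the atom of the kernel at \<open>0\<close> is the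
  event \<open>N = 0\<close>.
\<close>

lemma outer_density_sums:
  assumes "0 \<le> h" "0 < y"
  shows "(\<lambda>i. exp (- h) * h ^ Suc i / fact (Suc i) * erlang_density i 1 y) sums outer_density h y"
proof -
  have summ: "summable (\<lambda>i. (1 / (fact i * fact (Suc i))) * w ^ i)" for w :: real
  proof -
    have "summable (\<lambda>i. diffs (\<lambda>i. 1 / (fact i)\<^sup>2 :: real) i * w ^ i)"
      by (rule termdiff_converges_all) (rule bessel_coeff_summable)
    then show ?thesis unfolding diffs_bessel_coeff .
  qed
  have "sqrt (h / y) * (sqrt (h * y)) = h"
    using assms by (simp add: real_sqrt_mult[symmetric])
  then have "exp (- h - y) * h * (\<Sum>i. (1 / (fact i * fact (Suc i))) * (h * y) ^ i) = outer_density h y"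
    using assms by (simp add: outer_density_def deriv_bessel_I0 power_mult_distrib mult.assoc[symmetric])
  moreover have "(\<lambda>i. exp (- h - y) * h * ((1 / (fact i * fact (Suc i))) * (h * y) ^ i)) sums
      (exp (- h - y) * h * (\<Sum>i. (1 / (fact i * fact (Suc i))) * (h * y) ^ i))"
    by (intro sums_mult summable_sums summ)
  moreover have "(\<lambda>i. exp (- h - y) * h * ((1 / (fact i * fact (Suc i))) * (h * y) ^ i)) =
      (\<lambda>i. exp (- h) * h ^ Suc i / fact (Suc i) * erlang_density i 1 y)"
    using assms by (auto simp: erlang_density_def exp_diff exp_minus field_simps)
  ultimately show ?thesis by simp
qed

lemma nn_integral_erlang_mixture:
  assumes p: "\<And>i. 0 \<le> p i" and d: "\<And>y. 0 < y \<Longrightarrow> (\<lambda>i. p i * erlang_density i 1 y) sums d y"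
    and [measurable]: "f \<in> borel_measurable borel" and S: "S = {0<..} \<or> S = {0..}"
  shows "(\<integral>\<^sup>+y. ennreal (d y) * f y * indicator S y \<partial>lborel)
    = (\<Sum>i. ennreal (p i) * (\<integral>\<^sup>+y. ennreal (erlang_density i 1 y) * f y \<partial>lborel))"
proof -
  have "(\<integral>\<^sup>+y. ennreal (d y) * f y * indicator S y \<partial>lborel)
      = (\<integral>\<^sup>+y. (\<Sum>i. ennreal (p i) * (ennreal (erlang_density i 1 y) * f y)) \<partial>lborel)"
    using AE_lborel_singleton[of "0::real"]
  proof (intro nn_integral_cong_AE, eventually_elim)
    case (elim y)
    show ?case
    proof (cases "0 < y")
      case True
      have "ennreal (d y) = (\<Sum>i. ennreal (p i * erlang_density i 1 y))"
        using d[OF True] by (intro suminf_ennreal_eq[symmetric]) (auto simp: p)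
      then show ?thesis using True S
        by (auto simp: ennreal_mult p ennreal_suminf_multc[symmetric] mult.assoc
            simp del: ennreal_suminf_multc)
    next
      case False
      then show ?thesis using elim S by (auto simp: erlang_density_def)
    qed
  qed
  also have "\<dots> = (\<Sum>i. \<integral>\<^sup>+y. ennreal (p i) * (ennreal (erlang_density i 1 y) * f y) \<partial>lborel)"
    by (rule nn_integral_suminf) simp
  finally show ?thesis by (simp add: nn_integral_cmult)
qed

text \<open>
  Exponential tilting of a gamma law is a change of its scale.
\<close>

lemma nn_integral_erlang_exp:
  assumes "0 \<le> l"
  shows "(\<integral>\<^sup>+y. ennreal (erlang_density i 1 y) * ennreal (exp (- l * y)) \<partial>lborel) = ennreal ((1 / (1 + l)) ^ Suc i)"
proof -
  have "ennreal (erlang_density i 1 y) * ennreal (exp (- l * y))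
      = ennreal ((1 / (1 + l)) ^ Suc i) * ennreal (erlang_density i (1 + l) y)" for y
  proof -
    have "erlang_density i 1 y * exp (- l * y) = (1 / (1 + l)) ^ Suc i * erlang_density i (1 + l) y"
    proof (cases "y < 0")
      case False
      have "exp (- y) * exp (- l * y) = exp (- (1 + l) * y)"
        by (simp add: exp_add[symmetric] algebra_simps)
      moreover have "(1 / (1 + l)) ^ Suc i * (1 + l) ^ Suc i = 1"
        using assms by (simp add: power_mult_distrib[symmetric] del: power_Suc)
      ultimately show ?thesis
        using False by (simp add: erlang_density_def mult.assoc[symmetric] del: power_Suc)
    qed (simp add: erlang_density_def)
    then show ?thesis using assms by (simp add: ennreal_mult[symmetric])
  qed
  moreover have "(\<integral>\<^sup>+y. ennreal (erlang_density i (1 + l) y) \<partial>lborel) = 1"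
  proof -
    interpret prob_space "density lborel (erlang_density i (1 + l))"
      using assms by (intro prob_space_erlang_density) simp
    show ?thesis using emeasure_space_1 by (simp add: emeasure_density)
  qed
  ultimately show ?thesis by (simp add: nn_integral_cmult)
qed

lemma exp_minus_times_exp_sums:
  "(\<lambda>i. exp (- h) * h ^ i / fact i * c ^ i) sums exp (- h * (1 - c))" for h c :: real
proof -
  have "(\<lambda>i. exp (- h) * ((h * c) ^ i /\<^sub>R fact i)) sums (exp (- h) * exp (h * c))"
    by (intro sums_mult exp_converges)
  then show ?thesis
    by (simp add: exp_add[symmetric] power_mult_distrib divide_inverse algebra_simps)
qed

lemma exp_weight_nonneg: "0 \<le> h \<Longrightarrow> 0 \<le> exp (- h) * h ^ i / fact i" for h :: real
  by simp

lemma one_over_nonneg: "0 \<le> l \<Longrightarrow> 0 \<le> 1 / (1 + l)" for l :: real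
  by simp

lemma measurable_exp_neg: "(\<lambda>y. ennreal (exp (- l * y))) \<in> borel_measurable borel" for l :: real
  by measurable

lemma nn_integral_between_kernel:
  assumes "0 \<le> h" "f \<in> borel_measurable borel"
  shows "(\<integral>\<^sup>+y. f y \<partial>between_kernel h)
    = (\<Sum>i. ennreal (exp (- h) * h ^ i / fact i) * (\<integral>\<^sup>+y. ennreal (erlang_density i 1 y) * f y \<partial>lborel))"
proof -
  have [measurable]: "f \<in> borel_measurable borel" by fact
  have d: "between_density h \<in> borel_measurable (restrict_space lborel {0<..})"
  proof (rule borel_measurable_LIMSEQ_real)
    fix y :: real assume "y \<in> space (restrict_space lborel {0<..})"
    then show "(\<lambda>n. \<Sum>i<n. exp (- h) * h ^ i / fact i * erlang_density i 1 y) \<longlonglongrightarrow> between_density h y"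
      using between_density_sums[OF assms(1), of y] by (auto simp: sums_def space_restrict_space)
  qed (intro measurable_restrict_space1, measurable)
  have "(\<integral>\<^sup>+y. f y \<partial>between_kernel h) = (\<integral>\<^sup>+y. ennreal (between_density h y) * f y \<partial>restrict_space lborel {0<..})"
    unfolding between_kernel_def using d
    by (subst nn_integral_density) (auto intro!: measurable_restrict_space1)
  also have "\<dots> = (\<integral>\<^sup>+y. ennreal (between_density h y) * f y * indicator {0<..} y \<partial>lborel)"
    by (subst nn_integral_restrict_space) auto
  finally show ?thesis
    using nn_integral_erlang_mixture[OF _ between_density_sums[OF assms(1)] assms(2), of "{0<..}"] assms(1)
    by simp
qed

lemma laplace_between_kernel:
  assumes "0 \<le> h" "0 \<le> l"
  shows "(\<integral>\<^sup>+y. ennreal (exp (- l * y)) \<partial>between_kernel h) = ennreal (1 / (1 + l) * exp (- h * (l / (1 + l))))"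
proof -
  have "1 - 1 / (1 + l) = l / (1 + l)" using assms by (simp add: field_simps)
  moreover have "(\<lambda>i. 1 / (1 + l) * (exp (- h) * h ^ i / fact i * (1 / (1 + l)) ^ i)) sums
      (1 / (1 + l) * exp (- h * (1 - 1 / (1 + l))))"
    by (intro sums_mult exp_minus_times_exp_sums)
  ultimately have "(\<Sum>i. ennreal (exp (- h) * h ^ i / fact i * (1 / (1 + l)) ^ Suc i))
      = ennreal (1 / (1 + l) * exp (- h * (l / (1 + l))))"
    using assms by (intro suminf_ennreal_eq) (auto simp: mult_ac)
  then show ?thesis
    using nn_integral_between_kernel[OF assms(1) measurable_exp_neg, of l]
      exp_weight_nonneg[OF assms(1)] assms(2)
    by (simp only: nn_integral_erlang_exp ennreal_mult zero_le_power one_over_nonneg)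
qed

lemma sets_between_kernel: "sets (between_kernel h) = sets (restrict_space borel {0<..})"
  by (simp add: between_kernel_def sets_restrict_space)

lemma between_kernel_measurable:
  "between_kernel \<in> restrict_space borel {0<..} \<rightarrow>\<^sub>M prob_algebra (restrict_space borel {0<..})"
proof (rule measurable_prob_algebraI)
  fix h :: real assume "h \<in> space (restrict_space borel {0<..})"
  then have "0 \<le> h" by (simp add: space_restrict_space)
  then show "prob_space (between_kernel h)"
    using laplace_between_kernel[of h 0] by (intro prob_spaceI) (simp add: nn_integral_const)
next
  show "between_kernel \<in> restrict_space borel {0<..} \<rightarrow>\<^sub>M subprob_algebra (restrict_space borel {0<..})"
  proof (rule measurable_subprob_algebra)
    fix h :: real assume "h \<in> space (restrict_space borel {0<..})"
    then have "0 \<le> h" by (simp add: space_restrict_space)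
    then have "prob_space (between_kernel h)"
      using laplace_between_kernel[of h 0] by (intro prob_spaceI) (simp add: nn_integral_const)
    then show "subprob_space (between_kernel h)" by (rule prob_space_imp_subprob_space)
    show "sets (between_kernel h) = sets (restrict_space borel {0<..})" by (rule sets_between_kernel)
  next
    fix B assume B: "B \<in> sets (restrict_space (borel :: real measure) {0<..})"
    then have [measurable]: "B \<in> sets borel" by (auto simp: sets_restrict_space)
    have eq: "emeasure (between_kernel h) B = (\<Sum>i. ennreal (exp (- h) * h ^ i / fact i)
        * (\<integral>\<^sup>+y. ennreal (erlang_density i 1 y) * indicator B y \<partial>lborel))"
      if "h \<in> space (restrict_space borel {0<..})" for h
      using that nn_integral_between_kernel[of h "indicator B"] B
      by (simp add: space_restrict_space sets_between_kernel)
    have "(\<lambda>h. \<Sum>i. ennreal (exp (- h) * h ^ i / fact i)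
        * (\<integral>\<^sup>+y. ennreal (erlang_density i 1 y) * indicator B y \<partial>lborel)) \<in> borel_measurable (restrict_space borel {0<..})"
      by (intro measurable_restrict_space1) measurable
    then show "(\<lambda>h. emeasure (between_kernel h) B) \<in> borel_measurable (restrict_space borel {0<..})"
      by (subst measurable_cong[OF eq]) auto
  qed
qed

lemma sets_outer_kernel: "sets (outer_kernel h) = sets (restrict_space borel {0..})"
  and space_outer_kernel: "space (outer_kernel h) = {0..}"
proof -
  have "sets (restrict_space borel {0..}) \<subseteq> Pow {0::real..}"
    using sets.space_closed[of "restrict_space borel {0::real..}"] by (simp add: space_restrict_space)
  then show "sets (outer_kernel h) = sets (restrict_space borel {0..})" "space (outer_kernel h) = {0..}"
    using sets.sigma_sets_eq[of "restrict_space borel {0::real..}"]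
    unfolding outer_kernel_def by (simp_all add: sets_measure_of space_measure_of space_restrict_space)
qed

lemma nn_integral_sum_measure:
  assumes [measurable_cong]: "sets M1 = sets M" "sets M2 = sets M"
    and M: "\<And>A. A \<in> sets M \<Longrightarrow> emeasure M A = c * emeasure M1 A + emeasure M2 A"
    and f: "f \<in> borel_measurable M"
  shows "(\<integral>\<^sup>+y. f y \<partial>M) = c * (\<integral>\<^sup>+y. f y \<partial>M1) + (\<integral>\<^sup>+y. f y \<partial>M2)"
  using f
proof (induction rule: borel_measurable_induct)
  case (cong f g)
  moreover have "space M1 = space M" "space M2 = space M"
    using assms(1,2) by (auto dest: sets_eq_imp_space_eq)
  ultimately show ?case by (simp cong: nn_integral_cong_simp)
next
  case (set A)
  then show ?case using assms(1,2) by (simp add: M)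
next
  case (mult u c)
  then show ?case by (simp add: nn_integral_cmult distrib_left mult.left_commute)
next
  case (add u v)
  then show ?case by (simp add: nn_integral_add distrib_left add_ac)
next
  case (seq U)
  have mono: "(\<integral>\<^sup>+y. (SUP i. U i) y \<partial>N) = (SUP i. \<integral>\<^sup>+y. U i y \<partial>N)" if "sets N = sets M" for N
    using nn_integral_monotone_convergence_SUP[OF \<open>incseq U\<close>, of N] seq.hyps
    by (simp add: measurable_cong_sets[OF that refl] image_image)
  have inc: "incseq (\<lambda>i. \<integral>\<^sup>+y. U i y \<partial>N)" for N
    using \<open>incseq U\<close> by (auto simp: incseq_def le_fun_def intro!: nn_integral_mono)
  have "(\<integral>\<^sup>+y. (SUP i. U i) y \<partial>M) = (SUP i. c * (\<integral>\<^sup>+y. U i y \<partial>M1) + (\<integral>\<^sup>+y. U i y \<partial>M2))"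
    unfolding mono[OF refl] seq.IH ..
  also have "\<dots> = (SUP i. c * (\<integral>\<^sup>+y. U i y \<partial>M1)) + (SUP i. \<integral>\<^sup>+y. U i y \<partial>M2)"
    using inc by (intro ennreal_SUP_add) (auto simp: incseq_def intro!: mult_left_mono)
  finally show ?case
    unfolding mono[OF assms(1)] mono[OF assms(2)] by (simp add: SUP_mult_left_ennreal)
qed

text \<open>
  The set function defining the kernel is the sum of an atom at \<open>0\<close> and of a measure with a
  density, hence countably additive.
\<close>

lemma nn_integral_outer_kernel:
  assumes "0 \<le> h" and f[measurable]: "f \<in> borel_measurable borel"
  shows "(\<integral>\<^sup>+y. f y \<partial>outer_kernel h) = ennreal (exp (- h)) * f 0
    + (\<Sum>i. ennreal (exp (- h) * h ^ Suc i / fact (Suc i)) * (\<integral>\<^sup>+y. ennreal (erlang_density i 1 y) * f y \<partial>lborel))"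
proof -
  let ?R = "restrict_space borel {0::real..}"
  define N where "N = density lborel (\<lambda>y. ennreal (outer_density h y * indicator {0<..} y))"
  have d [measurable]: "(\<lambda>y. outer_density h y * indicator {0<..} y) \<in> borel_measurable borel"
  proof (rule borel_measurable_LIMSEQ_real)
    fix y :: real
    show "(\<lambda>n. (\<Sum>i<n. exp (- h) * h ^ Suc i / fact (Suc i) * erlang_density i 1 y) * indicator {0<..} y)
        \<longlonglongrightarrow> outer_density h y * indicator {0<..} y"
    proof (cases "0 < y")
      case True
      then show ?thesis using outer_density_sums[OF assms(1) True] unfolding sums_def by simp
    next
      case False
      then show ?thesis by (simp add: indicator_def)
    qed
  next
    show "(\<lambda>y. (\<Sum>i<n. exp (- h) * h ^ Suc i / fact (Suc i) * erlang_density i 1 y) * indicator {0<..} y)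
        \<in> borel_measurable borel" for n :: nat
      by (intro borel_measurable_times borel_measurable_sum borel_measurable_const
          borel_measurable_erlang_density borel_measurable_indicator) simp
  qed
  let ?\<mu> = "\<lambda>B. ennreal (exp (- h)) * indicator B 0 + (\<integral>\<^sup>+y. ennreal (outer_density h y) * indicator B y \<partial>lborel)"
  have mu: "?\<mu> A = ennreal (exp (- h)) * emeasure (return borel 0) A + emeasure N A" if "A \<in> sets ?R" for A
  proof -
    have [measurable]: "A \<in> sets borel" and A: "A \<subseteq> {0..}" using that by (auto simp: sets_restrict_space)
    have "(\<integral>\<^sup>+y. ennreal (outer_density h y) * indicator A y \<partial>lborel) = emeasure N A"
    proof -
      have "emeasure N A = (\<integral>\<^sup>+y. ennreal (outer_density h y * indicator {0<..} y) * indicator A y \<partial>lborel)"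
        unfolding N_def by (rule emeasure_density) simp_all
      also have "\<dots> = (\<integral>\<^sup>+y. ennreal (outer_density h y) * indicator A y \<partial>lborel)"
        using A by (intro nn_integral_cong_AE, intro eventually_mono[OF AE_lborel_singleton[of "0::real"]])
          (auto simp: indicator_def)
      finally show ?thesis by simp
    qed
    then show ?thesis by simp
  qed
  have "countably_additive (sets ?R) ?\<mu>"
  proof (rule countably_additiveI)
    fix A :: "nat \<Rightarrow> real set"
    assume A: "range A \<subseteq> sets ?R" "disjoint_family A" "(\<Union>i. A i) \<in> sets ?R"
    have A': "range A \<subseteq> sets borel" using A(1) by (auto simp: sets_restrict_space)
    have "(\<Sum>i. ?\<mu> (A i)) = (\<Sum>i. ennreal (exp (- h)) * emeasure (return borel 0) (A i) + emeasure N (A i))"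
      using A(1) by (intro suminf_cong mu) auto
    also have "\<dots> = (\<Sum>i. ennreal (exp (- h)) * emeasure (return borel 0) (A i)) + (\<Sum>i. emeasure N (A i))"
      by (intro suminf_add[symmetric] summableI)
    also have "\<dots> = ennreal (exp (- h)) * emeasure (return borel 0) (\<Union>i. A i) + emeasure N (\<Union>i. A i)"
    proof -
      have "(\<Sum>i. emeasure (return borel 0) (A i)) = emeasure (return borel 0) (\<Union>i. A i)"
        using A' A(2) by (intro suminf_emeasure) simp_all
      moreover have "(\<Sum>i. emeasure N (A i)) = emeasure N (\<Union>i. A i)"
        using A' A(2) by (intro suminf_emeasure) (simp_all add: N_def)
      ultimately show ?thesis by (simp only: ennreal_suminf_cmult)
    qed
    also have "\<dots> = ?\<mu> (\<Union>i. A i)" by (rule mu[OF A(3), symmetric])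
    finally show "(\<Sum>i. ?\<mu> (A i)) = ?\<mu> (\<Union>i. A i)" .
  qed
  moreover have "sets ?R \<subseteq> Pow {0..}" "sigma_algebra {0..} (sets ?R)"
    using sets.space_closed[of ?R] sets.sigma_algebra_axioms[of ?R] by (simp_all add: space_restrict_space)
  moreover have "positive (sets ?R) ?\<mu>" by (simp add: positive_def)
  ultimately have em: "emeasure (outer_kernel h) B = ?\<mu> B" if "B \<in> sets ?R" for B
    unfolding outer_kernel_def using that by (intro emeasure_measure_of_sigma)
  have id: "(\<lambda>y. y) \<in> outer_kernel h \<rightarrow>\<^sub>M borel"
    by (simp add: measurable_cong_sets[OF sets_outer_kernel refl] measurable_restrict_space1)
  let ?D = "distr (outer_kernel h) borel (\<lambda>y. y)"
  have D: "emeasure ?D A = ennreal (exp (- h)) * emeasure (return borel 0) A + emeasure N A" if "A \<in> sets ?D" for A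
  proof -
    have [measurable]: "A \<in> sets borel" using that by simp
    have A: "A \<inter> {0..} \<in> sets ?R" by (auto simp: sets_restrict_space)
    have ind: "indicator (A \<inter> {0..}) (0::real) = (indicator A 0 :: ennreal)" by (simp add: indicator_def)
    have "emeasure N (A \<inter> {0..}) = emeasure N A"
      by (simp add: N_def emeasure_density) (intro nn_integral_cong, auto simp: indicator_def)
    moreover have "emeasure ?D A = emeasure (outer_kernel h) (A \<inter> {0..})"
      using id by (simp add: emeasure_distr space_outer_kernel)
    ultimately show ?thesis
      unfolding em[OF A] mu[OF A] by (simp add: ind)
  qed
  have "(\<integral>\<^sup>+y. f y \<partial>outer_kernel h) = (\<integral>\<^sup>+y. f y \<partial>?D)"
    using f id by (simp add: nn_integral_distr)
  also have "\<dots> = ennreal (exp (- h)) * (\<integral>\<^sup>+y. f y \<partial>return borel 0) + (\<integral>\<^sup>+y. f y \<partial>N)"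
    by (rule nn_integral_sum_measure[OF _ _ D]) (simp_all add: N_def)
  also have "(\<integral>\<^sup>+y. f y \<partial>N) = (\<integral>\<^sup>+y. ennreal (outer_density h y) * f y * indicator {0<..} y \<partial>lborel)"
  proof -
    have "(\<integral>\<^sup>+y. f y \<partial>N) = (\<integral>\<^sup>+y. ennreal (outer_density h y * indicator {0<..} y) * f y \<partial>lborel)"
      unfolding N_def by (rule nn_integral_density) simp_all
    also have "\<dots> = (\<integral>\<^sup>+y. ennreal (outer_density h y) * f y * indicator {0<..} y \<partial>lborel)"
      by (intro nn_integral_cong) (auto simp: indicator_def)
    finally show ?thesis .
  qed
  also have "\<dots> = (\<Sum>i. ennreal (exp (- h) * h ^ Suc i / fact (Suc i)) * (\<integral>\<^sup>+y. ennreal (erlang_density i 1 y) * f y \<partial>lborel))"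
    by (rule nn_integral_erlang_mixture[OF exp_weight_nonneg[OF assms(1)] outer_density_sums[OF assms(1)] f]) simp_all
  finally show ?thesis by (simp add: nn_integral_return del: power_Suc fact_Suc)
qed

text \<open>
  Each of the Poisson(\<open>h\<close>) many exponential variables contributes a factor \<open>1 / (1 + l)\<close>.
\<close>

lemma laplace_outer_kernel:
  assumes "0 \<le> h" "0 \<le> l"
  shows "(\<integral>\<^sup>+y. ennreal (exp (- l * y)) \<partial>outer_kernel h) = ennreal (exp (- h * (l / (1 + l))))"
proof -
  have eq: "1 - 1 / (1 + l) = l / (1 + l)" using assms by (simp add: field_simps)
  let ?t = "\<lambda>i. exp (- h) * h ^ i / fact i * (1 / (1 + l)) ^ i"
  have "(\<Sum>i. ennreal (?t i)) = ennreal (exp (- h * (l / (1 + l))))"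
    using exp_minus_times_exp_sums[of h "1 / (1 + l)"] assms unfolding eq
    by (intro suminf_ennreal_eq) auto
  then have "ennreal (exp (- h * (l / (1 + l)))) = ennreal (?t 0) + (\<Sum>i. ennreal (?t (Suc i)))"
    using suminf_offset[of "\<lambda>i. ennreal (?t i)" 1] by (simp del: power_Suc fact_Suc add: add.commute)
  then show ?thesis
    using nn_integral_outer_kernel[OF assms(1) measurable_exp_neg, of l]
      exp_weight_nonneg[OF assms(1)] assms(2)
    by (simp only: nn_integral_erlang_exp ennreal_mult zero_le_power one_over_nonneg)
      (simp add: mult_zero_right)
qed

lemma outer_kernel_measurable:
  "outer_kernel \<in> restrict_space borel {0..} \<rightarrow>\<^sub>M prob_algebra (restrict_space borel {0..})"
proof -
  let ?R = "restrict_space borel {0::real..}"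
  have prob: "prob_space (outer_kernel h)" if "h \<in> space ?R" for h
    using laplace_outer_kernel[of h 0] that
    by (intro prob_spaceI) (simp add: nn_integral_const space_restrict_space)
  show ?thesis
  proof (rule measurable_prob_algebraI[OF prob measurable_subprob_algebra[OF prob_space_imp_subprob_space[OF prob]]])
    fix B assume B: "B \<in> sets ?R"
    then have [measurable]: "B \<in> sets borel" by (auto simp: sets_restrict_space)
    have eq: "emeasure (outer_kernel h) B = ennreal (exp (- h)) * indicator B 0 +
        (\<Sum>i. ennreal (exp (- h) * h ^ Suc i / fact (Suc i)) * (\<integral>\<^sup>+y. ennreal (erlang_density i 1 y) * indicator B y \<partial>lborel))"
      if "h \<in> space ?R" for h
      using that nn_integral_outer_kernel[of h "indicator B"] B
      by (simp add: space_restrict_space sets_outer_kernel)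
    have "(\<lambda>h. ennreal (exp (- h)) * indicator B 0 + (\<Sum>i. ennreal (exp (- h) * h ^ Suc i / fact (Suc i))
        * (\<integral>\<^sup>+y. ennreal (erlang_density i 1 y) * indicator B y \<partial>lborel))) \<in> borel_measurable ?R"
      by (intro measurable_restrict_space1) measurable
    then show "(\<lambda>h. emeasure (outer_kernel h) B) \<in> borel_measurable ?R"
      by (subst measurable_cong[OF eq]) auto
  qed (auto simp: sets_outer_kernel)
qed

section \<open>Markov chains and independence from Laplace transforms\<close>

text \<open>
  The map through which a rate at the next site acts on the present one. It appears in the Laplace
  transforms of both kernels and in the recursion for the harmonic profile of the walk.
\<close>

definition fold_rate :: "real \<Rightarrow> real" where
  "fold_rate s = s / (1 + s)"

lemma fold_rate_0[simp]: "fold_rate 0 = 0"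
  by (simp add: fold_rate_def)

lemma fold_rate_bounds: "0 \<le> s \<Longrightarrow> 0 \<le> fold_rate s" "0 \<le> s \<Longrightarrow> fold_rate s < 1"
  by (auto simp: fold_rate_def)

lemma one_minus_fold_rate: "0 \<le> s \<Longrightarrow> 1 - fold_rate s = 1 / (1 + s)"
  by (simp add: fold_rate_def field_simps)

lemma sample_path_measurable:
  "(\<And>i. i \<in> I \<Longrightarrow> Y i \<in> borel_measurable M) \<Longrightarrow> sample_path I Y \<in> M \<rightarrow>\<^sub>M path_space I"
  unfolding sample_path_def by (intro measurable_restrict) auto

context prob_space
begin

text \<open>
  Weighted laws of a process are compared through their Laplace functionals. The weights carry the
  information on other processes, which is how joint laws are treated one process at a time.
\<close>

lemma sample_path_laplace_unique:
  assumes Y: "\<And>i. i \<in> I \<Longrightarrow> Y i \<in> borel_measurable M" "\<And>i \<omega>. 0 \<le> Y i \<omega>"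
    and v: "v \<in> borel_measurable M" "\<And>\<omega>. 0 \<le> v \<omega>" "\<And>\<omega>. v \<omega> \<le> c"
    and w: "w \<in> borel_measurable M" "\<And>\<omega>. 0 \<le> w \<omega>" "\<And>\<omega>. w \<omega> \<le> d"
    and laplace: "\<And>J q. finite J \<Longrightarrow> J \<subseteq> I \<Longrightarrow> (\<And>i. 0 \<le> q i) \<Longrightarrow>
      (\<integral>\<omega>. v \<omega> * exp (- (\<Sum>i\<in>J. q i * Y i \<omega>)) \<partial>M) = (\<integral>\<omega>. w \<omega> * exp (- (\<Sum>i\<in>J. q i * Y i \<omega>)) \<partial>M)"
    and C: "C \<in> sets (path_space I)"
  shows "(\<integral>\<omega>. v \<omega> * indicator C (sample_path I Y \<omega>) \<partial>M) = (\<integral>\<omega>. w \<omega> * indicator C (sample_path I Y \<omega>) \<partial>M)"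
proof -
  have path[measurable]: "sample_path I Y \<in> M \<rightarrow>\<^sub>M path_space I"
    using Y(1) by (rule sample_path_measurable)
  define N where "N v = distr (density M (\<lambda>\<omega>. ennreal (v \<omega>))) (path_space I) (sample_path I Y)" for v :: "'a \<Rightarrow> real"
  have int: "(\<integral>x. f x \<partial>N v) = (\<integral>\<omega>. v \<omega> * f (sample_path I Y \<omega>) \<partial>M)"
    if [measurable]: "v \<in> borel_measurable M" and "\<And>\<omega>. 0 \<le> v \<omega>" and [measurable]: "f \<in> borel_measurable (path_space I)"
    for v and f :: "_ \<Rightarrow> real"
    unfolding N_def using that(2) by (subst integral_distr) (auto simp: integral_density)
  have fin: "finite_measure (N v)" if "v \<in> borel_measurable M" "\<And>\<omega>. v \<omega> \<le> c" for v c
  proof -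
    have "emeasure (density M (\<lambda>\<omega>. ennreal (v \<omega>))) (space M) \<le> (\<integral>\<^sup>+\<omega>. ennreal c \<partial>M)"
    proof -
      have "emeasure (density M (\<lambda>\<omega>. ennreal (v \<omega>))) (space M) = (\<integral>\<^sup>+\<omega>. ennreal (v \<omega>) * indicator (space M) \<omega> \<partial>M)"
        using that(1) by (intro emeasure_density) auto
      also have "\<dots> \<le> (\<integral>\<^sup>+\<omega>. ennreal c \<partial>M)"
        using that(2) by (intro nn_integral_mono) (simp add: ennreal_leI)
      finally show ?thesis .
    qed
    then have "finite_measure (density M (\<lambda>\<omega>. ennreal (v \<omega>)))"
      by (intro finite_measureI) (auto simp: emeasure_space_1 top_unique)
    then show ?thesis unfolding N_def by (rule finite_measure.finite_measure_distr) simp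
  qed
  have nonneg: "AE x in N v. 0 \<le> x i" if "i \<in> I" and [measurable]: "v \<in> borel_measurable M" for v i
  proof -
    have [measurable]: "(\<lambda>x. x i) \<in> borel_measurable (path_space I)" using that by simp
    show ?thesis
      unfolding N_def using Y(2) that(1) by (subst AE_distr_iff) (auto simp: sample_path_def)
  qed
  have "N v = N w"
  proof (rule laplace_transform_determines_process_law[OF fin[OF v(1,3)] fin[OF w(1,3)]])
    show "sets (N v) = sets (path_space I)" "sets (N w) = sets (path_space I)" by (simp_all add: N_def)
    fix J and q :: "nat \<Rightarrow> real" assume J: "finite J" "J \<subseteq> I" "\<And>i. 0 \<le> q i"
    have [measurable]: "(\<lambda>x. exp (- (\<Sum>i\<in>J. q i * x i))) \<in> borel_measurable (path_space I)"
    proof -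
      have [measurable]: "i \<in> J \<Longrightarrow> (\<lambda>x. x i) \<in> borel_measurable (path_space I)" for i
        using J by (intro measurable_component_singleton) auto
      show ?thesis by measurable
    qed
    have eq: "exp (- (\<Sum>i\<in>J. q i * sample_path I Y \<omega> i)) = exp (- (\<Sum>i\<in>J. q i * Y i \<omega>))" for \<omega>
      using J by (auto simp: sample_path_def subset_eq intro!: sum.cong)
    show "(\<integral>x. exp (- (\<Sum>i\<in>J. q i * x i)) \<partial>N v) = (\<integral>x. exp (- (\<Sum>i\<in>J. q i * x i)) \<partial>N w)"
      using laplace[OF J] by (simp add: int[OF v(1,2)] int[OF w(1,2)] eq)
  qed (use nonneg v(1) w(1) in auto)
  have "(\<integral>x. indicator C x \<partial>N v) = (\<integral>\<omega>. v \<omega> * indicator C (sample_path I Y \<omega>) \<partial>M)"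
    using C by (intro int v) simp
  moreover have "(\<integral>x. indicator C x \<partial>N w) = (\<integral>\<omega>. w \<omega> * indicator C (sample_path I Y \<omega>) \<partial>M)"
    using C by (intro int w) simp
  ultimately show ?thesis using \<open>N v = N w\<close> by simp
qed

text \<open>
  Two applications of uniqueness: first for the path up to time \<open>n\<close>, with the exponential of the next value
  as the weight, then for the next value, with the event \<open>C\<close> of the past as the weight. The variable
  \<open>Y'\<close> is a version of \<open>Y n\<close> that takes values in \<open>S\<close> everywhere, so that the kernel can be
  evaluated at it.
\<close>

lemma transition_from_laplace:
  fixes Y :: "nat \<Rightarrow> 'a \<Rightarrow> real" and K :: "real \<Rightarrow> real measure" and \<kappa> :: "real \<Rightarrow> real"
  assumes Y: "\<And>i. Y i \<in> borel_measurable M" "\<And>i \<omega>. 0 \<le> Y i \<omega>"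
    and S: "S \<in> sets borel" "S \<subseteq> {0..}"
    and K: "K \<in> restrict_space borel S \<rightarrow>\<^sub>M prob_algebra (restrict_space borel S)"
    and \<kappa>: "\<And>l. 0 \<le> l \<Longrightarrow> 0 \<le> \<kappa> l"
    and K_laplace: "\<And>y l. y \<in> S \<Longrightarrow> 0 \<le> l \<Longrightarrow>
      (\<integral>\<^sup>+z. ennreal (exp (- l * z)) \<partial>K y) = ennreal (\<kappa> l * exp (- y * fold_rate l))"
    and step: "\<And>q l. (\<And>i. 0 \<le> q i) \<Longrightarrow> 0 \<le> l \<Longrightarrow>
      (\<integral>\<omega>. exp (- (\<Sum>i\<le>n. q i * Y i \<omega>)) * exp (- l * Y (Suc n) \<omega>) \<partial>M)
      = (\<integral>\<omega>. exp (- (\<Sum>i\<le>n. q i * Y i \<omega>)) * (\<kappa> l * exp (- Y n \<omega> * fold_rate l)) \<partial>M)"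
    and Y': "Y' \<in> M \<rightarrow>\<^sub>M restrict_space borel S" "AE \<omega> in M. Y' \<omega> = Y n \<omega>"
    and C: "C \<in> sets (path_space {..n})" and B: "B \<in> sets borel"
  shows "(\<integral>\<^sup>+\<omega>. indicator C (sample_path {..n} Y \<omega>) * indicator B (Y (Suc n) \<omega>) \<partial>M)
    = (\<integral>\<^sup>+\<omega>. indicator C (sample_path {..n} Y \<omega>) * emeasure (K (Y' \<omega>)) (B \<inter> S) \<partial>M)"
proof -
  let ?R = "restrict_space borel S" and ?p = "sample_path {..n} Y"
  note [measurable] = Y(1) C B
  have path[measurable]: "?p \<in> M \<rightarrow>\<^sub>M path_space {..n}" by (rule sample_path_measurable) simp
  have KY: "(\<lambda>\<omega>. K (Y' \<omega>)) \<in> M \<rightarrow>\<^sub>M subprob_algebra ?R"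
    using measurable_compose[OF Y'(1) measurable_prob_algebraD[OF K]] .
  have Y'S: "Y' \<omega> \<in> S" if "\<omega> \<in> space M" for \<omega>
    using measurable_space[OF Y'(1) that] by (simp add: space_restrict_space)
  have [measurable]: "Y' \<in> borel_measurable M"
    using measurable_compose[OF Y'(1) measurable_restrict_space1[OF measurable_ident]] by simp
  have stepC: "(\<integral>\<omega>. exp (- l * Y (Suc n) \<omega>) * indicator C (?p \<omega>) \<partial>M)
      = (\<integral>\<omega>. \<kappa> l * exp (- Y n \<omega> * fold_rate l) * indicator C (?p \<omega>) \<partial>M)" if l: "0 \<le> l" for l
  proof (rule sample_path_laplace_unique[OF _ _ _ _ _ _ _ _ _ C])
    show "exp (- l * Y (Suc n) \<omega>) \<le> 1" for \<omega> using l Y(2) by simp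
    show "\<kappa> l * exp (- Y n \<omega> * fold_rate l) \<le> \<kappa> l" for \<omega>
      using \<kappa>[OF l] Y(2)[of n \<omega>] fold_rate_bounds(1)[OF l] by (intro mult_left_le) auto
    show "0 \<le> \<kappa> l * exp (- Y n \<omega> * fold_rate l)" for \<omega> using \<kappa>[OF l] by simp
    fix J and q :: "nat \<Rightarrow> real" assume J: "finite J" "J \<subseteq> {..n}" "\<And>i. 0 \<le> q i"
    define q' where "q' i = (if i \<in> J then q i else 0)" for i
    have "(\<Sum>i\<le>n. q' i * Y i \<omega>) = (\<Sum>i\<in>J. q i * Y i \<omega>)" for \<omega>
      using J by (intro sum.mono_neutral_cong_right) (auto simp: q'_def)
    then show "(\<integral>\<omega>. exp (- l * Y (Suc n) \<omega>) * exp (- (\<Sum>i\<in>J. q i * Y i \<omega>)) \<partial>M)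
        = (\<integral>\<omega>. \<kappa> l * exp (- Y n \<omega> * fold_rate l) * exp (- (\<Sum>i\<in>J. q i * Y i \<omega>)) \<partial>M)"
      using step[of q' l] J(3) l by (simp add: q'_def mult.commute)
  qed (use Y in auto)
  define D where "D = density M (\<lambda>\<omega>. indicator C (?p \<omega>))"
  have setsD[measurable_cong]: "sets D = sets M" by (simp add: D_def)
  have KD: "(\<lambda>\<omega>. K (Y' \<omega>)) \<in> D \<rightarrow>\<^sub>M subprob_algebra ?R"
    using KY by (simp add: D_def)
  have spD: "space D \<noteq> {}" using not_empty by (simp add: D_def)
  define N1 where "N1 = distr D borel (Y (Suc n))"
  define N2 where "N2 = distr (D \<bind> (\<lambda>\<omega>. K (Y' \<omega>))) borel (\<lambda>z. z)"
  have sets_DK: "sets (D \<bind> (\<lambda>\<omega>. K (Y' \<omega>))) = sets ?R"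
    by (rule sets_bind[OF _ spD]) (use KD in \<open>auto dest!: measurable_space simp: space_subprob_algebra\<close>)
  have id[measurable]: "(\<lambda>z. z) \<in> (D \<bind> (\<lambda>\<omega>. K (Y' \<omega>))) \<rightarrow>\<^sub>M borel"
    by (simp add: measurable_cong_sets[OF sets_DK refl] measurable_restrict_space1)
  have int1: "(\<integral>\<^sup>+z. f z \<partial>N1) = (\<integral>\<^sup>+\<omega>. indicator C (?p \<omega>) * f (Y (Suc n) \<omega>) \<partial>M)"
    if [measurable]: "f \<in> borel_measurable borel" for f
    unfolding N1_def by (simp add: nn_integral_distr D_def nn_integral_density)
  have int2: "(\<integral>\<^sup>+z. f z \<partial>N2) = (\<integral>\<^sup>+\<omega>. indicator C (?p \<omega>) * (\<integral>\<^sup>+z. f z \<partial>K (Y' \<omega>)) \<partial>M)"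
    if [measurable]: "f \<in> borel_measurable borel" for f
  proof -
    have fR: "f \<in> borel_measurable ?R" by (rule measurable_restrict_space1) simp
    have m: "(\<lambda>\<omega>. \<integral>\<^sup>+z. f z \<partial>K (Y' \<omega>)) \<in> borel_measurable M"
      by (rule measurable_compose[OF KY nn_integral_measurable_subprob_algebra[OF fR]])
    have "(\<integral>\<^sup>+z. f z \<partial>N2) = (\<integral>\<^sup>+z. f z \<partial>(D \<bind> (\<lambda>\<omega>. K (Y' \<omega>))))"
      unfolding N2_def by (rule nn_integral_distr[OF id]) simp
    also have "\<dots> = (\<integral>\<^sup>+\<omega>. (\<integral>\<^sup>+z. f z \<partial>K (Y' \<omega>)) \<partial>D)"
      by (rule nn_integral_bind[OF fR KD])
    also have "\<dots> = (\<integral>\<^sup>+\<omega>. indicator C (?p \<omega>) * (\<integral>\<^sup>+z. f z \<partial>K (Y' \<omega>)) \<partial>M)"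
      unfolding D_def using m by (intro nn_integral_density) simp_all
    finally show ?thesis .
  qed
  have lap1: "(\<integral>\<^sup>+z. ennreal (exp (- l * z)) \<partial>N1) = ennreal (\<integral>\<omega>. exp (- l * Y (Suc n) \<omega>) * indicator C (?p \<omega>) \<partial>M)"
    if l: "0 \<le> l" for l
  proof -
    have "(\<integral>\<^sup>+z. ennreal (exp (- l * z)) \<partial>N1) = (\<integral>\<^sup>+\<omega>. ennreal (exp (- l * Y (Suc n) \<omega>) * indicator C (?p \<omega>)) \<partial>M)"
      by (subst int1) (auto intro!: nn_integral_cong simp: indicator_def)
    also have "\<dots> = ennreal (\<integral>\<omega>. exp (- l * Y (Suc n) \<omega>) * indicator C (?p \<omega>) \<partial>M)"
      using l Y(2) by (intro nn_integral_eq_integral integrable_const_bound[where B=1]) (auto simp: indicator_def)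
    finally show ?thesis .
  qed
  have lap2: "(\<integral>\<^sup>+z. ennreal (exp (- l * z)) \<partial>N2) = ennreal (\<integral>\<omega>. \<kappa> l * exp (- Y n \<omega> * fold_rate l) * indicator C (?p \<omega>) \<partial>M)"
    if l: "0 \<le> l" for l
  proof -
    have "(\<integral>\<^sup>+z. ennreal (exp (- l * z)) \<partial>N2)
        = (\<integral>\<^sup>+\<omega>. indicator C (?p \<omega>) * (\<integral>\<^sup>+z. ennreal (exp (- l * z)) \<partial>K (Y' \<omega>)) \<partial>M)"
      by (rule int2) measurable
    also have "\<dots> = (\<integral>\<^sup>+\<omega>. ennreal (\<kappa> l * exp (- Y n \<omega> * fold_rate l) * indicator C (?p \<omega>)) \<partial>M)"
    proof (rule nn_integral_cong_AE)
      show "AE \<omega> in M. indicator C (?p \<omega>) * (\<integral>\<^sup>+z. ennreal (exp (- l * z)) \<partial>K (Y' \<omega>))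
          = ennreal (\<kappa> l * exp (- Y n \<omega> * fold_rate l) * indicator C (?p \<omega>))"
        using Y'(2) AE_space
      proof eventually_elim
        case (elim \<omega>)
        then show ?case using K_laplace[OF Y'S l, of \<omega>] by (simp add: indicator_def)
      qed
    qed
    also have "\<dots> = ennreal (\<integral>\<omega>. \<kappa> l * exp (- Y n \<omega> * fold_rate l) * indicator C (?p \<omega>) \<partial>M)"
    proof (rule nn_integral_eq_integral[OF integrable_const_bound[where B="\<kappa> l"]])
      have "\<kappa> l * exp (- Y n \<omega> * fold_rate l) \<le> \<kappa> l" for \<omega>
        using \<kappa>[OF l] Y(2)[of n \<omega>] fold_rate_bounds(1)[OF l] by (intro mult_left_le) auto
      then show "AE \<omega> in M. norm (\<kappa> l * exp (- Y n \<omega> * fold_rate l) * indicator C (?p \<omega>)) \<le> \<kappa> l"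
        using \<kappa>[OF l] by (intro AE_I2) (simp add: indicator_def)
    qed (use \<kappa>[OF l] in auto)
    finally show ?thesis .
  qed
  have lapint: "(\<integral>z. exp (- l * z) \<partial>N) = enn2real (\<integral>\<^sup>+z. ennreal (exp (- l * z)) \<partial>N)"
    if "sets N = sets borel" for N :: "real measure" and l
    by (rule integral_eq_nn_integral) (auto simp: measurable_cong_sets[OF that refl])
  have setsN: "sets N1 = sets borel" "sets N2 = sets borel" by (simp_all add: N1_def N2_def)
  have finN: "finite_measure N" if "sets N = sets borel" "(\<integral>\<^sup>+z. ennreal (exp (- 0 * z)) \<partial>N) = ennreal a" for N :: "real measure" and a
    using that(2) by (intro finite_measureI) simp
  have "N1 = N2"
  proof (rule laplace_transform_determines_measure[OF finN[OF setsN(1) lap1] finN[OF setsN(2) lap2] setsN])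
    show "AE z in N1. 0 \<le> z"
      unfolding N1_def using Y(2) by (subst AE_distr_iff) auto
    show "AE z in N2. 0 \<le> z"
    proof -
      have "AE z in D \<bind> (\<lambda>\<omega>. K (Y' \<omega>)). 0 \<le> z"
        using S(2) sets_eq_imp_space_eq[OF sets_DK] by (intro AE_I2) (auto simp: space_restrict_space)
      then show ?thesis unfolding N2_def by (subst AE_distr_iff) auto
    qed
    show "(\<integral>z. exp (- l * z) \<partial>N1) = (\<integral>z. exp (- l * z) \<partial>N2)" if "0 \<le> l" for l
      unfolding lapint[OF setsN(1)] lapint[OF setsN(2)] lap1[OF that] lap2[OF that] stepC[OF that] ..
  qed simp_all
  then have "(\<integral>\<^sup>+z. indicator B z \<partial>N1) = (\<integral>\<^sup>+z. indicator B z \<partial>N2)" by simp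
  moreover have "(\<integral>\<^sup>+z. indicator B z \<partial>K (Y' \<omega>)) = emeasure (K (Y' \<omega>)) (B \<inter> S)" if w: "\<omega> \<in> space M" for \<omega>
  proof -
    have sK: "sets (K (Y' \<omega>)) = sets ?R"
      using measurable_space[OF KY w] by (simp add: space_subprob_algebra)
    have BS: "B \<inter> S \<in> sets (K (Y' \<omega>))" unfolding sK using B S(1) by (auto simp: sets_restrict_space)
    have "(\<integral>\<^sup>+z. indicator B z \<partial>K (Y' \<omega>)) = (\<integral>\<^sup>+z. indicator (B \<inter> S) z \<partial>K (Y' \<omega>))"
      using sets_eq_imp_space_eq[OF sK]
      by (intro nn_integral_cong) (auto simp: indicator_def space_restrict_space)
    then show ?thesis using BS by simp
  qed
  ultimately show ?thesis by (simp add: int1 int2 cong: nn_integral_cong_simp)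
qed

end

context prob_space
begin

lemma vimage_subalgebra:
  assumes "f \<in> M \<rightarrow>\<^sub>M N"
  shows "subalgebra M (vimage_algebra (space M) f N)"
    and "sigma_finite_subalgebra M (vimage_algebra (space M) f N)"
    and "sets (vimage_algebra (space M) f N) = {f -` A \<inter> space M |A. A \<in> sets N}"
    and "f \<in> vimage_algebra (space M) f N \<rightarrow>\<^sub>M N"
proof -
  have f: "f \<in> space M \<rightarrow> space N" using assms by (rule measurable_space[THEN funcsetI])
  show sets: "sets (vimage_algebra (space M) f N) = {f -` A \<inter> space M |A. A \<in> sets N}"
    by (rule sets_vimage_algebra2[OF f])
  show sub: "subalgebra M (vimage_algebra (space M) f N)"
    unfolding subalgebra_def sets using measurable_sets[OF assms] by auto
  show "sigma_finite_subalgebra M (vimage_algebra (space M) f N)"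
    using sub by (intro finite_measure_subalgebra_is_sigma_finite)
      (simp add: finite_measure_subalgebra_def finite_measure_subalgebra_axioms_def finite_measure_axioms)
  show "f \<in> vimage_algebra (space M) f N \<rightarrow>\<^sub>M N"
    by (rule measurable_vimage_algebra1[OF f])
qed

text \<open>
  The hypothesis on \<open>Y 0\<close> propagates to all times because the kernel is carried by \<open>S\<close>.
\<close>

lemma markov_chain_on_from_laplace:
  fixes Y :: "nat \<Rightarrow> 'a \<Rightarrow> real" and K :: "real \<Rightarrow> real measure" and \<kappa> :: "real \<Rightarrow> real"
  assumes Y: "\<And>i. Y i \<in> borel_measurable M" "\<And>i \<omega>. 0 \<le> Y i \<omega>"
    and I: "\<And>n. Suc n \<in> I \<Longrightarrow> n \<in> I"
    and S: "S \<in> sets borel" "S \<subseteq> {0..}" "S \<noteq> {}"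
    and K: "K \<in> restrict_space borel S \<rightarrow>\<^sub>M prob_algebra (restrict_space borel S)"
    and \<kappa>: "\<And>l. 0 \<le> l \<Longrightarrow> 0 \<le> \<kappa> l"
    and K_laplace: "\<And>y l. y \<in> S \<Longrightarrow> 0 \<le> l \<Longrightarrow>
      (\<integral>\<^sup>+z. ennreal (exp (- l * z)) \<partial>K y) = ennreal (\<kappa> l * exp (- y * fold_rate l))"
    and init: "AE \<omega> in M. Y 0 \<omega> \<in> S"
    and step: "\<And>n q l. Suc n \<in> I \<Longrightarrow> (\<And>i. 0 \<le> q i) \<Longrightarrow> 0 \<le> l \<Longrightarrow>
      (\<integral>\<omega>. exp (- (\<Sum>i\<le>n. q i * Y i \<omega>)) * exp (- l * Y (Suc n) \<omega>) \<partial>M)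
      = (\<integral>\<omega>. exp (- (\<Sum>i\<le>n. q i * Y i \<omega>)) * (\<kappa> l * exp (- Y n \<omega> * fold_rate l)) \<partial>M)"
  shows "markov_chain_on M I S K Y"
proof -
  let ?R = "restrict_space borel S"
  note [measurable] = Y(1) S(1)
  obtain s where s: "s \<in> S" using S(3) by auto
  define Y' where "Y' n \<omega> = (if Y n \<omega> \<in> S then Y n \<omega> else s)" for n \<omega>
  have Y'S: "Y' n \<omega> \<in> S" for n \<omega> using s by (simp add: Y'_def)
  have Y'meas: "Y' n \<in> F \<rightarrow>\<^sub>M ?R" if [measurable]: "Y n \<in> borel_measurable F" for F n
  proof (rule measurable_restrict_space2)
    show "Y' n \<in> borel_measurable F" unfolding Y'_def[abs_def] by measurable
  qed (use Y'S in auto)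
  have prob_K: "prob_space (K y)" "sets (K y) = sets ?R" if "y \<in> S" for y
    using measurable_space[OF K, of y] that by (auto simp: space_prob_algebra space_restrict_space)
  have Kmeas: "(\<lambda>y. measure (K y) B) \<in> borel_measurable ?R" if "B \<in> sets ?R" for B
  proof -
    have "(\<lambda>y. emeasure (K y) B) \<in> borel_measurable ?R"
      by (rule measurable_compose[OF measurable_prob_algebraD[OF K] measurable_emeasure_subprob_algebra[OF that]])
    then show ?thesis unfolding measure_def by measurable
  qed
  have trans: "(\<integral>\<^sup>+\<omega>. indicator C (sample_path {..n} Y \<omega>) * indicator B (Y (Suc n) \<omega>) \<partial>M)
      = (\<integral>\<^sup>+\<omega>. indicator C (sample_path {..n} Y \<omega>) * emeasure (K (Y' n \<omega>)) (B \<inter> S) \<partial>M)"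
    if "Suc n \<in> I" "AE \<omega> in M. Y' n \<omega> = Y n \<omega>" "C \<in> sets (path_space {..n})" "B \<in> sets borel" for n C B
    by (rule transition_from_laplace[OF Y S(1,2) K \<kappa> K_laplace step Y'meas that(2-4)])
      (use that(1) Y(1) in auto)
  have inS: "AE \<omega> in M. Y n \<omega> \<in> S" if "n \<in> I" for n
    using that
  proof (induction n)
    case 0
    then show ?case using init by simp
  next
    case (Suc n)
    then have "AE \<omega> in M. Y n \<omega> \<in> S" using I by blast
    then have ae: "AE \<omega> in M. Y' n \<omega> = Y n \<omega>" by (rule AE_mp) (simp add: Y'_def)
    have "(\<integral>\<^sup>+\<omega>. indicator S (Y (Suc n) \<omega>) \<partial>M)
        = (\<integral>\<^sup>+\<omega>. indicator (space (path_space {..n})) (sample_path {..n} Y \<omega>) * indicator S (Y (Suc n) \<omega>) \<partial>M)"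
      by (intro nn_integral_cong) (auto simp: sample_path_def space_PiM)
    also have "\<dots> = (\<integral>\<^sup>+\<omega>. indicator (space (path_space {..n})) (sample_path {..n} Y \<omega>) * emeasure (K (Y' n \<omega>)) (S \<inter> S) \<partial>M)"
      using Suc.prems ae by (intro trans) auto
    also have "\<dots> = (\<integral>\<^sup>+\<omega>. 1 \<partial>M)"
    proof (intro nn_integral_cong)
      fix \<omega>
      have "space (K (Y' n \<omega>)) = S"
        using sets_eq_imp_space_eq[OF prob_K(2)[OF Y'S]] by (simp add: space_restrict_space)
      then have "emeasure (K (Y' n \<omega>)) S = 1"
        using prob_space.emeasure_space_1[OF prob_K(1)[OF Y'S, of n \<omega>]] by simp
      then show "indicator (space (path_space {..n})) (sample_path {..n} Y \<omega>) * emeasure (K (Y' n \<omega>)) (S \<inter> S) = 1"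
        by (simp add: sample_path_def space_PiM)
    qed
    finally have "(\<integral>\<^sup>+\<omega>. indicator S (Y (Suc n) \<omega>) \<partial>M) = 1" by (simp add: emeasure_space_1)
    also have "(\<integral>\<^sup>+\<omega>. indicator S (Y (Suc n) \<omega>) \<partial>M) = (\<integral>\<^sup>+\<omega>. indicator {\<omega>\<in>space M. Y (Suc n) \<omega> \<in> S} \<omega> \<partial>M)"
      by (intro nn_integral_cong) (auto simp: indicator_def)
    also have "\<dots> = emeasure M {\<omega>\<in>space M. Y (Suc n) \<omega> \<in> S}" by (intro nn_integral_indicator) measurable
    finally have "prob {\<omega>\<in>space M. Y (Suc n) \<omega> \<in> S} = 1" by (simp add: emeasure_eq_measure)
    then show ?case by (subst prob_Collect_eq_1[symmetric]) measurable
  qed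
  have cond: "AE \<omega> in M. real_cond_exp M (vimage_algebra (space M) (sample_path {..n} Y) (path_space {..n}))
      (indicator (Y (Suc n) -` B \<inter> space M)) \<omega> = measure (K (Y n \<omega>)) B"
    if n: "n \<in> I" "Suc n \<in> I" and B: "B \<in> sets ?R" for n B
  proof -
    let ?p = "sample_path {..n} Y"
    let ?F = "vimage_algebra (space M) ?p (path_space {..n})"
    have p[measurable]: "?p \<in> M \<rightarrow>\<^sub>M path_space {..n}" by (rule sample_path_measurable) simp
    note F = vimage_subalgebra[OF p]
    interpret F: sigma_finite_subalgebra M ?F by (rule F(2))
    have [measurable]: "B \<in> sets borel" and BS: "B \<inter> S = B" using B by (auto simp: sets_restrict_space)
    have ae: "AE \<omega> in M. Y' n \<omega> = Y n \<omega>" using inS[OF n(1)] by (rule AE_mp) (simp add: Y'_def)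
    let ?g = "\<lambda>\<omega>. measure (K (Y' n \<omega>)) B"
    have "(\<lambda>\<omega>. ?p \<omega> n) \<in> borel_measurable ?F"
      by (rule measurable_compose[OF F(4)]) simp
    then have "Y n \<in> borel_measurable ?F" by (simp add: sample_path_def)
    then have gF: "?g \<in> borel_measurable ?F"
      by (rule measurable_compose[OF Y'meas Kmeas[OF B]])
    then have gM[measurable]: "?g \<in> borel_measurable M" by (rule measurable_from_subalg[OF F(1)])
    have g1: "?g \<omega> \<le> 1" for \<omega> using prob_space.prob_le_1[OF prob_K(1)[OF Y'S]] .
    have "AE \<omega> in M. real_cond_exp M ?F (indicator (Y (Suc n) -` B \<inter> space M)) \<omega> = ?g \<omega>"
    proof (rule F.real_cond_exp_charact[OF _ _ _ gF])
      show "integrable M (indicator (Y (Suc n) -` B \<inter> space M) :: 'a \<Rightarrow> real)"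
        by (intro integrable_real_indicator) (auto simp: emeasure_eq_measure)
      show "integrable M ?g" using g1 by (intro integrable_const_bound[where B=1]) auto
      fix A assume "A \<in> sets ?F"
      then obtain C where C[measurable]: "C \<in> sets (path_space {..n})" and A: "A = ?p -` C \<inter> space M"
        unfolding F(3) by auto
      have "(\<integral>\<omega>\<in>A. indicator (Y (Suc n) -` B \<inter> space M) \<omega> \<partial>M)
          = (\<integral>\<omega>. indicator C (?p \<omega>) * indicator B (Y (Suc n) \<omega>) \<partial>M :: real)"
        unfolding set_lebesgue_integral_def A
        by (intro Bochner_Integration.integral_cong) (auto simp: indicator_def)
      also have "\<dots> = enn2real (\<integral>\<^sup>+\<omega>. indicator C (?p \<omega>) * indicator B (Y (Suc n) \<omega>) \<partial>M)"
        by (subst integral_eq_nn_integral) (auto intro!: arg_cong[of _ _ enn2real] nn_integral_cong simp: indicator_def)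
      also have "\<dots> = enn2real (\<integral>\<^sup>+\<omega>. indicator C (?p \<omega>) * emeasure (K (Y' n \<omega>)) (B \<inter> S) \<partial>M)"
        using n ae by (subst trans) auto
      also have "\<dots> = enn2real (\<integral>\<^sup>+\<omega>. ennreal (indicator C (?p \<omega>) * ?g \<omega>) \<partial>M)"
      proof (intro arg_cong[of _ _ enn2real] nn_integral_cong)
        fix \<omega>
        interpret KY: prob_space "K (Y' n \<omega>)" by (rule prob_K(1)[OF Y'S])
        show "indicator C (?p \<omega>) * emeasure (K (Y' n \<omega>)) (B \<inter> S) = ennreal (indicator C (?p \<omega>) * ?g \<omega>)"
          unfolding BS by (simp add: KY.emeasure_eq_measure indicator_def)
      qed
      also have "\<dots> = (\<integral>\<omega>. indicator C (?p \<omega>) * ?g \<omega> \<partial>M)"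
        by (subst integral_eq_nn_integral) auto
      also have "\<dots> = (\<integral>\<omega>\<in>A. ?g \<omega> \<partial>M)"
        unfolding set_lebesgue_integral_def A
        by (intro Bochner_Integration.integral_cong) (auto simp: indicator_def)
      finally show "(\<integral>\<omega>\<in>A. indicator (Y (Suc n) -` B \<inter> space M) \<omega> \<partial>M) = (\<integral>\<omega>\<in>A. ?g \<omega> \<partial>M)" .
    qed
    with ae show ?thesis by eventually_elim simp
  qed
  show ?thesis
    unfolding markov_chain_on_def using K Y(1) inS cond by blast
qed

text \<open>
  Uniqueness is applied first to \<open>R\<close>, weighted by an exponential of \<open>Z\<close>, and then to \<open>Z\<close>, weighted
  by an event of \<open>R\<close>.
\<close>

lemma laplace_factorization_imp_indep:
  fixes R Z :: "nat \<Rightarrow> 'a \<Rightarrow> real"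
  assumes R: "\<And>i. R i \<in> borel_measurable M" "\<And>i \<omega>. 0 \<le> R i \<omega>"
    and Z: "\<And>i. Z i \<in> borel_measurable M" "\<And>i \<omega>. 0 \<le> Z i \<omega>"
    and factor: "\<And>J J' q p. finite J \<Longrightarrow> finite J' \<Longrightarrow> (\<And>i. 0 \<le> q i) \<Longrightarrow> (\<And>i. 0 \<le> p i) \<Longrightarrow>
      (\<integral>\<omega>. exp (- (\<Sum>i\<in>J. q i * R i \<omega>)) * exp (- (\<Sum>i\<in>J'. p i * Z i \<omega>)) \<partial>M)
      = (\<integral>\<omega>. exp (- (\<Sum>i\<in>J. q i * R i \<omega>)) \<partial>M) * (\<integral>\<omega>. exp (- (\<Sum>i\<in>J'. p i * Z i \<omega>)) \<partial>M)"
    and C: "C \<in> sets (path_space UNIV)" "C' \<in> sets (path_space UNIV)"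
  shows "(\<integral>\<omega>. indicator C (sample_path UNIV R \<omega>) * indicator C' (sample_path UNIV Z \<omega>) \<partial>M :: real)
    = (\<integral>\<omega>. indicator C (sample_path UNIV R \<omega>) \<partial>M) * (\<integral>\<omega>. indicator C' (sample_path UNIV Z \<omega>) \<partial>M)"
proof -
  note [measurable] = R(1) Z(1) C
  have [measurable]: "sample_path UNIV R \<in> M \<rightarrow>\<^sub>M path_space UNIV" "sample_path UNIV Z \<in> M \<rightarrow>\<^sub>M path_space UNIV"
    using R(1) Z(1) by (auto intro: sample_path_measurable)
  have 1: "(\<integral>\<omega>. exp (- (\<Sum>i\<in>J'. p i * Z i \<omega>)) * indicator C (sample_path UNIV R \<omega>) \<partial>M)
      = (\<integral>\<omega>. exp (- (\<Sum>i\<in>J'. p i * Z i \<omega>)) \<partial>M) * (\<integral>\<omega>. indicator C (sample_path UNIV R \<omega>) \<partial>M)"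
    if J': "finite J'" "\<And>i. 0 \<le> p i" for J' p
  proof -
    let ?E = "\<integral>\<omega>. exp (- (\<Sum>i\<in>J'. p i * Z i \<omega>)) \<partial>M"
    have "(\<integral>\<omega>. exp (- (\<Sum>i\<in>J'. p i * Z i \<omega>)) * indicator C (sample_path UNIV R \<omega>) \<partial>M)
        = (\<integral>\<omega>. ?E * indicator C (sample_path UNIV R \<omega>) \<partial>M)"
    proof (rule sample_path_laplace_unique[OF R])
      show "exp (- (\<Sum>i\<in>J'. p i * Z i \<omega>)) \<le> 1" for \<omega>
        using J' Z(2) by (simp add: sum_nonneg)
      show "0 \<le> ?E" by (intro integral_nonneg_AE) auto
      show "?E \<le> ?E" ..
      show "(\<integral>\<omega>. exp (- (\<Sum>i\<in>J'. p i * Z i \<omega>)) * exp (- (\<Sum>i\<in>J. q i * R i \<omega>)) \<partial>M)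
          = (\<integral>\<omega>. ?E * exp (- (\<Sum>i\<in>J. q i * R i \<omega>)) \<partial>M)"
        if "finite J" "\<And>i. 0 \<le> q i" for J q
        using factor[of J J' q p, OF that(1) J'(1) that(2) J'(2)] by (simp add: mult.commute)
    qed (use C in auto)
    then show ?thesis by simp
  qed
  let ?P = "\<integral>\<omega>. indicator C (sample_path UNIV R \<omega>) \<partial>M :: real"
  have "(\<integral>\<omega>. indicator C (sample_path UNIV R \<omega>) * indicator C' (sample_path UNIV Z \<omega>) \<partial>M :: real)
      = (\<integral>\<omega>. ?P * indicator C' (sample_path UNIV Z \<omega>) \<partial>M)"
  proof (rule sample_path_laplace_unique[OF Z])
    show "indicator C (sample_path UNIV R \<omega>) \<le> (1::real)" for \<omega> by (simp add: indicator_def)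
    show "0 \<le> ?P" by (intro integral_nonneg_AE) auto
    show "?P \<le> ?P" ..
    show "(\<integral>\<omega>. indicator C (sample_path UNIV R \<omega>) * exp (- (\<Sum>i\<in>J. q i * Z i \<omega>)) \<partial>M)
        = (\<integral>\<omega>. ?P * exp (- (\<Sum>i\<in>J. q i * Z i \<omega>)) \<partial>M)"
      if "finite J" "\<And>i. 0 \<le> q i" for J q
      using 1[of J q, OF that] by (simp add: mult.commute)
  qed (use C in auto)
  then show ?thesis by simp
qed

text \<open>
  The hypothesis says that given the path up to \<open>b\<close>, an exponential functional of the future has
  conditional expectation \<open>exp (- a * Z b)\<close>, a function of the present. Uniqueness extends this from
  exponentials to events: given the present, an event of the past may be replaced by its conditional
  probability when it is integrated against an event of the future.
\<close>

lemma cond_indep_from_collapse: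
  fixes Z :: "nat \<Rightarrow> 'a \<Rightarrow> real"
  assumes Z: "\<And>i. Z i \<in> borel_measurable M" "\<And>i \<omega>. 0 \<le> Z i \<omega>"
    and collapse: "\<And>J q. finite J \<Longrightarrow> (\<And>i. 0 \<le> q i) \<Longrightarrow> \<exists>a\<ge>0. \<forall>J' p. finite J' \<longrightarrow> J' \<subseteq> {..b} \<longrightarrow> (\<forall>i. 0 \<le> p i) \<longrightarrow>
      (\<integral>\<omega>. exp (- (\<Sum>i\<in>J. q i * Z (b + i) \<omega>)) * exp (- (\<Sum>i\<in>J'. p i * Z i \<omega>)) \<partial>M)
      = (\<integral>\<omega>. exp (- a * Z b \<omega>) * exp (- (\<Sum>i\<in>J'. p i * Z i \<omega>)) \<partial>M)"
  shows "cond_indep_var M (vimage_algebra (space M) (Z b) borel)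
    (path_space {..b}) (sample_path {..b} Z) (path_space UNIV) (sample_path UNIV (\<lambda>i. Z (b + i)))"
proof -
  let ?p = "sample_path {..b} Z" and ?r = "sample_path UNIV (\<lambda>i. Z (b + i))"
  let ?F = "vimage_algebra (space M) (Z b) borel"
  note [measurable] = Z(1)
  have p[measurable]: "?p \<in> M \<rightarrow>\<^sub>M path_space {..b}" and r[measurable]: "?r \<in> M \<rightarrow>\<^sub>M path_space UNIV"
    by (rule sample_path_measurable, simp)+
  note F = vimage_subalgebra[OF Z(1)[of b]]
  interpret F: sigma_finite_subalgebra M ?F by (rule F(2))
  have ZbF[measurable]: "Z b \<in> borel_measurable ?F" by (rule F(4))
  have main: "AE \<omega> in M.
      real_cond_exp M ?F (indicator (?p -` B1 \<inter> ?r -` B2 \<inter> space M)) \<omega> =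
      real_cond_exp M ?F (indicator (?p -` B1 \<inter> space M)) \<omega> * real_cond_exp M ?F (indicator (?r -` B2 \<inter> space M)) \<omega>"
    if B1[measurable]: "B1 \<in> sets (path_space {..b})" and B2[measurable]: "B2 \<in> sets (path_space UNIV)" for B1 B2
  proof -
    let ?f1 = "indicator (?p -` B1 \<inter> space M) :: 'a \<Rightarrow> real" and ?f2 = "indicator (?r -` B2 \<inter> space M) :: 'a \<Rightarrow> real"
    have int1: "integrable M ?f1" and int2: "integrable M ?f2"
      by (intro integrable_real_indicator; simp add: emeasure_eq_measure)+
    \<comment> \<open>a version of the conditional probability with values in the unit interval everywhere\<close>
    define c1 where "c1 \<omega> = max 0 (min 1 (real_cond_exp M ?F ?f1 \<omega>))" for \<omega>
    have c1F[measurable]: "c1 \<in> borel_measurable ?F" unfolding c1_def[abs_def] by measurable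
    have c1M[measurable]: "c1 \<in> borel_measurable M" by (rule measurable_from_subalg[OF F(1) c1F])
    have c1b: "0 \<le> c1 \<omega>" "c1 \<omega> \<le> 1" for \<omega> by (auto simp: c1_def)
    have c1: "AE \<omega> in M. real_cond_exp M ?F ?f1 \<omega> = c1 \<omega>"
    proof -
      have "AE \<omega> in M. 0 \<le> real_cond_exp M ?F ?f1 \<omega>"
        by (rule F.real_cond_exp_pos) auto
      moreover have "AE \<omega> in M. real_cond_exp M ?F ?f1 \<omega> \<le> real_cond_exp M ?F (\<lambda>_. 1) \<omega>"
        by (rule F.real_cond_exp_mono) (auto simp: int1 indicator_def)
      moreover have "AE \<omega> in M. real_cond_exp M ?F (\<lambda>_. 1) \<omega> = 1"
        by (rule F.real_cond_exp_F_meas) auto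
      ultimately show ?thesis by eventually_elim (simp add: c1_def)
    qed
    show ?thesis
    proof -
      let ?c2 = "real_cond_exp M ?F ?f2"
      have c2b: "AE \<omega> in M. \<bar>?c2 \<omega>\<bar> \<le> 1"
      proof -
        have "AE \<omega> in M. 0 \<le> ?c2 \<omega>" by (rule F.real_cond_exp_pos) auto
        moreover have "AE \<omega> in M. ?c2 \<omega> \<le> real_cond_exp M ?F (\<lambda>_. 1) \<omega>"
          by (rule F.real_cond_exp_mono) (auto simp: int2 indicator_def)
        moreover have "AE \<omega> in M. real_cond_exp M ?F (\<lambda>_. 1) \<omega> = 1"
          by (rule F.real_cond_exp_F_meas) auto
        ultimately show ?thesis by eventually_elim simp
      qed
      have "AE \<omega> in M. real_cond_exp M ?F (indicator (?p -` B1 \<inter> ?r -` B2 \<inter> space M)) \<omega> = c1 \<omega> * ?c2 \<omega>"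
      proof (rule F.real_cond_exp_charact)
        show "integrable M (indicator (?p -` B1 \<inter> ?r -` B2 \<inter> space M) :: 'a \<Rightarrow> real)"
        proof (rule integrable_real_indicator)
          have "?p -` B1 \<inter> ?r -` B2 \<inter> space M = (?p -` B1 \<inter> space M) \<inter> (?r -` B2 \<inter> space M)" by auto
          also have "\<dots> \<in> sets M" by measurable
          finally show "?p -` B1 \<inter> ?r -` B2 \<inter> space M \<in> sets M" .
        qed (simp add: emeasure_eq_measure)
        show "integrable M (\<lambda>\<omega>. c1 \<omega> * ?c2 \<omega>)"
        proof (rule integrable_const_bound[where B=1])
          show "AE \<omega> in M. norm (c1 \<omega> * ?c2 \<omega>) \<le> 1"
            using c2b by eventually_elim (use c1b in \<open>auto simp: abs_mult intro!: mult_le_one\<close>)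
        qed measurable
        show "(\<lambda>\<omega>. c1 \<omega> * ?c2 \<omega>) \<in> borel_measurable ?F" by measurable
        fix A assume A_F: "A \<in> sets ?F"
        then obtain A' where A'[measurable]: "A' \<in> sets borel" and A: "A = Z b -` A' \<inter> space M"
          unfolding F(3) by auto
        let ?i = "\<lambda>\<omega>. indicator A' (Z b \<omega>) :: real"
        have iF[measurable]: "?i \<in> borel_measurable ?F" by measurable
        have key: "(\<integral>\<omega>. (?i \<omega> * ?f1 \<omega>) * indicator B2 (?r \<omega>) \<partial>M) = (\<integral>\<omega>. (?i \<omega> * c1 \<omega>) * indicator B2 (?r \<omega>) \<partial>M)"
        proof (rule sample_path_laplace_unique[where c=1 and d=1, OF _ _ _ _ _ _ _ _ _ B2])
          fix J :: "nat set" and q :: "nat \<Rightarrow> real" assume J: "finite J" "\<And>i. 0 \<le> q i"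
          let ?Q = "\<lambda>\<omega>. exp (- (\<Sum>i\<in>J. q i * Z (b + i) \<omega>))"
          obtain a where a: "0 \<le> a" and coll: "\<And>J' p. finite J' \<Longrightarrow> J' \<subseteq> {..b} \<Longrightarrow> (\<And>i. 0 \<le> p i) \<Longrightarrow>
              (\<integral>\<omega>. ?Q \<omega> * exp (- (\<Sum>i\<in>J'. p i * Z i \<omega>)) \<partial>M)
              = (\<integral>\<omega>. exp (- a * Z b \<omega>) * exp (- (\<Sum>i\<in>J'. p i * Z i \<omega>)) \<partial>M)"
            using collapse[of J q, OF J] by blast
          let ?e = "\<lambda>\<omega>. exp (- a * Z b \<omega>)"
          have Q1: "?Q \<omega> \<le> 1" and e1: "?e \<omega> \<le> 1" for \<omega>
            using J Z(2) a by (auto intro!: sum_nonneg)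
          have intQ: "integrable M ?Q" and inte: "integrable M ?e"
            using Q1 e1 by (auto intro!: integrable_const_bound[where B=1])
          have star: "(\<integral>\<omega>. ?Q \<omega> * indicator C (?p \<omega>) \<partial>M) = (\<integral>\<omega>. ?e \<omega> * indicator C (?p \<omega>) \<partial>M)"
            if C: "C \<in> sets (path_space {..b})" for C
            by (rule sample_path_laplace_unique[where c=1 and d=1, OF _ _ _ _ _ _ _ _ _ C])
              (use Z Q1 e1 coll in auto)
          have eF: "?e \<in> borel_measurable ?F" by measurable
          \<comment> \<open>the future enters only through the present\<close>
          have condQ: "AE \<omega> in M. real_cond_exp M ?F ?Q \<omega> = ?e \<omega>"
          proof (rule F.real_cond_exp_charact[OF _ intQ inte eF])
            fix D assume "D \<in> sets ?F"
            then obtain D' where D'[measurable]: "D' \<in> sets borel" and D: "D = Z b -` D' \<inter> space M"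
              unfolding F(3) by auto
            let ?C = "{x\<in>space (path_space {..b}). x b \<in> D'}"
            have C: "?C \<in> sets (path_space {..b})" by measurable
            have ind: "indicator ?C (?p \<omega>) = (indicator D \<omega> :: real)" if "\<omega> \<in> space M" for \<omega>
              using that by (auto simp: D sample_path_def indicator_def space_PiM)
            have "(\<integral>\<omega>\<in>D. g \<omega> \<partial>M) = (\<integral>\<omega>. g \<omega> * indicator ?C (?p \<omega>) \<partial>M)" for g :: "'a \<Rightarrow> real"
              unfolding set_lebesgue_integral_def by (intro Bochner_Integration.integral_cong) (auto simp: ind)
            then show "(\<integral>\<omega>\<in>D. ?Q \<omega> \<partial>M) = (\<integral>\<omega>\<in>D. ?e \<omega> \<partial>M)" using star[OF C] by simp
          qed
          let ?C = "B1 \<inter> {x\<in>space (path_space {..b}). x b \<in> A'}"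
          have C: "?C \<in> sets (path_space {..b})" by measurable
          have ind: "indicator ?C (?p \<omega>) = ?i \<omega> * ?f1 \<omega>" if "\<omega> \<in> space M" for \<omega>
            using that by (auto simp: sample_path_def indicator_def space_PiM)
          have "(\<integral>\<omega>. (?i \<omega> * ?f1 \<omega>) * ?Q \<omega> \<partial>M) = (\<integral>\<omega>. ?Q \<omega> * indicator ?C (?p \<omega>) \<partial>M)"
            by (intro Bochner_Integration.integral_cong) (auto simp: ind)
          also have "\<dots> = (\<integral>\<omega>. ?e \<omega> * indicator ?C (?p \<omega>) \<partial>M)" by (rule star[OF C])
          also have "\<dots> = (\<integral>\<omega>. (?i \<omega> * ?e \<omega>) * ?f1 \<omega> \<partial>M)"
            by (intro Bochner_Integration.integral_cong) (auto simp: ind)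
          also have "\<dots> = (\<integral>\<omega>. (?i \<omega> * ?e \<omega>) * real_cond_exp M ?F ?f1 \<omega> \<partial>M)"
          proof (rule F.real_cond_exp_intg(2)[symmetric])
            show "integrable M (\<lambda>\<omega>. ?i \<omega> * ?e \<omega> * ?f1 \<omega>)"
              using e1 by (intro integrable_const_bound[where B=1] AE_I2) (auto simp: indicator_def)
          qed measurable
          also have "\<dots> = (\<integral>\<omega>. (?i \<omega> * c1 \<omega>) * ?e \<omega> \<partial>M)"
            using c1 by (intro integral_cong_AE) (measurable, auto)
          also have "\<dots> = (\<integral>\<omega>. (?i \<omega> * c1 \<omega>) * real_cond_exp M ?F ?Q \<omega> \<partial>M)"
            using condQ by (intro integral_cong_AE) (measurable, auto)
          also have "\<dots> = (\<integral>\<omega>. (?i \<omega> * c1 \<omega>) * ?Q \<omega> \<partial>M)"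
          proof (rule F.real_cond_exp_intg(2))
            show "integrable M (\<lambda>\<omega>. ?i \<omega> * c1 \<omega> * ?Q \<omega>)"
              using Q1 c1b by (intro integrable_const_bound[where B=1] AE_I2)
                (auto simp: indicator_def intro!: mult_le_one)
          qed measurable
          finally show "(\<integral>\<omega>. ?i \<omega> * ?f1 \<omega> * ?Q \<omega> \<partial>M) = (\<integral>\<omega>. ?i \<omega> * c1 \<omega> * ?Q \<omega> \<partial>M)" .
        qed (use Z c1b in \<open>auto simp: indicator_def\<close>)
        have "(\<integral>\<omega>\<in>A. indicator (?p -` B1 \<inter> ?r -` B2 \<inter> space M) \<omega> \<partial>M)
            = (\<integral>\<omega>. (?i \<omega> * ?f1 \<omega>) * indicator B2 (?r \<omega>) \<partial>M)"
          unfolding set_lebesgue_integral_def A by (intro Bochner_Integration.integral_cong) (auto simp: indicator_def)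
        also note key
        also have "(\<integral>\<omega>. (?i \<omega> * c1 \<omega>) * indicator B2 (?r \<omega>) \<partial>M) = (\<integral>\<omega>. (?i \<omega> * c1 \<omega>) * ?f2 \<omega> \<partial>M)"
          by (intro Bochner_Integration.integral_cong) (auto simp: indicator_def)
        also have "\<dots> = (\<integral>\<omega>. (?i \<omega> * c1 \<omega>) * ?c2 \<omega> \<partial>M)"
        proof (rule F.real_cond_exp_intg(2)[symmetric])
          show "integrable M (\<lambda>\<omega>. ?i \<omega> * c1 \<omega> * ?f2 \<omega>)"
            using c1b by (intro integrable_const_bound[where B=1] AE_I2) (auto simp: indicator_def)
        qed measurable
        also have "\<dots> = (\<integral>\<omega>\<in>A. c1 \<omega> * ?c2 \<omega> \<partial>M)"
          unfolding set_lebesgue_integral_def A by (intro Bochner_Integration.integral_cong) (auto simp: indicator_def)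
        finally show "(\<integral>\<omega>\<in>A. indicator (?p -` B1 \<inter> ?r -` B2 \<inter> space M) \<omega> \<partial>M) = (\<integral>\<omega>\<in>A. c1 \<omega> * ?c2 \<omega> \<partial>M)" .
      qed
      with c1 show ?thesis by eventually_elim simp
    qed
  qed
  show ?thesis
    unfolding cond_indep_var_def using p r main by blast
qed

end

section \<open>The continued fraction and the theorem\<close>

text \<open>
  Rates \<open>x\<close> prescribed at consecutive sites act on the first of them like the single rate \<open>effective_rate xs\<close>: a
  continued fraction.
\<close>

primrec effective_rate :: "real list \<Rightarrow> real" where
  "effective_rate [] = 0"
| "effective_rate (x # xs) = x + fold_rate (effective_rate xs)"

lemma effective_rate_nonneg: "(\<And>x. x \<in> set xs \<Longrightarrow> 0 \<le> x) \<Longrightarrow> 0 \<le> effective_rate xs"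
  by (induction xs) (auto intro!: add_nonneg_nonneg fold_rate_bounds)

lemma effective_rate_zero: "(\<And>x. x \<in> set xs \<Longrightarrow> x = 0) \<Longrightarrow> effective_rate xs = 0"
  by (induction xs) auto

lemma effective_rate_append: "effective_rate (xs @ ys) = effective_rate (xs @ [effective_rate ys])"
  by (induction xs) auto

lemma effective_rate_collapse:
  assumes "j \<le> n" "n \<le> N"
  shows "effective_rate (map p [j..<Suc N]) = effective_rate (map (p(n := effective_rate (map p [n..<Suc N]))) [j..<Suc n])"
proof -
  have "[j..<Suc N] = [j..<n] @ [n..<Suc N]"
    using assms upt_add_eq_append[of j n "Suc N - n"] by simp
  then have "effective_rate (map p [j..<Suc N]) = effective_rate (map p [j..<n] @ [effective_rate (map p [n..<Suc N])])"
    by (simp only: map_append effective_rate_append[of _ "map p [n..<Suc N]"])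
  also have "map p [j..<n] @ [effective_rate (map p [n..<Suc N])] = map (p(n := effective_rate (map p [n..<Suc N]))) [j..<Suc n]"
    using assms by simp
  finally show ?thesis .
qed

text \<open>
  The bounded solution of the difference equation at the distances \<open>1, 2, \<dots>\<close> from \<open>b\<close>, with value \<open>1\<close> at
  \<open>b\<close> and constant from distance \<open>N\<close> on. It is the product of its successive ratios, and the ratio
  at a site is \<open>1 - s / (1 + s) = 1 / (1 + s)\<close> for the effective rate \<open>s\<close> from that site outwards.
\<close>

definition profile :: "(nat \<Rightarrow> real) \<Rightarrow> nat \<Rightarrow> nat \<Rightarrow> real" where
  "profile p N i = (\<Prod>j<i. 1 - fold_rate (effective_rate (map p [Suc j..<Suc N])))"

lemma profile_0[simp]: "profile p N 0 = 1"
  by (simp add: profile_def)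

lemma profile_Suc: "profile p N (Suc i) = profile p N i * (1 - fold_rate (effective_rate (map p [Suc i..<Suc N])))"
  by (simp add: profile_def)

lemma profile_1: "profile p N 1 = 1 - fold_rate (effective_rate (map p [1..<Suc N]))"
  by (simp add: profile_def del: upt_Suc)

context
  fixes p :: "nat \<Rightarrow> real" and N :: nat
  assumes p: "\<And>i. 0 \<le> p i"
begin

lemma effective_rate_map_nonneg: "0 \<le> effective_rate (map p [i..<k])"
  using p by (intro effective_rate_nonneg) auto

lemma profile_bounds: "0 \<le> profile p N i" "profile p N i \<le> 1"
  using fold_rate_bounds[OF effective_rate_map_nonneg]
  by (auto simp: profile_def less_imp_le simp del: upt_Suc intro!: prod_nonneg prod_le_1)

text \<open>
  Divided by the middle value, the second-order equation relates two successive ratios \<open>1 / (1 + s)\<close> and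
  \<open>1 - fold_rate t\<close>; it becomes the recursion \<open>s = p (Suc i) + fold_rate t\<close> of the effective rates.
\<close>

lemma profile_equation:
  "profile p N (Suc (Suc i)) + profile p N i - 2 * profile p N (Suc i)
    = (if Suc i \<le> N then p (Suc i) else 0) * profile p N (Suc i)"
proof -
  let ?s = "effective_rate (map p [Suc i..<Suc N])" and ?t = "effective_rate (map p [Suc (Suc i)..<Suc N])"
  have s: "?s = (if Suc i \<le> N then p (Suc i) else 0) + fold_rate ?t"
    by (cases "Suc i \<le> N") (simp_all add: upt_conv_Cons del: upt_Suc)
  have "0 \<le> ?s" by (rule effective_rate_map_nonneg)
  then have "profile p N i = profile p N (Suc i) * (1 + ?s)"
    by (simp add: profile_Suc one_minus_fold_rate)
  moreover have "profile p N (Suc (Suc i)) = profile p N (Suc i) * (1 - fold_rate ?t)"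
    by (rule profile_Suc)
  ultimately have "profile p N (Suc (Suc i)) + profile p N i - 2 * profile p N (Suc i)
      = profile p N (Suc i) * (?s - fold_rate ?t)"
    by (simp only:) (simp add: algebra_simps)
  then show ?thesis using s by simp
qed

end

lemma profile_collapse:
  assumes "b \<le> n" "n \<le> N"
  shows "profile p N b = profile (p(n := effective_rate (map p [n..<Suc N]))) n b"
  unfolding profile_def using assms by (intro prod.cong refl) (subst effective_rate_collapse[of _ n N p], auto)

lemma finite_sum_as_initial_segment:
  fixes q :: "nat \<Rightarrow> real"
  assumes "finite J"
  shows "\<exists>N. \<forall>Y. (\<Sum>i\<in>J. q i * Y i) = (\<Sum>i\<le>N. (if i \<in> J then q i else 0) * Y i)"
proof -
  obtain N where N: "J \<subseteq> {..N}" using assms by (meson finite_nat_iff_bounded_le)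
  have "(\<Sum>i\<in>J. q i * Y i) = (\<Sum>i\<le>N. (if i \<in> J then q i else 0) * Y i)" for Y
    using N by (intro sum.mono_neutral_cong_left) auto
  then show ?thesis by blast
qed

text \<open>
  Local times are indexed by the distance from \<open>b\<close> on either side, so the starting point of
  the walk is \<open>left b\<close>.
\<close>

locale ray_knight = srw M X P
  for M :: "'a measure" and X :: "real \<Rightarrow> 'a \<Rightarrow> int" and P +
  fixes b :: nat and h :: real
  assumes h: "0 < h"
begin

abbreviation "L \<equiv> stopped_local_time X (int b) h"

definition right :: "nat \<Rightarrow> 'a \<Rightarrow> real" where "right i = L (int b + int i)"
definition left :: "nat \<Rightarrow> 'a \<Rightarrow> real" where "left i = L (int b - int i)"

lemma right_measurable: "right i \<in> borel_measurable M" and left_measurable: "left i \<in> borel_measurable M"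
  unfolding right_def left_def using h by (auto intro: stopped_local_time_measurable)

lemma right_nonneg: "0 \<le> right i \<omega>" and left_nonneg: "0 \<le> left i \<omega>"
  unfolding right_def left_def by (rule stopped_local_time_nonneg)+

lemma left_0: "AE \<omega> in M. left 0 \<omega> = h" and right_0: "AE \<omega> in M. right 0 \<omega> = h"
  using stopped_local_time_at_level[of h "int b"] h by (simp_all add: left_def right_def)

text \<open>
  The Laplace functional with \<open>u\<close> assembled from one profile on each side of \<open>b\<close>. The two neighbours
  of \<open>b\<close> give the exponent; the value of \<open>u\<close> at the starting point gives the prefactor.
\<close>

lemma joint_laplace_off_level:
  assumes q: "\<And>i. 0 \<le> q i" and p: "\<And>i. 0 \<le> p i"
  shows "(\<integral>\<omega>. exp (- (\<Sum>i\<in>{1..N}. q i * right i \<omega>) - (\<Sum>i\<in>{1..K}. p i * left i \<omega>)) \<partial>M)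
    = profile p K b * exp (- h * (fold_rate (effective_rate (map q [1..<Suc N])) + fold_rate (effective_rate (map p [1..<Suc K]))))"
proof -
  define u where "u x = (if int b \<le> x then profile q N (nat (x - int b)) else profile p K (nat (int b - x)))" for x
  define w where "w x = (if int b \<le> x then q (nat (x - int b)) else p (nat (int b - x)))" for x
  let ?FR = "(\<lambda>i. int b + int i) ` {1..N}" and ?FL = "(\<lambda>i. int b - int i) ` {1..K}"
  have uR: "u (int b + int i) = profile q N i" for i by (simp add: u_def)
  have uL: "u (int b - int i) = profile p K i" for i by (cases "i = 0") (auto simp: u_def)
  have wR: "w (int b + int i) = q i" for i by (simp add: w_def)
  have wL: "w (int b - int i) = p i" if "0 < i" for i using that by (simp add: w_def)
  have sums: "(\<Sum>x\<in>?FR \<union> ?FL. w x * L x \<omega>)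
      = (\<Sum>i\<in>{1..N}. q i * right i \<omega>) + (\<Sum>i\<in>{1..K}. p i * left i \<omega>)" for \<omega>
  proof -
    have "(\<Sum>x\<in>?FR \<union> ?FL. w x * L x \<omega>) = (\<Sum>x\<in>?FR. w x * L x \<omega>) + (\<Sum>x\<in>?FL. w x * L x \<omega>)"
      by (intro sum.union_disjoint) auto
    also have "(\<Sum>x\<in>?FR. w x * L x \<omega>) = (\<Sum>i\<in>{1..N}. q i * right i \<omega>)"
      by (subst sum.reindex) (auto simp: inj_on_def w_def right_def)
    also have "(\<Sum>x\<in>?FL. w x * L x \<omega>) = (\<Sum>i\<in>{1..K}. p i * left i \<omega>)"
      by (subst sum.reindex) (auto simp: inj_on_def w_def left_def intro!: sum.cong)
    finally show ?thesis .
  qed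
  have "(\<integral>\<omega>. exp (- (\<Sum>x\<in>?FR \<union> ?FL. w x * L x \<omega>)) \<partial>M)
      = u 0 * exp (h * (u (int b + 1) + u (int b - 1) - 2))"
  proof (rule laplace_functional)
    show "0 \<le> u x" "u x \<le> 1" for x
      using profile_bounds[of q, OF q] profile_bounds[of p, OF p] by (auto simp: u_def)
    show "u (int b) = 1" by (simp add: u_def)
    show "0 \<le> w x" for x using q p by (simp add: w_def)
    fix x assume x: "x \<noteq> int b"
    show "u (x + 1) + u (x - 1) - 2 * u x = (if x \<in> ?FR \<union> ?FL then w x else 0) * u x"
    proof (cases "int b < x")
      case True
      then obtain i where i: "x = int b + int (Suc i)" by (metis zless_iff_Suc_zadd)
      have "x \<in> ?FR \<union> ?FL \<longleftrightarrow> Suc i \<le> N" unfolding i by (auto intro!: image_eqI[of _ _ "Suc i"])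
      moreover have "w x = q (Suc i)" unfolding i by (rule wR)
      moreover have "u (x + 1) = profile q N (Suc (Suc i))" "u (x - 1) = profile q N i" "u x = profile q N (Suc i)"
        using uR[of "Suc (Suc i)"] uR[of i] uR[of "Suc i"] by (simp_all add: i add.assoc)
      ultimately show ?thesis using profile_equation[of q N i, OF q] by simp
    next
      case False
      then have "x < int b" using x by simp
      then obtain i where i: "int b = x + int (Suc i)" by (metis zless_iff_Suc_zadd)
      then have i': "x = int b - int (Suc i)" by simp
      have "x \<in> ?FR \<union> ?FL \<longleftrightarrow> Suc i \<le> K" unfolding i' by (auto intro!: image_eqI[of _ _ "Suc i"])
      moreover have "w x = p (Suc i)" unfolding i' by (rule wL) simp
      moreover have "u (x - 1) = profile p K (Suc (Suc i))" "u (x + 1) = profile p K i" "u x = profile p K (Suc i)"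
        using uL[of "Suc (Suc i)"] uL[of i] uL[of "Suc i"] by (simp_all add: i' algebra_simps)
      moreover have "profile p K i + profile p K (Suc (Suc i)) - 2 * profile p K (Suc i)
          = (if Suc i \<le> K then p (Suc i) else 0) * profile p K (Suc i)"
        using profile_equation[of p K i, OF p] by linarith
      ultimately show ?thesis by (simp only:)
    qed
  qed (use h in auto)
  also have "u 0 = profile p K b" using uL[of b] by simp
  also have "u (int b + 1) + u (int b - 1) - 2
      = - (fold_rate (effective_rate (map q [1..<Suc N])) + fold_rate (effective_rate (map p [1..<Suc K])))"
    using uR[of 1] uL[of 1] unfolding profile_1 by simp
  finally show ?thesis unfolding sums by (simp add: right_diff_distrib distrib_left del: upt_Suc)
qed

definition right_laplace :: "(nat \<Rightarrow> real) \<Rightarrow> nat \<Rightarrow> real" where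
  "right_laplace q N = exp (- h * effective_rate (map q [0..<Suc N]))"

text \<open>
  The product \<open>profile p K b\<close> over the sites between \<open>b\<close> and the starting point is what distinguishes the
  left side from the right side.
\<close>

definition left_laplace :: "(nat \<Rightarrow> real) \<Rightarrow> nat \<Rightarrow> real" where
  "left_laplace p K = exp (- h * effective_rate (map p [0..<Suc K])) * profile p K b"

text \<open>
  The index \<open>0\<close> on both sides is the point \<open>b\<close> with the constant local time \<open>h\<close>. The product
  form is the independence of the two sides.
\<close>

lemma joint_laplace:
  assumes q: "\<And>i. 0 \<le> q i" and p: "\<And>i. 0 \<le> p i"
  shows "(\<integral>\<omega>. exp (- (\<Sum>i\<le>N. q i * right i \<omega>)) * exp (- (\<Sum>i\<le>K. p i * left i \<omega>)) \<partial>M)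
    = right_laplace q N * left_laplace p K"
proof -
  note [measurable] = right_measurable left_measurable
  have split: "(\<Sum>i\<le>N. f i) = f 0 + (\<Sum>i\<in>{1..N}. f i)" for f :: "nat \<Rightarrow> real" and N
    by (simp add: atMost_atLeast0 sum.atLeast_Suc_atMost)
  have eff0: "effective_rate (map q [0..<Suc N]) = q 0 + fold_rate (effective_rate (map q [1..<Suc N]))" for q N
    by (simp add: upt_conv_Cons del: upt_Suc)
  have "(\<integral>\<omega>. exp (- (\<Sum>i\<le>N. q i * right i \<omega>)) * exp (- (\<Sum>i\<le>K. p i * left i \<omega>)) \<partial>M)
      = (\<integral>\<omega>. exp (- (q 0 + p 0) * h)
          * exp (- (\<Sum>i\<in>{1..N}. q i * right i \<omega>) - (\<Sum>i\<in>{1..K}. p i * left i \<omega>)) \<partial>M)"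
  proof (rule integral_cong_AE)
    show "AE \<omega> in M. exp (- (\<Sum>i\<le>N. q i * right i \<omega>)) * exp (- (\<Sum>i\<le>K. p i * left i \<omega>))
        = exp (- (q 0 + p 0) * h) * exp (- (\<Sum>i\<in>{1..N}. q i * right i \<omega>) - (\<Sum>i\<in>{1..K}. p i * left i \<omega>))"
      using left_0 right_0
    proof eventually_elim
      case (elim \<omega>)
      then show ?case unfolding split by (simp add: exp_add[symmetric] algebra_simps)
    qed
  qed measurable
  also have "\<dots> = exp (- (q 0 + p 0) * h) * (profile p K b
      * exp (- h * (fold_rate (effective_rate (map q [1..<Suc N])) + fold_rate (effective_rate (map p [1..<Suc K])))))"
    using joint_laplace_off_level[of q p N K, OF q p] by (simp del: upt_Suc)
  also have "\<dots> = right_laplace q N * left_laplace p K"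
    unfolding right_laplace_def left_laplace_def eff0
    by (simp add: exp_add[symmetric] algebra_simps del: upt_Suc)
  finally show ?thesis .
qed

lemma left_laplace_cong: "(\<And>i. i \<le> K \<Longrightarrow> p i = p' i) \<Longrightarrow> left_laplace p K = left_laplace p' K"
  unfolding left_laplace_def profile_def
  by (intro arg_cong2[of _ _ _ _ "(*)"] prod.cong refl arg_cong[of _ _ "\<lambda>x. exp (- h * effective_rate x)"]
      arg_cong[of _ _ "\<lambda>x. 1 - fold_rate (effective_rate x)"] map_cong) auto

lemma left_laplace_zero: "left_laplace (\<lambda>_. 0) K = 1" and right_laplace_zero: "right_laplace (\<lambda>_. 0) N = 1"
proof -
  have z: "effective_rate (map (\<lambda>_. 0) xs) = 0" for xs :: "nat list" by (rule effective_rate_zero) auto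
  show "left_laplace (\<lambda>_. 0) K = 1" "right_laplace (\<lambda>_. 0) N = 1"
    unfolding left_laplace_def right_laplace_def profile_def z by simp_all
qed

lemma laplace_right: "(\<And>i. 0 \<le> q i) \<Longrightarrow> (\<integral>\<omega>. exp (- (\<Sum>i\<le>N. q i * right i \<omega>)) \<partial>M) = right_laplace q N"
  using joint_laplace[of q "\<lambda>_. 0" N 0] by (simp add: left_laplace_zero)

lemma laplace_left: "(\<And>i. 0 \<le> p i) \<Longrightarrow> (\<integral>\<omega>. exp (- (\<Sum>i\<le>K. p i * left i \<omega>)) \<partial>M) = left_laplace p K"
  using joint_laplace[of "\<lambda>_. 0" p 0 K] by (simp add: right_laplace_zero)

lemma effective_rate_last_two: "effective_rate (map (p(Suc n := l)) [n..<Suc (Suc n)]) = p n + fold_rate l"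
  by (simp add: upt_conv_Cons)

lemma effective_rate_merge_last:
  "j \<le> n \<Longrightarrow> effective_rate (map (p(Suc n := l)) [j..<Suc (Suc n)]) = effective_rate (map (p(n := p n + fold_rate l)) [j..<Suc n])"
  unfolding effective_rate_collapse[of j n "Suc n" "p(Suc n := l)", OF _ le_SucI[OF order_refl]] effective_rate_last_two
  by (intro arg_cong[of _ _ effective_rate] map_cong) auto

lemma right_laplace_step: "right_laplace (q(Suc n := l)) (Suc n) = right_laplace (q(n := q n + fold_rate l)) n"
  unfolding right_laplace_def by (simp only: effective_rate_merge_last[OF le0])

text \<open>
  Cutting off the site at distance \<open>n + 1\<close> folds its rate into the one at distance \<open>n\<close>. If \<open>n + 1 \<le> b\<close>,
  a ratio \<open>1 / (1 + l)\<close> of the profile is left over; this is the extra exponential variable of the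
  kernel between \<open>b\<close> and the starting point.
\<close>

lemma left_laplace_step:
  assumes "0 \<le> l"
  shows "left_laplace (p(Suc n := l)) (Suc n)
    = (if n < b then 1 / (1 + l) else 1) * left_laplace (p(n := p n + fold_rate l)) n"
proof -
  let ?p' = "p(n := p n + fold_rate l)"
  have fac: "1 - fold_rate (effective_rate (map (p(Suc n := l)) [Suc j..<Suc (Suc n)]))
      = (1 - fold_rate (effective_rate (map ?p' [Suc j..<Suc n]))) * (if j = n then 1 / (1 + l) else 1)" for j
  proof (cases "Suc j \<le> n")
    case True
    then show ?thesis by (simp add: effective_rate_merge_last del: upt_Suc)
  next
    case False
    then show ?thesis using assms by (cases "j = n") (auto simp: one_minus_fold_rate)
  qed
  have "profile (p(Suc n := l)) (Suc n) b = profile ?p' n b * (\<Prod>j<b. if j = n then 1 / (1 + l) else 1)"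
    unfolding profile_def fac by (rule prod.distrib)
  also have "(\<Prod>j<b. if j = n then 1 / (1 + l) else 1) = (if n < b then 1 / (1 + l) else 1)"
    by (simp add: prod.delta)
  finally show ?thesis
    unfolding left_laplace_def by (simp only: effective_rate_merge_last[OF le0] mult.commute mult.left_commute)
qed

lemma sum_fun_upd:
  fixes q Y :: "nat \<Rightarrow> real"
  shows "(\<Sum>i\<le>Suc n. (q(Suc n := l)) i * Y i) = (\<Sum>i\<le>n. q i * Y i) + l * Y (Suc n)"
    and "(\<Sum>i\<le>n. (q(n := q n + a)) i * Y i) = (\<Sum>i\<le>n. q i * Y i) + a * Y n"
proof -
  have 1: "(\<Sum>i\<le>n. (q(Suc n := l)) i * Y i) = (\<Sum>i\<le>n. q i * Y i)" by (intro sum.cong) auto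
  then show "(\<Sum>i\<le>Suc n. (q(Suc n := l)) i * Y i) = (\<Sum>i\<le>n. q i * Y i) + l * Y (Suc n)" by simp
  have "(\<Sum>i\<le>n. (q(n := q n + a)) i * Y i) = (\<Sum>i\<le>n. q i * Y i + (if i = n then a * Y n else 0))"
    by (intro sum.cong) (auto simp: algebra_simps)
  then show "(\<Sum>i\<le>n. (q(n := q n + a)) i * Y i) = (\<Sum>i\<le>n. q i * Y i) + a * Y n"
    by (simp add: sum.distrib)
qed

lemma right_step:
  assumes q: "\<And>i. 0 \<le> q i" and l: "0 \<le> l"
  shows "(\<integral>\<omega>. exp (- (\<Sum>i\<le>n. q i * right i \<omega>)) * exp (- l * right (Suc n) \<omega>) \<partial>M)
    = (\<integral>\<omega>. exp (- (\<Sum>i\<le>n. q i * right i \<omega>)) * (1 * exp (- right n \<omega> * fold_rate l)) \<partial>M)"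
proof -
  have pos: "0 \<le> (q(Suc n := l)) i" "0 \<le> (q(n := q n + fold_rate l)) i" for i
    using q l fold_rate_bounds(1)[OF l] by simp_all
  have "(\<integral>\<omega>. exp (- (\<Sum>i\<le>n. q i * right i \<omega>)) * exp (- l * right (Suc n) \<omega>) \<partial>M)
      = right_laplace (q(Suc n := l)) (Suc n)"
    using laplace_right[of "q(Suc n := l)" "Suc n", OF pos(1)] unfolding sum_fun_upd(1) by (simp add: exp_add[symmetric])
  also have "\<dots> = right_laplace (q(n := q n + fold_rate l)) n" by (rule right_laplace_step)
  also have "\<dots> = (\<integral>\<omega>. exp (- (\<Sum>i\<le>n. q i * right i \<omega>)) * (1 * exp (- right n \<omega> * fold_rate l)) \<partial>M)"
    using laplace_right[of "q(n := q n + fold_rate l)" n, OF pos(2)] unfolding sum_fun_upd(2)[of q n] minus_add_distrib exp_add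
    by (simp add: mult.commute)
  finally show ?thesis .
qed

lemma left_step:
  assumes p: "\<And>i. 0 \<le> p i" and l: "0 \<le> l"
  shows "(\<integral>\<omega>. exp (- (\<Sum>i\<le>n. p i * left i \<omega>)) * exp (- l * left (Suc n) \<omega>) \<partial>M)
    = (\<integral>\<omega>. exp (- (\<Sum>i\<le>n. p i * left i \<omega>))
        * ((if n < b then 1 / (1 + l) else 1) * exp (- left n \<omega> * fold_rate l)) \<partial>M)"
proof -
  let ?c = "if n < b then 1 / (1 + l) else 1"
  have pos: "0 \<le> (p(Suc n := l)) i" "0 \<le> (p(n := p n + fold_rate l)) i" for i
    using p l fold_rate_bounds(1)[OF l] by simp_all
  have "(\<integral>\<omega>. exp (- (\<Sum>i\<le>n. p i * left i \<omega>)) * exp (- l * left (Suc n) \<omega>) \<partial>M)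
      = left_laplace (p(Suc n := l)) (Suc n)"
    using laplace_left[of "p(Suc n := l)" "Suc n", OF pos(1)] unfolding sum_fun_upd(1) by (simp add: exp_add[symmetric])
  also have "\<dots> = ?c * left_laplace (p(n := p n + fold_rate l)) n" by (rule left_laplace_step[OF l])
  also have "left_laplace (p(n := p n + fold_rate l)) n
      = (\<integral>\<omega>. exp (- (\<Sum>i\<le>n. p i * left i \<omega>)) * exp (- left n \<omega> * fold_rate l) \<partial>M)"
    using laplace_left[of "p(n := p n + fold_rate l)" n, OF pos(2)] unfolding sum_fun_upd(2)[of p n] minus_add_distrib exp_add
    by (simp add: mult.commute)
  finally show ?thesis by (simp add: mult.left_commute)
qed

text \<open>
  Everything beyond the starting point acts as the rate \<open>a\<close> at the starting point, because the prefactor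
  \<open>profile\<close> involves only the effective rates of sites up to there.
\<close>

lemma left_collapse:
  assumes J: "finite J" and q: "\<And>i. 0 \<le> q i"
  shows "\<exists>a\<ge>0. \<forall>J' p. finite J' \<longrightarrow> J' \<subseteq> {..b} \<longrightarrow> (\<forall>i. 0 \<le> p i) \<longrightarrow>
    (\<integral>\<omega>. exp (- (\<Sum>i\<in>J. q i * left (b + i) \<omega>)) * exp (- (\<Sum>i\<in>J'. p i * left i \<omega>)) \<partial>M)
    = (\<integral>\<omega>. exp (- a * left b \<omega>) * exp (- (\<Sum>i\<in>J'. p i * left i \<omega>)) \<partial>M)"
proof -
  define q1 where "q1 i = (if i \<in> J then q i else 0)" for i
  have q1: "0 \<le> q1 i" for i using q by (simp add: q1_def)
  obtain N where N: "\<And>Y. (\<Sum>i\<in>J. q i * Y i) = (\<Sum>i\<le>N. q1 i * Y i)"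
    using finite_sum_as_initial_segment[OF J, of q] unfolding q1_def by blast
  \<comment> \<open>all rates beyond the starting point are folded into one\<close>
  define a where "a = effective_rate (map q1 [0..<Suc N])"
  have a: "0 \<le> a" unfolding a_def using q1 by (intro effective_rate_nonneg) auto
  have "(\<integral>\<omega>. exp (- (\<Sum>i\<in>J. q i * left (b + i) \<omega>)) * exp (- (\<Sum>i\<in>J'. p i * left i \<omega>)) \<partial>M)
    = (\<integral>\<omega>. exp (- a * left b \<omega>) * exp (- (\<Sum>i\<in>J'. p i * left i \<omega>)) \<partial>M)"
    if J': "finite J'" "J' \<subseteq> {..b}" and p: "\<And>i. 0 \<le> p i" for J' p
  proof -
    define p1 where "p1 i = (if i \<in> J' then p i else 0)" for i
    have p1: "0 \<le> p1 i" for i using p by (simp add: p1_def)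
    \<comment> \<open>the starting point, at distance \<open>b\<close>, belongs to both families, so its rates add up\<close>
    define p2 where "p2 i = p1 i + (if b \<le> i then q1 (i - b) else 0)" for i
    have p2: "0 \<le> p2 i" for i using p1 q1 by (simp add: p2_def)
    have sum1: "(\<Sum>i\<in>J'. p i * left i \<omega>) = (\<Sum>i\<le>b. p1 i * left i \<omega>)" for \<omega>
      using J' by (intro sum.mono_neutral_cong_left) (auto simp: p1_def)
    have sum2: "(\<Sum>i\<le>b + N. p2 i * left i \<omega>) = (\<Sum>i\<in>J'. p i * left i \<omega>) + (\<Sum>i\<in>J. q i * left (b + i) \<omega>)" for \<omega>
    proof -
      have "(\<Sum>i\<le>b + N. p1 i * left i \<omega>) = (\<Sum>i\<in>J'. p i * left i \<omega>)"
        using J' by (intro sum.mono_neutral_cong_right) (auto simp: p1_def)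
      moreover have "(\<Sum>i\<le>b + N. (if b \<le> i then q1 (i - b) else 0) * left i \<omega>)
          = (\<Sum>i\<in>(\<lambda>i. b + i) ` {..N}. q1 (i - b) * left i \<omega>)"
      proof (rule sum.mono_neutral_cong_right)
        show "\<forall>i\<in>{..b + N} - (\<lambda>i. b + i) ` {..N}. (if b \<le> i then q1 (i - b) else 0) * left i \<omega> = 0"
        proof
          fix i assume "i \<in> {..b + N} - (\<lambda>i. b + i) ` {..N}"
          then have "\<not> b \<le> i" by (auto simp: image_iff) (metis add_le_cancel_left atMost_iff le_add_diff_inverse)
          then show "(if b \<le> i then q1 (i - b) else 0) * left i \<omega> = 0" by simp
        qed
      qed auto
      moreover have "\<dots> = (\<Sum>i\<le>N. q1 i * left (b + i) \<omega>)"
        by (subst sum.reindex) (auto simp: inj_on_def)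
      ultimately show ?thesis unfolding p2_def distrib_right sum.distrib N by simp
    qed
    have "effective_rate (map p2 [b..<Suc (b + N)]) = p1 b + a"
    proof -
      have "map p2 [Suc b..<Suc (b + N)] = map q1 [1..<Suc N]"
        using J' by (intro nth_equalityI) (auto simp: p2_def p1_def subset_eq simp del: upt_Suc)
      then show ?thesis
        by (simp add: a_def upt_conv_Cons p2_def del: upt_Suc)
    qed
    then have collapse: "left_laplace p2 (b + N) = left_laplace (p1(b := p1 b + a)) b"
    proof -
      assume e: "effective_rate (map p2 [b..<Suc (b + N)]) = p1 b + a"
      have "left_laplace p2 (b + N) = left_laplace (p2(b := p1 b + a)) b"
        unfolding left_laplace_def
        using effective_rate_collapse[of 0 b "b + N" p2] profile_collapse[of b b "b + N" p2] by (simp only: e le_add1 le0 order_refl simp_thms)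
      also have "\<dots> = left_laplace (p1(b := p1 b + a)) b"
        by (rule left_laplace_cong) (auto simp: p2_def)
      finally show ?thesis .
    qed
    have "(\<integral>\<omega>. exp (- (\<Sum>i\<in>J. q i * left (b + i) \<omega>)) * exp (- (\<Sum>i\<in>J'. p i * left i \<omega>)) \<partial>M)
        = (\<integral>\<omega>. exp (- (\<Sum>i\<le>b + N. p2 i * left i \<omega>)) \<partial>M)"
      unfolding sum2 minus_add_distrib exp_add by (simp only: mult.commute)
    also have "\<dots> = left_laplace p2 (b + N)" by (rule laplace_left[OF p2])
    also have "\<dots> = (\<integral>\<omega>. exp (- (\<Sum>i\<le>b. (p1(b := p1 b + a)) i * left i \<omega>)) \<partial>M)"
      unfolding collapse using p1 a by (intro laplace_left[symmetric]) simp
    also have "\<dots> = (\<integral>\<omega>. exp (- a * left b \<omega>) * exp (- (\<Sum>i\<in>J'. p i * left i \<omega>)) \<partial>M)"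
      unfolding sum_fun_upd(2)[of p1 b] sum1 minus_add_distrib exp_add by (simp add: mult.commute)
    finally show ?thesis .
  qed
  with a show ?thesis by blast
qed

lemma between_chain: "markov_chain_on M {..b} {0<..} between_kernel left"
proof (rule markov_chain_on_from_laplace[where \<kappa> = "\<lambda>l. 1 / (1 + l)"])
  show "AE \<omega> in M. left 0 \<omega> \<in> {0<..}" using left_0 h by (auto elim!: eventually_mono)
  show "(\<integral>\<^sup>+z. ennreal (exp (- l * z)) \<partial>between_kernel y) = ennreal (1 / (1 + l) * exp (- y * fold_rate l))"
    if "y \<in> {0<..}" "0 \<le> l" for y l
    using laplace_between_kernel[of y l] that by (simp add: fold_rate_def)
  show "(\<integral>\<omega>. exp (- (\<Sum>i\<le>n. q i * left i \<omega>)) * exp (- l * left (Suc n) \<omega>) \<partial>M)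
      = (\<integral>\<omega>. exp (- (\<Sum>i\<le>n. q i * left i \<omega>)) * (1 / (1 + l) * exp (- left n \<omega> * fold_rate l)) \<partial>M)"
    if "Suc n \<in> {..b}" "\<And>i. 0 \<le> q i" "0 \<le> l" for n q l
    using left_step[of q l n, OF that(2,3)] that(1) by simp
qed (auto simp: left_measurable left_nonneg between_kernel_measurable)

lemma right_chain: "markov_chain_on M UNIV {0..} outer_kernel right"
proof (rule markov_chain_on_from_laplace[where \<kappa> = "\<lambda>_. 1"])
  show "(\<integral>\<^sup>+z. ennreal (exp (- l * z)) \<partial>outer_kernel y) = ennreal (1 * exp (- y * fold_rate l))"
    if "y \<in> {0..}" "0 \<le> l" for y l
    using laplace_outer_kernel[of y l] that by (simp add: fold_rate_def)
  show "(\<integral>\<omega>. exp (- (\<Sum>i\<le>n. q i * right i \<omega>)) * exp (- l * right (Suc n) \<omega>) \<partial>M)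
      = (\<integral>\<omega>. exp (- (\<Sum>i\<le>n. q i * right i \<omega>)) * (1 * exp (- right n \<omega> * fold_rate l)) \<partial>M)"
    if "\<And>i. 0 \<le> q i" "0 \<le> l" for n q l
    by (rule right_step[OF that])
qed (auto simp: right_measurable right_nonneg outer_kernel_measurable)

lemma left_chain: "markov_chain_on M UNIV {0..} outer_kernel (\<lambda>i. left (b + i))"
proof (rule markov_chain_on_from_laplace[where \<kappa> = "\<lambda>_. 1"])
  show "(\<integral>\<^sup>+z. ennreal (exp (- l * z)) \<partial>outer_kernel y) = ennreal (1 * exp (- y * fold_rate l))"
    if "y \<in> {0..}" "0 \<le> l" for y l
    using laplace_outer_kernel[of y l] that by (simp add: fold_rate_def)
  show "(\<integral>\<omega>. exp (- (\<Sum>i\<le>n. q i * left (b + i) \<omega>)) * exp (- l * left (b + Suc n) \<omega>) \<partial>M)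
      = (\<integral>\<omega>. exp (- (\<Sum>i\<le>n. q i * left (b + i) \<omega>)) * (1 * exp (- left (b + n) \<omega> * fold_rate l)) \<partial>M)"
    if q: "\<And>i. 0 \<le> q i" and l: "0 \<le> l" for n q l
  proof -
    define p where "p i = (if b \<le> i then q (i - b) else 0)" for i
    have p: "0 \<le> p i" for i using q by (simp add: p_def)
    have "(\<Sum>i\<le>b + n. p i * left i \<omega>) = (\<Sum>i\<le>n. q i * left (b + i) \<omega>)" for \<omega>
    proof -
      have "(\<Sum>i\<le>b + n. p i * left i \<omega>) = (\<Sum>i\<in>{b..b + n}. p i * left i \<omega>)"
        by (intro sum.mono_neutral_right) (auto simp: p_def)
      also have "\<dots> = (\<Sum>i\<le>n. p (b + i) * left (b + i) \<omega>)"
        using sum.shift_bounds_cl_nat_ivl[of "\<lambda>i. p i * left i \<omega>" 0 b n]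
        by (simp add: add.commute atMost_atLeast0)
      finally show ?thesis by (simp add: p_def)
    qed
    then show ?thesis using left_step[of p l "b + n", OF p l] by simp
  qed
qed (auto simp: left_measurable left_nonneg outer_kernel_measurable)

lemma right_left_independent:
  assumes C: "C \<in> sets (path_space UNIV)" "C' \<in> sets (path_space UNIV)"
  shows "(\<integral>\<omega>. indicator C (sample_path UNIV right \<omega>) * indicator C' (sample_path UNIV left \<omega>) \<partial>M :: real)
    = (\<integral>\<omega>. indicator C (sample_path UNIV right \<omega>) \<partial>M) * (\<integral>\<omega>. indicator C' (sample_path UNIV left \<omega>) \<partial>M)"
proof (rule laplace_factorization_imp_indep[OF right_measurable right_nonneg left_measurable left_nonneg _ C])
  fix J J' :: "nat set" and q p :: "nat \<Rightarrow> real"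
  assume J: "finite J" "finite J'" and q: "\<And>i. 0 \<le> q i" and p: "\<And>i. 0 \<le> p i"
  define q1 where "q1 i = (if i \<in> J then q i else 0)" for i
  define p1 where "p1 i = (if i \<in> J' then p i else 0)" for i
  have pos: "0 \<le> q1 i" "0 \<le> p1 i" for i using q p by (simp_all add: q1_def p1_def)
  obtain N where N: "\<And>Y. (\<Sum>i\<in>J. q i * Y i) = (\<Sum>i\<le>N. q1 i * Y i)"
    using finite_sum_as_initial_segment[OF J(1), of q] unfolding q1_def by blast
  obtain K where K: "\<And>Y. (\<Sum>i\<in>J'. p i * Y i) = (\<Sum>i\<le>K. p1 i * Y i)"
    using finite_sum_as_initial_segment[OF J(2), of p] unfolding p1_def by blast
  show "(\<integral>\<omega>. exp (- (\<Sum>i\<in>J. q i * right i \<omega>)) * exp (- (\<Sum>i\<in>J'. p i * left i \<omega>)) \<partial>M)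
      = (\<integral>\<omega>. exp (- (\<Sum>i\<in>J. q i * right i \<omega>)) \<partial>M) * (\<integral>\<omega>. exp (- (\<Sum>i\<in>J'. p i * left i \<omega>)) \<partial>M)"
    unfolding N K using pos by (simp only: joint_laplace laplace_right laplace_left)
qed

text \<open>
  Both the chain between and the chain left of the starting point are read off from the one process
  \<open>left\<close>, which makes the independence from the right a statement about two processes.
\<close>

lemma chains_independent:
  "independent_chains M b left right (\<lambda>i. left (b + i))"
proof -
  let ?R = "sample_path UNIV right" and ?Z = "sample_path UNIV left"
  let ?pair = "\<lambda>\<omega>. (sample_path {..b} left \<omega>, sample_path UNIV (\<lambda>i. left (b + i)) \<omega>)"
  let ?PP = "path_space {..b} \<Otimes>\<^sub>M path_space UNIV"
  \<comment> \<open>both chains on the left are functions of the one process \<open>left\<close>\<close>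
  define \<Phi> :: "(nat \<Rightarrow> real) \<Rightarrow> (nat \<Rightarrow> real) \<times> (nat \<Rightarrow> real)" where "\<Phi> z = (restrict z {..b}, \<lambda>i. z (b + i))" for z
  have pair: "?pair = (\<lambda>\<omega>. \<Phi> (?Z \<omega>))"
    by (auto simp: \<Phi>_def sample_path_def fun_eq_iff)
  have \<Phi>: "\<Phi> \<in> path_space UNIV \<rightarrow>\<^sub>M ?PP"
    unfolding \<Phi>_def
  proof (rule measurable_Pair)
    show "(\<lambda>z. restrict z {..b}) \<in> path_space UNIV \<rightarrow>\<^sub>M path_space {..b}"
      by (rule measurable_restrict_subset) simp
    show "(\<lambda>z i. z (b + i)) \<in> path_space UNIV \<rightarrow>\<^sub>M path_space UNIV"
      by (rule measurable_PiM_single') (auto simp: space_PiM)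
  qed
  have R: "?R \<in> M \<rightarrow>\<^sub>M path_space UNIV" and Z: "?Z \<in> M \<rightarrow>\<^sub>M path_space UNIV"
    by (auto intro: sample_path_measurable right_measurable left_measurable)
  have pm: "?pair \<in> M \<rightarrow>\<^sub>M ?PP" unfolding pair by (rule measurable_compose[OF Z \<Phi>])
  have "indep_set (sets (vimage_algebra (space M) ?R (path_space UNIV))) (sets (vimage_algebra (space M) ?pair ?PP))"
    unfolding vimage_subalgebra(3)[OF R] vimage_subalgebra(3)[OF pm]
  proof (rule indep_setI)
    show "{?R -` A \<inter> space M |A. A \<in> sets (path_space UNIV)} \<subseteq> events" using measurable_sets[OF R] by auto
    show "{?pair -` A \<inter> space M |A. A \<in> sets ?PP} \<subseteq> events" using measurable_sets[OF pm] by auto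
    fix A D assume "A \<in> {?R -` A \<inter> space M |A. A \<in> sets (path_space UNIV)}" "D \<in> {?pair -` A \<inter> space M |A. A \<in> sets ?PP}"
    then obtain C D' where C: "C \<in> sets (path_space UNIV)" and A: "A = ?R -` C \<inter> space M"
      and D': "D' \<in> sets ?PP" and D: "D = ?pair -` D' \<inter> space M" by auto
    define C' where "C' = \<Phi> -` D' \<inter> space (path_space UNIV)"
    have C': "C' \<in> sets (path_space UNIV)" unfolding C'_def by (rule measurable_sets[OF \<Phi> D'])
    have DC: "D = ?Z -` C' \<inter> space M"
      unfolding D pair C'_def using measurable_space[OF Z] by auto
    have AM: "A \<in> events" and DM: "D \<in> events"
      unfolding A DC using measurable_sets[OF R C] measurable_sets[OF Z C'] by auto
    have "prob A = (\<integral>\<omega>. indicator C (?R \<omega>) \<partial>M)" "prob D = (\<integral>\<omega>. indicator C' (?Z \<omega>) \<partial>M)"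
      "prob (A \<inter> D) = (\<integral>\<omega>. indicator C (?R \<omega>) * indicator C' (?Z \<omega>) \<partial>M)"
    proof -
      have "(\<integral>\<omega>. indicator C (?R \<omega>) \<partial>M) = (\<integral>\<omega>. indicator A \<omega> \<partial>M :: real)"
        unfolding A by (intro Bochner_Integration.integral_cong) (auto simp: indicator_def)
      then show "prob A = (\<integral>\<omega>. indicator C (?R \<omega>) \<partial>M)" using AM by simp
      have "(\<integral>\<omega>. indicator C' (?Z \<omega>) \<partial>M) = (\<integral>\<omega>. indicator D \<omega> \<partial>M :: real)"
        unfolding DC by (intro Bochner_Integration.integral_cong) (auto simp: indicator_def)
      then show "prob D = (\<integral>\<omega>. indicator C' (?Z \<omega>) \<partial>M)" using DM by simp
      have "(\<integral>\<omega>. indicator C (?R \<omega>) * indicator C' (?Z \<omega>) \<partial>M) = (\<integral>\<omega>. indicator (A \<inter> D) \<omega> \<partial>M :: real)"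
        unfolding A DC by (intro Bochner_Integration.integral_cong) (auto simp: indicator_def)
      then show "prob (A \<inter> D) = (\<integral>\<omega>. indicator C (?R \<omega>) * indicator C' (?Z \<omega>) \<partial>M)"
        using sets.Int[OF AM DM] by simp
    qed
    then show "prob (A \<inter> D) = prob A * prob D" using right_left_independent[OF C C'] by simp
  qed
  moreover have "cond_indep_var M (vimage_algebra (space M) (left b) borel)
      (path_space {..b}) (sample_path {..b} left) (path_space UNIV) (sample_path UNIV (\<lambda>i. left (b + i)))"
    using left_collapse by (intro cond_indep_from_collapse left_measurable left_nonneg) blast
  ultimately show ?thesis by (simp add: independent_chains_def)
qed

end

theorem theorem4p1:
  fixes M :: "'a measure" and X :: "real \<Rightarrow> 'a \<Rightarrow> int" and b :: nat and h :: real
  assumes "ctmc M srw_generator 0 X"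
    and "b \<ge> 1"
    and "h > 0"
  defines "L \<equiv> stopped_local_time X (int b) h"
  shows
    "(markov_chain_on M {..b} {0<..} between_kernel (\<lambda>x. L (int b - int x)) \<and>
      (AE \<omega> in M. L (int b) \<omega> = h)) \<and>
     (markov_chain_on M UNIV {0..} outer_kernel (\<lambda>x. L (int b + int x)) \<and>
      markov_chain_on M UNIV {0..} outer_kernel (\<lambda>x. L (- int x))) \<and>
     independent_chains M b
       (\<lambda>x. L (int b - int x)) (\<lambda>x. L (int b + int x)) (\<lambda>x. L (- int x))"
proof -
  obtain P where P: "transition_function P" "has_generator P srw_generator"
    and fdd: "\<And>n (t :: nat \<Rightarrow> real) x. 0 \<le> t 0 \<Longrightarrow> (\<forall>i\<le>n. t i \<le> t (Suc i)) \<Longrightarrow>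
          measure M {\<omega>\<in>space M. \<forall>i\<le>Suc n. X (t i) \<omega> = x i} =
          measure M {\<omega>\<in>space M. \<forall>i\<le>n. X (t i) \<omega> = x i} * P (t (Suc n) - t n) (x n) (x (Suc n))"
    using assms(1) unfolding ctmc_def by blast
  interpret prob_space M using assms(1) by (simp add: ctmc_def)
  interpret ray_knight M X P b h
  proof
    show "X t \<in> M \<rightarrow>\<^sub>M count_space UNIV" if "0 \<le> t" for t
      using assms(1) that by (simp add: ctmc_def)
    show "\<forall>\<^sub>F s in at_right t. X s \<omega> = X t \<omega>" if "\<omega> \<in> space M" "0 \<le> t" for \<omega> t
      using assms(1) that by (simp add: ctmc_def)
    show "AE \<omega> in M. X 0 \<omega> = 0" using assms(1) by (simp add: ctmc_def)
  qed (use P fdd assms(3) in auto)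
  have "(\<lambda>x. L (int b - int x)) = left" "(\<lambda>x. L (int b + int x)) = right" "(\<lambda>x. L (- int x)) = (\<lambda>i. left (b + i))"
    by (auto simp: L_def left_def right_def fun_eq_iff)
  moreover have "AE \<omega> in M. L (int b) \<omega> = h" using left_0 by (simp add: left_def L_def)
  ultimately show ?thesis
    using between_chain right_chain left_chain chains_independent by simp
qed

end
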